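(* Let $d\in\{1,2\}$, $\alpha\in[d;2]$, let $(\Delta,F,\nu)$ be a probability preserving dynamical system with transfer operator $P$, let $\Psi:\Delta\to\mathbb Z^d$, $S_n:=\sum_{k=0}^{n-1}\Psi\circ F^k$ and $Q_{n,a}:=P^n(\mathbf 1_{\{S_n=a\}}\,\cdot\,)$ for $a\in\mathbb Z^d$, $n\ge0$. Assume that Hypothesis A (stated in the context) holds, with sequences $(\mathfrak a_n)_{n\ge0}$, $\mathfrak A_n=\sum_{k=0}^n\mathfrak a_k^{-d}$, Banach space $\mathcal B$ and constant $\Phi(0)>0$. Then $$\Big(\frac1{\mathfrak A_n}\sum_{k=0}^{n-1}\mathbf 1_{\{S_k=0\}}\Big)_{n\ge1}$$ converges in distribution (and in the sense of moments), with respect to $\nu$, to $\Phi(0)\mathcal Y$, where $\mathcal Y$ has the Mittag-Leffler distribution of index $\frac{\alpha-d}\alpha$, i.e. for every integer $N\geq 0$ $$\mathbb E[\mathcal Y^N]=N!\,\frac{\Gamma(1+\frac{\alpha-d}\alpha)^N}{\Gamma(1+N\frac{\alpha-d}\alpha)}.$$ If furthermore $(\beta_\ell)_{\ell\in\mathbb Z^d}$ is a family of real numbers with $\sum_{\ell\in\mathbb Z^d}(1+|\ell|)^\eta|\beta_\ell|<\infty$, where $\eta:=\frac{\alpha+\varepsilon-d}2$ for some $\varepsilon\in(0,1/2)$, and $\sum_{\ell\in\mathbb Z^d}\beta_\ell=0$, and if Hypothesis B (stated in the context) holds, then $$\Big(\frac1{\sqrt{\mathfrak A_n}}\sum_{k=0}^{n-1}\beta_{S_k}\Big)_{n\ge1}$$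 converges in distribution (and in the sense of moments), with respect to $\nu$, to $\sqrt{\sigma_\beta^2\,\Phi(0)\,\mathcal Y}\;\mathcal N$, where $\mathcal N$ is a standard Gaussian random variable independent of $\mathcal Y$ and where $$\sigma_\beta^2:=\sum_{k\in\mathbb Z}\sum_{a,b\in\mathbb Z^d}\beta_a\beta_b\,\nu(S_{|k|}=b-a)$$ $$=\sum_{k\in\mathbb Z}\sum_{a,b\in\mathbb Z^d}\beta_a\beta_b\Big(\nu(S_{|k|}=b-a)-\nu(S_{|k|}=b)-\nu(S_{|k|}=-a)+\nu(S_{|k|}=0)\Big).$$
   Context: The transfer operator $P$ of $(\Delta,F,\nu)$ is defined on $L^1(\nu)$ by $\int P(h)\,g\,d\nu=\int h\cdot g\circ F\,d\nu$ for bounded measurable $g$. The notation $\|\cdot\|_{\mathcal B}$ applied to an operator denotes its operator norm in $\mathcal L(\mathcal B)$, and $\hookrightarrow$ means continuous inclusion. Hypothesis A. There exist a $(1/\alpha)$-regularly varying sequence $(\mathfrak a_n)_{n\ge0}$ of positive numbers such that $\mathfrak A_n:=\sum_{k=0}^n\mathfrak a_k^{-d}\to+\infty$ as $n\to+\infty$, a Banach space $(\mathcal B,\|\cdot\|_{\mathcal B})$ preserved by the operators $Q_{n,a}$, with $\mathbf 1_\Delta\in\mathcal B\hookrightarrow L^1(\nu)$, and a real number $\Phi(0)>0$ such that $$\|Q_{n,0}\|_{\mathcal B}=\mathcal O(\mathfrak a_n^{-d}),\qquad Q_{n,0}=\Phi(0)\,\mathfrak a_n^{-d}\,\mathbb E_\nu[\cdot]+o(\mathfrak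 a_n^{-d})\quad\text{in }\mathcal L(\mathcal B\to L^1(\nu)).$$ Hypothesis B. Hypothesis A holds and, in addition, $\sup_{a\in\mathbb Z^d}\|Q_{k,a}\|_{\mathcal B}=\mathcal O(\mathfrak a_k^{-d})$ and, for all $\eta\in[0;1]$, uniformly in $a,b\in\mathbb Z^d$, $$\|Q_{k,b}-Q_{k,a}\|_{\mathcal B}=\mathcal O\big(|b-a|^\eta\,\mathfrak a_k^{-d-\eta}\big),$$ $$\|Q_{k,b-a}-Q_{k,b}-Q_{k,-a}+Q_{k,0}\|_{\mathcal B}=\mathcal O\big((|a||b|)^\eta\,\mathfrak a_k^{-d-2\eta}\big).$$ *)

theory Defs
  imports "HOL-Probability.Probability" "HOL-Library.Landau_Symbols"
begin

text \<open>The lattice \<open>\<int>\<^sup>d\<close> is the type \<^typ>\<open>int ^ 'd\<close> with \<open>d = CARD('d)\<close>; it carries no norm in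
  the library, so the Euclidean one is pulled back from \<^typ>\<open>real ^ 'd\<close>.\<close>

definition lattice_norm :: "int ^ 'd \<Rightarrow> real" where
  "lattice_norm a = norm ((\<chi> i. real_of_int (a $ i)) :: real ^ 'd)"

definition regularly_varying_seq :: "real \<Rightarrow> (nat \<Rightarrow> real) \<Rightarrow> bool" where
  "regularly_varying_seq \<rho> u \<longleftrightarrow>
     (\<forall>c>0. (\<lambda>n. u (nat \<lfloor>c * real n\<rfloor>) / u n) \<longlonglongrightarrow> c powr \<rho>)"

definition A_sum :: "nat \<Rightarrow> (nat \<Rightarrow> real) \<Rightarrow> nat \<Rightarrow> real" where
  "A_sum d u n = (\<Sum>k\<le>n. 1 / u k ^ d)"

definition pp_dynamical_system :: "'s measure \<Rightarrow> ('s \<Rightarrow> 's) \<Rightarrow> bool" where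
  "pp_dynamical_system M F \<longleftrightarrow> prob_space M \<and> F \<in> measurable M M \<and> distr M M F = M"

text \<open>Elements of \<open>L\<^sup>1\<close> are represented by integrable complex-valued functions, and equalities
  in \<open>L\<^sup>1\<close> are almost everywhere equalities. An operator on \<open>L\<^sup>1\<close> is a map on representatives;
  the duality relation determines the transfer operator up to null sets.\<close>

definition transfer_operator ::
    "'s measure \<Rightarrow> ('s \<Rightarrow> 's) \<Rightarrow> (('s \<Rightarrow> complex) \<Rightarrow> ('s \<Rightarrow> complex)) \<Rightarrow> bool" where
  "transfer_operator M F P \<longleftrightarrow>
     (\<forall>h. integrable M h \<longrightarrow>
        integrable M (P h) \<and>
        (\<forall>g \<in> borel_measurable M. bounded (g ` space M) \<longrightarrow>
           (\<integral>x. P h x * g x \<partial>M) = (\<integral>x. h x * g (F x) \<partial>M)))"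

definition birkhoff :: "('s \<Rightarrow> 's) \<Rightarrow> ('s \<Rightarrow> int ^ 'd) \<Rightarrow> nat \<Rightarrow> 's \<Rightarrow> int ^ 'd" where
  "birkhoff F \<Psi> n x = (\<Sum>k<n. \<Psi> ((F ^^ k) x))"

definition Q_op ::
    "('s \<Rightarrow> 's) \<Rightarrow> (('s \<Rightarrow> complex) \<Rightarrow> ('s \<Rightarrow> complex)) \<Rightarrow> ('s \<Rightarrow> int ^ 'd) \<Rightarrow>
     nat \<Rightarrow> int ^ 'd \<Rightarrow> ('s \<Rightarrow> complex) \<Rightarrow> ('s \<Rightarrow> complex)" where
  "Q_op F P \<Psi> n a h = (P ^^ n) (\<lambda>x. of_bool (birkhoff F \<Psi> n x = a) * h x)"

text \<open>A Banach space \<open>B\<close> continuously included in \<open>L\<^sup>1\<close> is a type of class \<^class>\<open>banach\<close> together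
  with a map \<open>J\<close> sending each element to a representative of its class. Only real-linearity is
  required, and the functions may be complex-valued; this covers real Banach spaces of real
  functions as well as complex Banach spaces of complex functions.\<close>

definition L1_inclusion :: "'s measure \<Rightarrow> ('b::banach \<Rightarrow> 's \<Rightarrow> complex) \<Rightarrow> bool" where
  "L1_inclusion M J \<longleftrightarrow>
     (\<forall>u. integrable M (J u)) \<and>
     (\<forall>u v. AE x in M. J (u + v) x = J u x + J v x) \<and>
     (\<forall>c u. AE x in M. J (c *\<^sub>R u) x = c *\<^sub>R J u x) \<and>
     (\<forall>u. (AE x in M. J u x = 0) \<longrightarrow> u = 0) \<and>
     (\<exists>C. \<forall>u. (\<integral>x. norm (J u x) \<partial>M) \<le> C * norm u)"

definition preserved_by ::
    "'s measure \<Rightarrow> ('b \<Rightarrow> 's \<Rightarrow> complex) \<Rightarrow> (('s \<Rightarrow> complex) \<Rightarrow> ('s \<Rightarrow> complex)) \<Rightarrow> bool" where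
  "preserved_by M J T \<longleftrightarrow> (\<forall>u. \<exists>v. AE x in M. J v x = T (J u) x)"

definition restrict_op ::
    "'s measure \<Rightarrow> ('b \<Rightarrow> 's \<Rightarrow> complex) \<Rightarrow> (('s \<Rightarrow> complex) \<Rightarrow> ('s \<Rightarrow> complex)) \<Rightarrow> 'b \<Rightarrow> 'b" where
  "restrict_op M J T u = (THE v. AE x in M. J v x = T (J u) x)"

text \<open>Norm in \<open>\<L>(B \<rightarrow> L\<^sup>1)\<close>, the analogue of \<^const>\<open>onorm\<close> for operators with values in \<open>L\<^sup>1\<close>.\<close>

definition onorm_L1 :: "'s measure \<Rightarrow> ('b::real_normed_vector \<Rightarrow> 's \<Rightarrow> complex) \<Rightarrow> real" where
  "onorm_L1 M D = (SUP u. (\<integral>x. norm (D u x) \<partial>M) / norm u)"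

text \<open>In the two hypotheses below, \<open>d = CARD('d)\<close>. That the restrictions to \<open>B\<close> belong to \<open>\<L>(B)\<close>
  is recorded explicitly because \<^const>\<open>onorm\<close> is meaningful only for bounded operators
  (mathematically it is automatic, by the closed graph theorem).\<close>

definition hypothesis_A ::
    "'s measure \<Rightarrow> ('s \<Rightarrow> 's) \<Rightarrow> (('s \<Rightarrow> complex) \<Rightarrow> ('s \<Rightarrow> complex)) \<Rightarrow> ('s \<Rightarrow> int ^ 'd) \<Rightarrow>
     real \<Rightarrow> (nat \<Rightarrow> real) \<Rightarrow> ('b::banach \<Rightarrow> 's \<Rightarrow> complex) \<Rightarrow> real \<Rightarrow> bool" where
  "hypothesis_A M F P \<Psi> \<alpha> \<aa> J \<Phi>0 \<longleftrightarrow>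
     (\<forall>n. \<aa> n > 0) \<and>
     regularly_varying_seq (1 / \<alpha>) \<aa> \<and>
     filterlim (A_sum CARD('d) \<aa>) at_top sequentially \<and>
     L1_inclusion M J \<and>
     (\<exists>e. AE x in M. J e x = 1) \<and>
     (\<forall>n a. preserved_by M J (Q_op F P \<Psi> n a)) \<and>
     (\<forall>n a. bounded_linear (restrict_op M J (Q_op F P \<Psi> n a))) \<and>
     \<Phi>0 > 0 \<and>
     (\<lambda>n. onorm (restrict_op M J (Q_op F P \<Psi> n 0))) \<in> O(\<lambda>n. 1 / \<aa> n ^ CARD('d)) \<and>
     (\<lambda>n. onorm_L1 M (\<lambda>u x. Q_op F P \<Psi> n 0 (J u) x
                          - complex_of_real (\<Phi>0 / \<aa> n ^ CARD('d)) * (\<integral>y. J u y \<partial>M)))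
       \<in> o(\<lambda>n. 1 / \<aa> n ^ CARD('d))"

definition hypothesis_B ::
    "'s measure \<Rightarrow> ('s \<Rightarrow> 's) \<Rightarrow> (('s \<Rightarrow> complex) \<Rightarrow> ('s \<Rightarrow> complex)) \<Rightarrow> ('s \<Rightarrow> int ^ 'd) \<Rightarrow>
     real \<Rightarrow> (nat \<Rightarrow> real) \<Rightarrow> ('b::banach \<Rightarrow> 's \<Rightarrow> complex) \<Rightarrow> real \<Rightarrow> bool" where
  "hypothesis_B M F P \<Psi> \<alpha> \<aa> J \<Phi>0 \<longleftrightarrow>
     hypothesis_A M F P \<Psi> \<alpha> \<aa> J \<Phi>0 \<and>
     (let Q = (\<lambda>k a. restrict_op M J (Q_op F P \<Psi> k a)); d = real CARD('d) in
       (\<exists>C. \<forall>k a. onorm (Q k a) \<le> C * \<aa> k powr (-d)) \<and>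
       (\<forall>\<eta>\<in>{0..1}.
          (\<exists>C. \<forall>k a b. onorm (\<lambda>u. Q k b u - Q k a u)
                 \<le> C * (lattice_norm (b - a) powr \<eta> * \<aa> k powr (- d - \<eta>))) \<and>
          (\<exists>C. \<forall>k a b. onorm (\<lambda>u. Q k (b - a) u - Q k b u - Q k (- a) u + Q k 0 u)
                 \<le> C * ((lattice_norm a * lattice_norm b) powr \<eta> * \<aa> k powr (- d - 2 * \<eta>)))))"

text \<open>The moments determine the law, which is carried by \<open>[0, \<infinity>)\<close>; nonnegativity is recorded
  since the square root of the variable is taken below.\<close>

definition mittag_leffler :: "real \<Rightarrow> 'w measure \<Rightarrow> ('w \<Rightarrow> real) \<Rightarrow> bool" where
  "mittag_leffler \<gamma> \<Omega> Y \<longleftrightarrow>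
     Y \<in> borel_measurable \<Omega> \<and> (AE w in \<Omega>. 0 \<le> Y w) \<and>
     (\<forall>N. integrable \<Omega> (\<lambda>w. Y w ^ N) \<and>
          (\<integral>w. Y w ^ N \<partial>\<Omega>) = fact N * Gamma (1 + \<gamma>) ^ N / Gamma (1 + real N * \<gamma>))"

definition converges_dist_moments ::
    "'s measure \<Rightarrow> (nat \<Rightarrow> 's \<Rightarrow> real) \<Rightarrow> 'w measure \<Rightarrow> ('w \<Rightarrow> real) \<Rightarrow> bool" where
  "converges_dist_moments M X \<Omega> L \<longleftrightarrow>
     (\<forall>n. X n \<in> borel_measurable M) \<and> L \<in> borel_measurable \<Omega> \<and>
     weak_conv_m (\<lambda>n. distr M borel (X n)) (distr \<Omega> borel L) \<and>
     (\<forall>N. (\<forall>n. integrable M (\<lambda>x. X n x ^ N)) \<and> integrable \<Omega> (\<lambda>w. L w ^ N) \<and>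
          (\<lambda>n. \<integral>x. X n x ^ N \<partial>M) \<longlonglongrightarrow> (\<integral>w. L w ^ N \<partial>\<Omega>))"

definition walk_prob :: "'s measure \<Rightarrow> ('s \<Rightarrow> 's) \<Rightarrow> ('s \<Rightarrow> int ^ 'd) \<Rightarrow> int \<Rightarrow> int ^ 'd \<Rightarrow> real" where
  "walk_prob M F \<Psi> k a = measure M {x \<in> space M. birkhoff F \<Psi> (nat \<bar>k\<bar>) x = a}"

definition sigma_term ::
    "'s measure \<Rightarrow> ('s \<Rightarrow> 's) \<Rightarrow> ('s \<Rightarrow> int ^ 'd) \<Rightarrow> (int ^ 'd \<Rightarrow> real) \<Rightarrow> int \<Rightarrow> real" where
  "sigma_term M F \<Psi> \<beta> k =
     (\<Sum>\<^sub>\<infinity>(a, b)\<in>UNIV. \<beta> a * \<beta> b * walk_prob M F \<Psi> k (b - a))"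

definition sigma_term_centred ::
    "'s measure \<Rightarrow> ('s \<Rightarrow> 's) \<Rightarrow> ('s \<Rightarrow> int ^ 'd) \<Rightarrow> (int ^ 'd \<Rightarrow> real) \<Rightarrow> int \<Rightarrow> real" where
  "sigma_term_centred M F \<Psi> \<beta> k =
     (\<Sum>\<^sub>\<infinity>(a, b)\<in>UNIV. \<beta> a * \<beta> b *
        (walk_prob M F \<Psi> k (b - a) - walk_prob M F \<Psi> k b
         - walk_prob M F \<Psi> k (- a) + walk_prob M F \<Psi> k 0))"

definition sigma2 ::
    "'s measure \<Rightarrow> ('s \<Rightarrow> 's) \<Rightarrow> ('s \<Rightarrow> int ^ 'd) \<Rightarrow> (int ^ 'd \<Rightarrow> real) \<Rightarrow> real" where
  "sigma2 M F \<Psi> \<beta> = (\<Sum>\<^sub>\<infinity>k\<in>UNIV. sigma_term M F \<Psi> \<beta> k)"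

end

theory Submission
  imports Defs
begin

text \<open>
  With \<open>L\<^sub>n\<close> the sum to be studied, the classes \<open>w N n a\<close> of
  \<open>\<Sum>k<n. P\<^sup>k (1\<^bsub>{S\<^sub>k = a}\<^esub> L\<^sub>k\<^sup>N)\<close> satisfy a renewal recursion in \<open>N\<close>, obtained by expanding
  \<open>L\<^sub>k\<^sub>+\<^sub>1\<^sup>N - L\<^sub>k\<^sup>N\<close> with the binomial theorem and conditioning on the last step counted:
  \<open>w N n a = \<Sum>l. \<Sum>j. (N choose j) \<Sum>b. \<beta>(b)\<^sup>j Q(l, a - b) (w (N - j) (n - l) b)\<close>.
  The local limit theorem turns convolution with \<open>Q(l, 0)\<close> into convolution with the sequence
  \<open>p l\<close>, the reciprocals of the \<open>d\<close>-th powers of the scaling sequence, and by regular variation a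
  convolution of \<open>p\<close> with \<open>A\<^sup>s\<close> is asymptotic to a Beta integral times \<open>A\<^sup>s\<^sup>+\<^sup>1\<close>. Iterating these Beta
  factors produces the Mittag-Leffler moments.

  When the weights \<open>\<beta>\<close> sum to zero, every \<open>Q(l, a - b)\<close> may be replaced by a difference, so that each
  factor \<open>L\<close> costs only half a power of \<open>A\<close>. The term \<open>j = 2\<close> and the terms \<open>j = 1\<close> paired
  with the next step through a double difference contribute \<open>(N choose 2) \<sigma>\<^sup>2\<close> times the moment
  of order \<open>N - 2\<close>; all others are negligible. Both limit laws are determined by their moments, and
  the Mittag-Leffler law itself is obtained as a weak limit of the normalised local times.\<close>

section \<open>Regularly varying sequences\<close>

text \<open>Two topologies are in play: the norm of B, in which only upper bounds are known, and L1,
  in which \<open>T l 0\<close> behaves like the rank one operator sending u to \<Phi> p(l) E(u) 1.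
  The induction on N carries both: norm bounds of the right order, and convergence of the rescaled
  \<open>w N n 0\<close> to a constant function in the seminorm \<open>sn\<close>. The latter
  survives one more operator because E composed with \<open>T l a\<close> is bounded by
  \<open>sn\<close>; this lets the series for \<sigma>^2 be extracted by dominated convergence.

  For centred weights the obvious order of \<open>w N\<close> is A^(N+1), while A^(N/2+1) is needed.
  The gain comes from a second inductive bound, on \<open>w N n a - w N n 0\<close>, half a power
  below the first. A single difference of operators contributes \<open>q l\<close>, whose sums are
  o(A^(1/2)); a double difference contributes the summable \<open>r l\<close>, which leaves a term
  of critical order: the off-diagonal part of \<sigma>^2.

  The boundary case \<alpha> = d, where \<gamma> = 0 and A varies slowly, is kept in the same
  statements; the Beta factors are then 1 and Y is exponential.\<close>

lemma filterlim_nat_floor_mult: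
  fixes c :: real
  assumes "c > 0"
  shows "filterlim (\<lambda>n. nat \<lfloor>c * real n\<rfloor>) at_top sequentially"
proof -
  have "filterlim (\<lambda>n. c * real n) at_top sequentially"
    using assms by (intro filterlim_tendsto_pos_mult_at_top[OF tendsto_const] filterlim_real_sequentially)
  then show ?thesis
    by (intro filterlim_compose[OF filterlim_nat_sequentially]
        filterlim_compose[OF filterlim_floor_sequentially])
qed

text \<open>The factors \<theta>^\<rho> and \<theta>^(-\<rho>) cancel in the limit, but the two
  roundings do not: the index reached differs from n by a bounded amount.\<close>

lemma regularly_varying_seq_roundtrip:
  assumes rv: "regularly_varying_seq \<rho> u" and pos: "\<And>n. u n > 0" and \<theta>: "\<theta> > 0"
  shows "(\<lambda>n. u (nat \<lfloor>(1 / \<theta>) * real (nat \<lfloor>\<theta> * real n\<rfloor>)\<rfloor>) / u n) \<longlonglongrightarrow> 1"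
proof -
  define m where "m = (\<lambda>n. nat \<lfloor>\<theta> * real n\<rfloor>)"
  have "(\<lambda>n. u (m n) / u n) \<longlonglongrightarrow> \<theta> powr \<rho>"
    using rv \<theta> by (auto simp: regularly_varying_seq_def m_def)
  moreover have "(\<lambda>n. u (nat \<lfloor>(1 / \<theta>) * real n\<rfloor>) / u n) \<longlonglongrightarrow> (1 / \<theta>) powr \<rho>"
    using rv[unfolded regularly_varying_seq_def, rule_format, of "1 / \<theta>"] \<theta> by simp
  then have "(\<lambda>n. u (nat \<lfloor>(1 / \<theta>) * real (m n)\<rfloor>) / u (m n)) \<longlonglongrightarrow> (1 / \<theta>) powr \<rho>"
    by (rule filterlim_compose) (simp add: m_def filterlim_nat_floor_mult \<theta>)
  ultimately have "(\<lambda>n. u (nat \<lfloor>(1 / \<theta>) * real (m n)\<rfloor>) / u (m n) * (u (m n) / u n))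
      \<longlonglongrightarrow> (1 / \<theta>) powr \<rho> * \<theta> powr \<rho>"
    by (intro tendsto_mult)
  moreover have "(1 / \<theta>) powr \<rho> * \<theta> powr \<rho> = 1"
    using \<theta> by (simp add: powr_divide)
  moreover have "u (nat \<lfloor>(1 / \<theta>) * real (m n)\<rfloor>) / u (m n) * (u (m n) / u n)
      = u (nat \<lfloor>(1 / \<theta>) * real (m n)\<rfloor>) / u n" for n
    using pos[of "m n"] by simp
  ultimately show ?thesis
    unfolding m_def by (simp only:)
qed

text \<open>Regular variation only controls ratios of the form \<open>u \<lfloor>c n\<rfloor> / u n\<close>, and no single \<open>c\<close> reaches
  \<open>u (n - 1) / u n\<close>. Following \<open>n\<close> through \<open>\<lfloor>\<theta> n\<rfloor>\<close> and back by \<open>1 / \<theta>\<close> yields \<open>n - 1\<close> exactly when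
  the fractional part of \<open>\<theta> n\<close> is at most \<open>\<theta>\<close>; for irrational \<open>\<theta>\<close> one of \<open>\<theta>\<close>, \<open>1 - \<theta>\<close> always works.\<close>

lemma beatty_cover:
  fixes \<theta> :: real
  assumes \<theta>: "0 < \<theta>" "\<theta> < 1" "\<theta> \<notin> \<rat>" and n: "n \<ge> 1"
  shows "nat \<lfloor>(1 / \<theta>) * real (nat \<lfloor>\<theta> * real n\<rfloor>)\<rfloor> = n - 1 \<or>
         nat \<lfloor>(1 / (1 - \<theta>)) * real (nat \<lfloor>(1 - \<theta>) * real n\<rfloor>)\<rfloor> = n - 1"
proof -
  have *: "nat \<lfloor>(1 / t) * real (nat \<lfloor>t * real n\<rfloor>)\<rfloor> = n - 1"
    if t: "0 < t" "0 < frac (t * real n)" "frac (t * real n) \<le> t" for t :: real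
  proof -
    have "real (nat \<lfloor>t * real n\<rfloor>) = t * real n - frac (t * real n)"
      using t by (simp add: frac_def)
    then have eq: "(1 / t) * real (nat \<lfloor>t * real n\<rfloor>) = real n - frac (t * real n) / t"
      using t(1) unfolding \<open>real (nat \<lfloor>t * real n\<rfloor>) = _\<close> by (simp add: diff_divide_distrib)
    have "frac (t * real n) / t > 0" "frac (t * real n) / t \<le> 1"
      using divide_pos_pos[OF t(2,1)] t by (simp_all only: divide_le_eq_1_pos)
    then have "\<lfloor>real n - frac (t * real n) / t\<rfloor> = int n - 1"
      by (intro floor_unique) auto
    then show ?thesis
      unfolding eq using n by simp
  qed
  \<comment> \<open>A zero fractional part would bring the round trip back to n itself instead of n
    - 1.\<close>
  have irr: "\<theta> * real n \<notin> \<rat>"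
  proof
    assume "\<theta> * real n \<in> \<rat>"
    then have "\<theta> * real n / real n \<in> \<rat>"
      by (intro Rats_divide) auto
    then show False
      using \<theta> n by simp
  qed
  then have "\<theta> * real n \<notin> \<int>"
    by (meson Ints_subset_Rats subsetD)
  then have pos: "0 < frac (\<theta> * real n)" "frac (\<theta> * real n) < 1"
    by (auto simp: frac_gt_0_iff frac_lt_1)
  have "(1 - \<theta>) * real n = - (\<theta> * real n) + of_int (int n)"
    by (simp add: algebra_simps)
  then have "frac ((1 - \<theta>) * real n) = frac (- (\<theta> * real n))"
    by (simp only: frac_def floor_add_int[symmetric] of_int_add)
  also have "\<dots> = 1 - frac (\<theta> * real n)"
    using \<open>\<theta> * real n \<notin> \<int>\<close> by (simp add: frac_neg)
  finally have "frac ((1 - \<theta>) * real n) = 1 - frac (\<theta> * real n)" .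
  \<comment> \<open>The two fractional parts add up to 1, so if the first exceeds \<theta>, the
    second is below 1 - \<theta>.\<close>
  then show ?thesis
    using *[of \<theta>] *[of "1 - \<theta>"] pos \<theta> by (cases "frac (\<theta> * real n) \<le> \<theta>") auto
qed

lemma regularly_varying_seq_Suc:
  assumes rv: "regularly_varying_seq \<rho> u" and pos: "\<And>n. u n > 0"
  shows "(\<lambda>n. u (Suc n) / u n) \<longlonglongrightarrow> 1"
proof -
  obtain \<theta> :: real where \<theta>: "0 < \<theta>" "\<theta> < 1" "\<theta> \<notin> \<rat>"
    using real_interval_avoid_countable_set[OF zero_less_one countable_rat] by auto
  define f where "f = (\<lambda>t n. u (nat \<lfloor>(1 / t) * real (nat \<lfloor>t * real n\<rfloor>)\<rfloor>) / u n)"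
  have f: "f \<theta> \<longlonglongrightarrow> 1" "f (1 - \<theta>) \<longlonglongrightarrow> 1"
    unfolding f_def using \<theta> by (intro regularly_varying_seq_roundtrip[OF rv pos]; simp)+
  \<comment> \<open>Which alternative holds varies with n, but each of the two comparison sequences
    tends to 1.\<close>
  have cov: "u (n - 1) / u n = f \<theta> n \<or> u (n - 1) / u n = f (1 - \<theta>) n" if "n \<ge> 1" for n
    using beatty_cover[OF \<theta> that] unfolding f_def by metis
  have "(\<lambda>n. u (n - 1) / u n) \<longlonglongrightarrow> 1"
  proof (rule tendstoI)
    fix \<epsilon> :: real assume "\<epsilon> > 0"
    have "\<forall>\<^sub>F n in sequentially. dist (f \<theta> n) 1 < \<epsilon> \<and> dist (f (1 - \<theta>) n) 1 < \<epsilon> \<and> n \<ge> 1"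
      using f \<open>\<epsilon> > 0\<close> by (intro eventually_conj tendstoD eventually_ge_at_top)
    then show "\<forall>\<^sub>F n in sequentially. dist (u (n - 1) / u n) 1 < \<epsilon>"
      by eventually_elim (metis cov)
  qed
  then have "(\<lambda>n. u (Suc n - 1) / u (Suc n)) \<longlonglongrightarrow> 1"
    by (rule LIMSEQ_Suc)
  then have "(\<lambda>n. inverse (u n / u (Suc n))) \<longlonglongrightarrow> inverse 1"
    by (intro tendsto_inverse) auto
  then show ?thesis
    by simp
qed

lemma ratio_shift:
  fixes u :: "nat \<Rightarrow> real"
  assumes "(\<lambda>n. u (Suc n) / u n) \<longlonglongrightarrow> 1" and pos: "\<And>n. u n > 0"
  shows "(\<lambda>n. u (n + r) / u n) \<longlonglongrightarrow> 1"
proof (induction r)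
  case 0
  then show ?case using pos by (simp add: less_imp_neq[symmetric])
next
  case (Suc r)
  have "(\<lambda>n. u (Suc (n + r)) / u (n + r)) \<longlonglongrightarrow> 1"
    using LIMSEQ_ignore_initial_segment[OF assms(1), of r] by simp
  from tendsto_mult[OF this Suc] show ?case
    using pos[of "_ + r"] by (simp add: less_imp_neq[symmetric])
qed

lemma regularly_varying_seq_affine:
  assumes rv: "regularly_varying_seq \<rho> u" and pos: "\<And>n. u n > 0" and m: "m \<ge> 1"
  shows "(\<lambda>n. u (m * n + r) / u n) \<longlonglongrightarrow> real m powr \<rho>"
proof -
  have "(\<lambda>n. u (nat \<lfloor>real m * real n\<rfloor>) / u n) \<longlonglongrightarrow> real m powr \<rho>"
    using rv m by (auto simp: regularly_varying_seq_def)
  moreover have "nat \<lfloor>real m * real n\<rfloor> = m * n" for n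
    by (metis floor_of_nat nat_int of_nat_mult)
  ultimately have 1: "(\<lambda>n. u (m * n) / u n) \<longlonglongrightarrow> real m powr \<rho>"
    by simp
  have "filterlim (\<lambda>n. m * n) at_top sequentially"
    using m by (intro mult_nat_left_at_top) auto
  with ratio_shift[OF regularly_varying_seq_Suc[OF rv pos] pos, of r]
  have "(\<lambda>n. u (m * n + r) / u (m * n)) \<longlonglongrightarrow> 1"
    by (rule filterlim_compose)
  from tendsto_mult[OF this 1] show ?thesis
    using pos[of "m * _"] by (simp add: less_imp_neq[symmetric])
qed

lemma regularly_varying_seq_powr:
  assumes rv: "regularly_varying_seq \<rho> u" and pos: "\<And>n. u n > 0"
  shows "regularly_varying_seq (\<rho> * x) (\<lambda>n. u n powr x)"
  unfolding regularly_varying_seq_def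
proof (intro allI impI)
  fix c :: real assume c: "c > 0"
  have "(\<lambda>n. (u (nat \<lfloor>c * real n\<rfloor>) / u n) powr x) \<longlonglongrightarrow> (c powr \<rho>) powr x"
    using rv c by (intro tendsto_powr tendsto_const) (auto simp: regularly_varying_seq_def)
  then show "(\<lambda>n. u (nat \<lfloor>c * real n\<rfloor>) powr x / u n powr x) \<longlonglongrightarrow> c powr (\<rho> * x)"
    using pos by (simp add: powr_divide powr_powr less_imp_le)
qed

text \<open>Toeplitz averaging: the finitely many weights before m have a fixed total, which is
  negligible against \<open>A n\<close>.\<close>

lemma weighted_cesaro:
  fixes p y A :: "nat \<Rightarrow> real"
  assumes A: "\<And>n. A n = (\<Sum>k\<le>n. p k)" and p: "\<And>n. p n \<ge> 0" and lim: "filterlim A at_top sequentially"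
    and y: "y \<longlonglongrightarrow> c"
  shows "(\<lambda>n. (\<Sum>k\<le>n. p k * y k) / A n) \<longlonglongrightarrow> c"
proof (rule tendstoI)
  fix \<epsilon> :: real assume \<epsilon>: "\<epsilon> > 0"
  from tendstoD[OF y, of "\<epsilon>/2"] obtain m where m: "\<And>k. k \<ge> m \<Longrightarrow> \<bar>y k - c\<bar> < \<epsilon>/2"
    using \<epsilon> by (auto simp: eventually_sequentially dist_real_def)
  define B where "B = (\<Sum>k<m. p k * \<bar>y k - c\<bar>)"
  have "\<forall>\<^sub>F n in sequentially. A n > 0 \<and> A n > 2 * B / \<epsilon> \<and> n \<ge> m"
    by (intro eventually_conj eventually_ge_at_top) (use lim in \<open>auto simp: filterlim_at_top_dense\<close>)
  then show "\<forall>\<^sub>F n in sequentially. dist ((\<Sum>k\<le>n. p k * y k) / A n) c < \<epsilon>"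
  proof eventually_elim
    case (elim n)
    have "\<bar>(\<Sum>k\<le>n. p k * y k) - c * A n\<bar> = \<bar>\<Sum>k\<le>n. p k * (y k - c)\<bar>"
      unfolding A by (simp add: sum_distrib_left sum_subtractf algebra_simps)
    also have "\<dots> \<le> (\<Sum>k\<le>n. p k * \<bar>y k - c\<bar>)"
      by (rule order_trans[OF sum_abs]) (use p in \<open>simp add: abs_mult\<close>)
    also have "(\<Sum>k\<le>n. p k * \<bar>y k - c\<bar>) = B + (\<Sum>k\<in>{m..n}. p k * \<bar>y k - c\<bar>)"
    proof -
      have "{..n} = {..<m} \<union> {m..n}"
        using elim by auto
      then show ?thesis
        unfolding B_def by (simp only:) (rule sum.union_disjoint, auto)
    qed
    also have "(\<Sum>k\<in>{m..n}. p k * \<bar>y k - c\<bar>) \<le> (\<Sum>k\<in>{m..n}. p k * (\<epsilon> / 2))"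
      using p m by (intro sum_mono mult_left_mono) (auto intro: less_imp_le)
    also have "\<dots> \<le> (\<Sum>k\<le>n. p k * (\<epsilon> / 2))"
      using p \<epsilon> by (intro sum_mono2) auto
    also have "\<dots> = A n * (\<epsilon> / 2)"
      unfolding A by (simp add: sum_distrib_right)
    finally have "\<bar>(\<Sum>k\<le>n. p k * y k) - c * A n\<bar> \<le> B + A n * (\<epsilon> / 2)" by simp
    also have "B < A n * (\<epsilon> / 2)"
      using elim \<epsilon> by (simp add: field_simps)
    finally have "\<bar>(\<Sum>k\<le>n. p k * y k) - c * A n\<bar> < \<epsilon> * A n" by simp
    moreover have "(\<Sum>k\<le>n. p k * y k) / A n - c = ((\<Sum>k\<le>n. p k * y k) - c * A n) / A n"
      using elim by (simp add: field_simps)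
    ultimately show ?case
      using elim by (simp add: dist_real_def abs_divide divide_less_eq)
  qed
qed

text \<open>Direct half of Karamata's theorem for integer factors. Grouping p into blocks of length
  m exhibits A(mn + m - 1) / A(n) as a weighted mean of block sums divided by \<open>p k\<close>,
  and each of the m terms of such a quotient tends to m^(\<gamma> - 1).\<close>

lemma karamata_affine:
  fixes p A :: "nat \<Rightarrow> real"
  assumes A: "\<And>n. A n = (\<Sum>k\<le>n. p k)" and p: "\<And>n. p n > 0" and lim: "filterlim A at_top sequentially"
    and rv: "regularly_varying_seq (\<gamma> - 1) p" and m: "m \<ge> 1"
  shows "(\<lambda>n. A (m * n + r) / A n) \<longlonglongrightarrow> real m powr \<gamma>"
proof -
  have Apos: "A n > 0" for n
    unfolding A using p by (intro sum_pos) auto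
  note cesaro = weighted_cesaro[OF A less_imp_le[OF p] lim]
  \<comment> \<open>This average is A(n + 1) / A(n) up to the single term p 0. Its limit 1 later
    trades the remainder m - 1 for an arbitrary r.\<close>
  have "(\<lambda>n. (\<Sum>k\<le>n. p k * (p (Suc k) / p k)) / A n) \<longlonglongrightarrow> 1"
    by (rule cesaro[OF regularly_varying_seq_Suc[OF rv p]])
  moreover have "(\<Sum>k\<le>n. p k * (p (Suc k) / p k)) = A (Suc n) - p 0" for n
    unfolding A using p by (subst sum.atMost_Suc_shift) (simp add: less_imp_neq[symmetric])
  ultimately have 1: "(\<lambda>n. (A (Suc n) - p 0) / A n) \<longlonglongrightarrow> 1"
    by simp
  have "(\<lambda>n. p 0 / A n) \<longlonglongrightarrow> 0"
    by (rule real_tendsto_divide_at_top[OF tendsto_const lim])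
  from tendsto_add[OF 1 this] have "(\<lambda>n. A (Suc n) / A n) \<longlonglongrightarrow> 1"
    by (simp add: diff_divide_distrib)
  note shift = ratio_shift[OF this Apos]
  have "(\<lambda>n. (\<Sum>k\<le>n. p k * (\<Sum>j<m. p (m * k + j) / p k)) / A n) \<longlonglongrightarrow> (\<Sum>j<m. real m powr (\<gamma> - 1))"
    by (intro cesaro tendsto_sum regularly_varying_seq_affine[OF rv p m])
  moreover have "(\<Sum>j<m. real m powr (\<gamma> - 1)) = real m powr \<gamma>"
    using m by (simp add: powr_diff)
  moreover have "(\<Sum>k\<le>n. p k * (\<Sum>j<m. p (m * k + j) / p k)) = A (m * n + (m - 1))" for n
  proof -
    have "p k * (\<Sum>j<m. p (m * k + j) / p k) = sum p {k * m..<k * m + m}" for k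
    proof -
      have "sum p {k * m..<k * m + m} = (\<Sum>j<m. p (j + k * m))"
        using sum.shift_bounds_nat_ivl[of p 0 "k * m" m] by (simp add: lessThan_atLeast0 add.commute)
      then show ?thesis
        using p[of k] by (simp add: sum_distrib_left algebra_simps)
    qed
    then have "(\<Sum>k\<le>n. p k * (\<Sum>j<m. p (m * k + j) / p k)) = (\<Sum>k<Suc n. sum p {k * m..<k * m + m})"
      by (simp add: lessThan_Suc_atMost)
    also have "\<dots> = sum p {..<Suc n * m}"
      by (rule sum.nat_group)
    also have "{..<Suc n * m} = {..m * n + (m - 1)}"
      using m by (auto simp: algebra_simps)
    finally show ?thesis
      by (simp add: A)
  qed
  ultimately have 2: "(\<lambda>n. A (m * n + (m - 1)) / A n) \<longlonglongrightarrow> real m powr \<gamma>"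
    by (simp only:)
  have mn: "filterlim (\<lambda>n. m * n) at_top sequentially"
    using m by (intro mult_nat_left_at_top) auto
  have "(\<lambda>n. (A (m * n + r) / A (m * n)) / (A (m * n + (m - 1)) / A (m * n))) \<longlonglongrightarrow> 1 / 1"
    by (intro tendsto_divide filterlim_compose[OF shift mn]) auto
  from tendsto_mult[OF this 2] show ?thesis
    using Apos[of "m * _"] Apos[of "m * _ + (m - 1)"] by (simp add: less_imp_neq[symmetric])
qed

text \<open>Dyadic contraction: u(2n) + u(2n + 1) is asymptotic to 2^(\<rho> + 1) u(n), and
  2^(\<rho> + 1) < 1. Hence every partial sum S satisfies S <= K + \<theta> S with one \<theta> < 1
  and bounded K.\<close>

lemma regularly_varying_seq_summable:
  assumes rv: "regularly_varying_seq \<rho> u" and pos: "\<And>n. u n > 0" and \<rho>: "\<rho> < -1"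
  shows "summable u"
proof -
  have 1: "(\<lambda>n. u (2 * n + 0) / u n + u (2 * n + 1) / u n) \<longlonglongrightarrow> 2 powr \<rho> + 2 powr \<rho>"
    using regularly_varying_seq_affine[OF rv pos, of 2] by (intro tendsto_add) (simp_all only: of_nat_numeral one_le_numeral)
  have "2 powr \<rho> + 2 powr \<rho> = 2 powr (\<rho> + 1)"
    by (simp add: powr_add)
  also have "\<dots> < 2 powr 0"
    using \<rho> by (intro powr_less_mono) auto
  finally obtain \<theta> where \<theta>: "2 powr \<rho> + 2 powr \<rho> < \<theta>" "\<theta> < 1"
    using dense by auto
  have "\<theta> > 0"
    using \<theta> by (smt (verit) powr_ge_zero)
  from order_tendstoD(2)[OF 1 \<theta>(1)] obtain m
    where m: "\<And>n. n \<ge> m \<Longrightarrow> u (2 * n) / u n + u (2 * n + 1) / u n < \<theta>"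
    by (auto simp: eventually_sequentially)
  have m': "u (2 * n) + u (2 * n + 1) \<le> \<theta> * u n" if "n \<ge> m" for n
    using m[OF that] pos[of n] by (simp add: field_simps)
  define K where "K = (\<Sum>k<m. u (2 * k) + u (2 * k + 1))"
  have le: "u (2 * k) + u (2 * k + 1) \<le> (if k < m then u (2 * k) + u (2 * k + 1) else 0) + \<theta> * u k" for k
    using m'[of k] pos[of k] \<open>\<theta> > 0\<close> by auto
  have bound: "sum u {..<n} \<le> K / (1 - \<theta>)" for n
  proof -
    have "sum u {..<n} \<le> sum u {..<n * 2}"
      using pos by (intro sum_mono2) (auto intro: less_imp_le)
    also have "\<dots> = (\<Sum>k<n. sum u {k * 2..<k * 2 + 2})"
      by (rule sum.nat_group[symmetric])
    also have "\<dots> = (\<Sum>k<n. u (2 * k) + u (2 * k + 1))"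
      by (simp add: numeral_2_eq_2 algebra_simps)
    also have "\<dots> \<le> (\<Sum>k<n. (if k < m then u (2 * k) + u (2 * k + 1) else 0) + \<theta> * u k)"
      by (intro sum_mono le)
    also have "\<dots> = (\<Sum>k<n. if k < m then u (2 * k) + u (2 * k + 1) else 0) + \<theta> * sum u {..<n}"
      by (simp add: sum.distrib sum_distrib_left)
    also have "(\<Sum>k<n. if k < m then u (2 * k) + u (2 * k + 1) else 0)
        = (\<Sum>k\<in>{..<n} \<inter> {k. k < m}. u (2 * k) + u (2 * k + 1))"
      by (simp add: sum.If_cases)
    also have "\<dots> \<le> K"
      unfolding K_def using pos by (intro sum_mono2) (auto intro: less_imp_le add_nonneg_nonneg)
    finally show ?thesis
      using \<theta> by (simp add: field_simps)
  qed
  show ?thesis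
    by (rule bounded_imp_summable[of u "K / (1 - \<theta>)"])
      (use bound[of "Suc _"] pos in \<open>auto intro: less_imp_le simp: lessThan_Suc_atMost\<close>)
qed

section \<open>Convolutions of regularly varying sums\<close>

text \<open>Subadditivity of the power: t <= t^\<gamma> on [0, 1], applied to t = x / (x + 1) and to
  1 - t.\<close>

lemma powr_increment_le:
  fixes x \<gamma> :: real
  assumes "x \<ge> 0" "0 \<le> \<gamma>" "\<gamma> \<le> 1"
  shows "(x + 1) powr \<gamma> - x powr \<gamma> \<le> 1"
proof (cases "x = 0")
  case False
  then have x: "x > 0" using assms by simp
  define t where "t = x / (x + 1)"
  have t: "0 < t" "t < 1" using x by (auto simp: t_def)
  have "t powr 1 \<le> t powr \<gamma>" "(1 - t) powr 1 \<le> (1 - t) powr \<gamma>"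
    using t assms by (intro powr_mono'; simp)+
  then have "1 \<le> t powr \<gamma> + (1 - t) powr \<gamma>" using t by simp
  then have "(x + 1) powr \<gamma> * 1 \<le> (x + 1) powr \<gamma> * (t powr \<gamma> + (1 - t) powr \<gamma>)"
    by (intro mult_left_mono) auto
  also have "\<dots> = ((x + 1) * t) powr \<gamma> + ((x + 1) * (1 - t)) powr \<gamma>"
    using x t by (simp add: powr_mult distrib_left)
  also have "\<dots> = x powr \<gamma> + 1"
  proof -
    have "(x + 1) * t = x" "(x + 1) * (1 - t) = 1"
      using x by (auto simp: t_def field_simps)
    then show ?thesis by simp
  qed
  finally show ?thesis by simp
qed simp

text \<open>For \<gamma> > 0 this is the Beta integral of \<gamma> t^(\<gamma> - 1) (1 - t)^(s
  \<gamma>) over [0, 1]. Written with Gamma it also makes sense at \<gamma> = 0, and its product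
  over s = 0, ..., N - 1 telescopes to Gamma(1 + \<gamma>)^N / Gamma(1 + N \<gamma>).\<close>

definition kappa :: "real \<Rightarrow> real \<Rightarrow> real" where
  "kappa \<gamma> s = Gamma (1 + \<gamma>) * Gamma (1 + s * \<gamma>) / Gamma (1 + (s + 1) * \<gamma>)"

lemma kappa_0 [simp]: "kappa 0 s = 1"
  by (simp add: kappa_def)

lemma kappa_s0: "\<gamma> \<ge> 0 \<Longrightarrow> kappa \<gamma> 0 = 1"
  using Gamma_real_pos[of "1 + \<gamma>"] by (simp add: kappa_def less_imp_neq[symmetric])

lemma kappa_Beta:
  assumes "\<gamma> > 0" "s \<ge> 0"
  shows "kappa \<gamma> s = \<gamma> * Beta \<gamma> (s * \<gamma> + 1)"
proof -
  have "\<gamma> \<notin> \<int>\<^sub>\<le>\<^sub>0"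
    using assms by (auto elim!: nonpos_Ints_cases)
  then have "Gamma (1 + \<gamma>) = \<gamma> * Gamma \<gamma>"
    using Gamma_plus1[of \<gamma>] by (simp add: add.commute)
  then show ?thesis
    by (simp add: kappa_def Beta_def algebra_simps)
qed

text \<open>Riemann-Stieltjes sums against t^\<gamma>, so that the singularity of t^(\<gamma> - 1)
  at 0 is absorbed into the increments. The factor (1 - t)^(s \<gamma>) is decreasing, so its end
  point values bound it on each cell; the gap between the two sums is at most the largest increment
  times a telescoping sum bounded by 1.\<close>

lemma integral_powr_Beta_bounds:
  fixes \<gamma> s :: real
  assumes \<gamma>: "0 < \<gamma>" "\<gamma> \<le> 1" and s: "s > 0" and K: "K \<ge> (1::nat)"
  defines "\<Delta> \<equiv> (\<lambda>i. (real (Suc i) / K) powr \<gamma> - (real i / K) powr \<gamma>)"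
    and "v \<equiv> (\<lambda>i. (real (K - i) / K) powr (s * \<gamma>))"
  shows "(\<Sum>i<K. \<Delta> i * v (Suc i)) \<le> kappa \<gamma> s" "kappa \<gamma> s \<le> (\<Sum>i<K. \<Delta> i * v i)"
    "(\<Sum>i<K. \<Delta> i * v i) - (\<Sum>i<K. \<Delta> i * v (Suc i)) \<le> real K powr - \<gamma>"
proof -
  define f where "f = (\<lambda>t::real. \<gamma> * (t powr (\<gamma> - 1) * (1 - t) powr (s * \<gamma>)))"
  define g where "g = (\<lambda>t::real. \<gamma> * t powr (\<gamma> - 1))"
  have f: "(f has_integral kappa \<gamma> s) {0..1}"
    unfolding f_def kappa_Beta[OF \<gamma>(1) less_imp_le[OF s]]
    using has_integral_Beta_real[of \<gamma> "s * \<gamma> + 1"] \<gamma> s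
    by (intro has_integral_mult_right) (simp add: add_pos_pos)
  have sub: "{real i / K..real (Suc i) / K} \<subseteq> {0..1}" if "i < K" for i
    using that K by (auto simp: field_simps intro: order_trans)
  have int: "f integrable_on {real i / K..real (Suc i) / K}" if "i < K" for i
    using integrable_on_subinterval[OF has_integral_integrable[OF f] sub[OF that]] .
  have g: "(g has_integral \<Delta> i) {real i / K..real (Suc i) / K}" for i
    unfolding \<Delta>_def g_def
  proof (rule fundamental_theorem_of_calculus_interior)
    have "0 \<le> real i / K"
      by simp
    then have "0 \<le> t" if "t \<in> {real i / K..real (Suc i) / K}" for t
      using that by (meson atLeastAtMost_iff order_trans)
    then show "continuous_on {real i / K..real (Suc i) / K} (\<lambda>t. t powr \<gamma>)"
      using \<gamma> by (intro continuous_on_powr' continuous_intros) auto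
    fix x assume "x \<in> {real i / K<..<real (Suc i) / K}"
    then have "x > 0"
      using K by (auto intro: le_less_trans[rotated])
    then show "((\<lambda>t. t powr \<gamma>) has_vector_derivative \<gamma> * x powr (\<gamma> - 1)) (at x)"
      unfolding has_real_derivative_iff_has_vector_derivative[symmetric]
      by (auto intro!: derivative_eq_intros)
  qed (use K in \<open>auto simp: field_simps\<close>)
  have up: "integral {real i / K..real (Suc i) / K} f \<le> \<Delta> i * v i" if i: "i < K" for i
  proof (rule has_integral_le[OF integrable_integral[OF int[OF i]] has_integral_mult_left[OF g]])
    fix t assume t: "t \<in> {real i / K..real (Suc i) / K}"
    have "1 - t \<le> real (K - i) / K" "0 \<le> 1 - t"
      using t subsetD[OF sub[OF i] t] i K by (auto simp: field_simps of_nat_diff)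
    then have "(1 - t) powr (s * \<gamma>) \<le> v i"
      unfolding v_def using s \<gamma> by (intro powr_mono2) auto
    then show "f t \<le> g t * v i"
      unfolding f_def g_def using \<gamma> by (simp add: mult.assoc mult_left_mono)
  qed
  have lo: "\<Delta> i * v (Suc i) \<le> integral {real i / K..real (Suc i) / K} f" if i: "i < K" for i
  proof (rule has_integral_le[OF has_integral_mult_left[OF g] integrable_integral[OF int[OF i]]])
    fix t assume t: "t \<in> {real i / K..real (Suc i) / K}"
    have "real (K - Suc i) / K \<le> 1 - t"
      using t subsetD[OF sub[OF i] t] i K by (auto simp: field_simps of_nat_diff)
    then have "v (Suc i) \<le> (1 - t) powr (s * \<gamma>)"
      unfolding v_def using s \<gamma> by (intro powr_mono2) auto
    then show "g t * v (Suc i) \<le> f t"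
      unfolding f_def g_def using \<gamma> by (simp add: mult.assoc mult_left_mono)
  qed
  have "integral {0..real j / K} f = (\<Sum>i<j. integral {real i / K..real (Suc i) / K} f)" if "j \<le> K" for j
    using that
  proof (induction j)
    case (Suc j)
    have "integral {0..real j / K} f + integral {real j / K..real (Suc j) / K} f = integral {0..real (Suc j) / K} f"
      using Suc.prems K
      by (intro Henstock_Kurzweil_Integration.integral_combine
          integrable_on_subinterval[OF has_integral_integrable[OF f]]) (auto simp: field_simps)
    with Suc show ?case by simp
  qed simp
  from this[of K] have I: "kappa \<gamma> s = (\<Sum>i<K. integral {real i / K..real (Suc i) / K} f)"
    using K f by (simp add: integral_unique)
  show "(\<Sum>i<K. \<Delta> i * v (Suc i)) \<le> kappa \<gamma> s" "kappa \<gamma> s \<le> (\<Sum>i<K. \<Delta> i * v i)"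
    unfolding I by (intro sum_mono lo up; simp)+
  have \<Delta>: "\<Delta> i \<le> real K powr - \<gamma>" for i
  proof -
    have "\<Delta> i = ((real i + 1) powr \<gamma> - real i powr \<gamma>) * real K powr - \<gamma>"
      unfolding \<Delta>_def using K by (simp add: powr_divide powr_minus field_simps)
    also have "\<dots> \<le> 1 * real K powr - \<gamma>"
      using powr_increment_le[of "real i" \<gamma>] \<gamma> by (intro mult_right_mono) auto
    finally show ?thesis by simp
  qed
  have vm: "v (Suc i) \<le> v i" for i
    unfolding v_def using s \<gamma> by (intro powr_mono2) (auto simp: divide_right_mono)
  have "(\<Sum>i<K. \<Delta> i * v i) - (\<Sum>i<K. \<Delta> i * v (Suc i)) = (\<Sum>i<K. \<Delta> i * (v i - v (Suc i)))"
    by (simp add: sum_subtractf algebra_simps)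
  also have "\<dots> \<le> (\<Sum>i<K. real K powr - \<gamma> * (v i - v (Suc i)))"
    using \<Delta> vm by (intro sum_mono mult_right_mono) auto
  also have "\<dots> = real K powr - \<gamma> * (v 0 - v K)"
    by (simp add: sum_distrib_left[symmetric] sum_lessThan_telescope')
  also have "\<dots> \<le> real K powr - \<gamma> * 1"
    using K by (intro mult_left_mono) (auto simp: v_def)
  finally show "(\<Sum>i<K. \<Delta> i * v i) - (\<Sum>i<K. \<Delta> i * v (Suc i)) \<le> real K powr - \<gamma>" by simp
qed

lemma sum_atMost_blocks:
  fixes g :: "nat \<Rightarrow> 'a::comm_monoid_add"
  shows "(\<Sum>l\<le>M * N. g l) = g 0 + (\<Sum>i<M. \<Sum>l\<in>{i * N<..Suc i * N}. g l)"
proof (induction M)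
  case (Suc M)
  have "{..Suc M * N} = {..M * N} \<union> {M * N<..Suc M * N}"
    by auto
  then have "(\<Sum>l\<le>Suc M * N. g l) = (\<Sum>l\<le>M * N. g l) + (\<Sum>l\<in>{M * N<..Suc M * N}. g l)"
    by (simp only:) (rule sum.union_disjoint, auto)
  with Suc show ?case
    by (simp add: add.assoc)
qed simp

lemma filterlim_div_const_nat:
  assumes "K > (0::nat)"
  shows "filterlim (\<lambda>n. n div K) at_top sequentially"
  unfolding filterlim_at_top
proof
  fix Z :: nat
  show "\<forall>\<^sub>F n in sequentially. Z \<le> n div K"
    using eventually_ge_at_top[of "Z * K"]
  proof eventually_elim
    case (elim n)
    then show ?case
      using assms div_le_mono[of "Z * K" n K] by simp
  qed
qed

lemma powr_Beta_bounds:
  fixes \<gamma> s :: real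
  assumes \<gamma>: "0 \<le> \<gamma>" "\<gamma> \<le> 1" and s: "s > 0" and K: "K \<ge> (2::nat)"
  defines "\<Delta> \<equiv> (\<lambda>i. (real (Suc i) / K) powr \<gamma> - (real i / K) powr \<gamma>)"
    and "v \<equiv> (\<lambda>i. (real (K - i) / K) powr (s * \<gamma>))"
  shows "(\<Sum>i<K. \<Delta> i * v i) \<le> kappa \<gamma> s + (if \<gamma> = 0 then 0 else real K powr - \<gamma>)"
    "(\<Sum>i<K. \<Delta> i * v (Suc i)) \<ge> kappa \<gamma> s - (if \<gamma> = 0 then 0 else real K powr - \<gamma>)"
proof -
  have "(\<Sum>i<K. \<Delta> i * v i) \<le> kappa \<gamma> s + (if \<gamma> = 0 then 0 else real K powr - \<gamma>) \<and>
    (\<Sum>i<K. \<Delta> i * v (Suc i)) \<ge> kappa \<gamma> s - (if \<gamma> = 0 then 0 else real K powr - \<gamma>)"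
  proof (cases "\<gamma> = 0")
    case True
    \<comment> \<open>Since \<open>0 powr 0 = 0\<close>, all the mass sits on the first cell when
      \<gamma> = 0. For the same reason K >= 2 matters: with K = 1 the value \<open>v 1\<close>
      would be 0 instead of 1.\<close>
    then have \<Delta>: "\<Delta> i = (if i = 0 then 1 else 0)" for i
      using K by (simp add: \<Delta>_def)
    have "(\<Sum>i<K. \<Delta> i * h i) = h 0" for h
      using K by (simp add: \<Delta> if_distrib[of "\<lambda>x. x * _"] sum.delta cong: if_cong)
    from this[of v] this[of "\<lambda>i. v (Suc i)"] have "(\<Sum>i<K. \<Delta> i * v i) = 1" "(\<Sum>i<K. \<Delta> i * v (Suc i)) = 1"
      using K True by (simp_all only:) (simp_all add: v_def)
    then show ?thesis
      using True by (simp only: kappa_0) simp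
  next
    case False
    with integral_powr_Beta_bounds[of \<gamma> s K] \<gamma> s K show ?thesis
      unfolding \<Delta>_def v_def by simp
  qed
  then show "(\<Sum>i<K. \<Delta> i * v i) \<le> kappa \<gamma> s + (if \<gamma> = 0 then 0 else real K powr - \<gamma>)"
    "(\<Sum>i<K. \<Delta> i * v (Suc i)) \<ge> kappa \<gamma> s - (if \<gamma> = 0 then 0 else real K powr - \<gamma>)"
    by auto
qed

text \<open>Of regular variation only the values of A at affine arguments mn + r are kept; these are
  the end points produced by cutting {0..n} into K blocks of length \<open>n div K\<close>.\<close>

locale regular_sums =
  fixes p A :: "nat \<Rightarrow> real" and \<gamma> :: real
  assumes A_eq: "\<And>n. A n = (\<Sum>k\<le>n. p k)"
    and p_pos: "\<And>n. p n > 0"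
    and A_lim: "filterlim A at_top sequentially"
    and A_affine: "\<And>m r. m \<ge> 1 \<Longrightarrow> (\<lambda>n. A (m * n + r) / A n) \<longlonglongrightarrow> real m powr \<gamma>"
    and \<gamma>_range: "0 \<le> \<gamma>" "\<gamma> \<le> 1"
begin

lemma A_pos: "A n > 0"
  unfolding A_eq using p_pos by (intro sum_pos) auto

lemma A_nz [simp]: "A n \<noteq> 0"
  using A_pos[of n] by simp

lemma A_mono: "m \<le> n \<Longrightarrow> A m \<le> A n"
  unfolding A_eq using p_pos by (intro sum_mono2) (auto intro: less_imp_le)

text \<open>For m = 0 the numerator is constant and the limit is \<open>0 powr \<gamma> = 0\<close>,
  also when \<gamma> = 0. The first and last blocks of a convolution require this case.\<close>

lemma A_affine': "(\<lambda>n. A (m * n + r) / A n) \<longlonglongrightarrow> real m powr \<gamma>"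
proof (cases "m = 0")
  case True
  then show ?thesis
    by (simp add: real_tendsto_divide_at_top[OF tendsto_const A_lim])
qed (simp add: A_affine)

lemma A_powr_lim:
  assumes "s > 0"
  shows "filterlim (\<lambda>n. A n powr s) at_top sequentially"
proof -
  have "(\<lambda>n. A n powr - s) \<longlonglongrightarrow> 0"
    using assms by (intro tendsto_neg_powr A_lim) auto
  then have "filterlim (\<lambda>n. inverse (A n powr - s)) at_top sequentially"
    by (rule filterlim_inverse_at_top) (use A_pos in \<open>simp add: less_imp_neq[symmetric]\<close>)
  then show ?thesis
    by (simp add: powr_minus)
qed

lemma sum_block: "m \<le> n \<Longrightarrow> (\<Sum>l\<in>{m<..n}. p l) = A n - A m"
proof -
  assume "m \<le> n"
  then have "{..n} = {..m} \<union> {m<..n}" by auto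
  then have "A n = A m + (\<Sum>l\<in>{m<..n}. p l)"
    unfolding A_eq by (simp only:) (rule sum.union_disjoint, auto)
  then show ?thesis by simp
qed

text \<open>Inside a block the weights p add up to an increment of A, and the monotone factor A(n -
  l)^s is replaced by a bound at a block end. The summand l = 0 and the fewer than K indices beyond
  KN give the outer terms of the upper bound; the shift by K absorbs \<open>n mod K\<close>.\<close>

lemma convolution_bounds:
  fixes n K :: nat and s :: real
  assumes s: "s > 0" and K: "K > 0"
  defines "N \<equiv> n div K" and "S \<equiv> (\<Sum>l\<le>n. p l * A (n - l) powr s)"
  shows "S \<le> p 0 * A (K * N + K) powr s
      + (\<Sum>i<K. (A (Suc i * N) - A (i * N)) * A ((K - i) * N + K) powr s)
      + (A (K * N + K) - A (K * N)) * A K powr s"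
    "(\<Sum>i<K. (A (Suc i * N) - A (i * N)) * A ((K - Suc i) * N) powr s) \<le> S"
    "A (K * N) \<le> A n" "A n \<le> A (K * N + K)"
proof -
  have n: "n = K * N + n mod K" "n mod K < K"
    using K by (auto simp: N_def)
  then have n': "K * N \<le> n" "n \<le> K * N + K"
    by linarith+
  then show "A (K * N) \<le> A n" "A n \<le> A (K * N + K)"
    by (auto intro: A_mono)
  define g where "g = (\<lambda>l. p l * A (n - l) powr s)"
  have g0: "g l \<ge> 0" for l
    unfolding g_def using p_pos[of l] by simp
  have "{..n} = {..K * N} \<union> {K * N<..n}"
    using n' by auto
  then have "S = (\<Sum>l\<le>K * N. g l) + (\<Sum>l\<in>{K * N<..n}. g l)"
    unfolding S_def g_def[symmetric] by (simp only:) (rule sum.union_disjoint, auto)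
  then have S: "S = g 0 + (\<Sum>i<K. \<Sum>l\<in>{i * N<..Suc i * N}. g l) + (\<Sum>l\<in>{K * N<..n}. g l)"
    by (simp only: sum_atMost_blocks)
  have g_le: "g l \<le> p l * A m powr s" if "n - l \<le> m" for l m
    unfolding g_def using p_pos[of l] s A_pos A_mono[OF that]
    by (intro mult_left_mono powr_mono2) (auto intro: less_imp_le)
  have g_ge: "p l * A m powr s \<le> g l" if "m \<le> n - l" for l m
    unfolding g_def using p_pos[of l] s A_pos A_mono[OF that]
    by (intro mult_left_mono powr_mono2) (auto intro: less_imp_le)
  have up: "(\<Sum>l\<in>{i * N<..Suc i * N}. g l) \<le> (A (Suc i * N) - A (i * N)) * A ((K - i) * N + K) powr s"
    if i: "i < K" for i
  proof -
    have "n - i * N \<le> (K - i) * N + K"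
      using n' by (simp add: diff_mult_distrib)
    then have "(\<Sum>l\<in>{i * N<..Suc i * N}. g l) \<le> (\<Sum>l\<in>{i * N<..Suc i * N}. p l * A ((K - i) * N + K) powr s)"
      by (intro sum_mono g_le) auto
    then show ?thesis
      by (simp add: sum_distrib_right[symmetric] sum_block)
  qed
  have lo: "(A (Suc i * N) - A (i * N)) * A ((K - Suc i) * N) powr s \<le> (\<Sum>l\<in>{i * N<..Suc i * N}. g l)"
    if i: "i < K" for i
  proof -
    have "(K - Suc i) * N \<le> n - Suc i * N"
      using n' by (simp add: diff_mult_distrib)
    then have "(\<Sum>l\<in>{i * N<..Suc i * N}. p l * A ((K - Suc i) * N) powr s) \<le> (\<Sum>l\<in>{i * N<..Suc i * N}. g l)"
      by (intro sum_mono g_ge) auto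
    then show ?thesis
      by (simp add: sum_distrib_right[symmetric] sum_block)
  qed
  show "(\<Sum>i<K. (A (Suc i * N) - A (i * N)) * A ((K - Suc i) * N) powr s) \<le> S"
    unfolding S using sum_mono[of "{..<K}", OF lo] g0[of 0] sum_nonneg[of "{K * N<..n}" g] g0
    by fastforce
  have "(\<Sum>l\<in>{K * N<..n}. g l) \<le> (\<Sum>l\<in>{K * N<..n}. p l * A K powr s)"
    using n' by (intro sum_mono g_le) auto
  also have "\<dots> = (A n - A (K * N)) * A K powr s"
    using n' by (simp add: sum_distrib_right[symmetric] sum_block)
  also have "\<dots> \<le> (A (K * N + K) - A (K * N)) * A K powr s"
    using n' by (intro mult_right_mono diff_mono A_mono) auto
  finally have "(\<Sum>l\<in>{K * N<..n}. g l) \<le> (A (K * N + K) - A (K * N)) * A K powr s" .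
  moreover have "g 0 \<le> p 0 * A (K * N + K) powr s"
    using n' by (intro g_le) auto
  ultimately show "S \<le> p 0 * A (K * N + K) powr s
      + (\<Sum>i<K. (A (Suc i * N) - A (i * N)) * A ((K - i) * N + K) powr s)
      + (A (K * N + K) - A (K * N)) * A K powr s"
    unfolding S using sum_mono[of "{..<K}", OF up] by fastforce
qed

text \<open>For a fixed number K of blocks, both bounds converge to the Stieltjes sums of the Beta
  integral as n grows. K is chosen beforehand, large enough for these sums to be within \<epsilon>
  of \<open>kappa \<gamma> s\<close>.\<close>

lemma convolution_powr_limit:
  assumes s: "s > 0"
  shows "(\<lambda>n. (\<Sum>l\<le>n. p l * A (n - l) powr s) / A n powr (s + 1)) \<longlonglongrightarrow> kappa \<gamma> s"
proof (rule tendstoI)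
  fix \<epsilon> :: real assume \<epsilon>: "\<epsilon> > 0"
  define err where "err = (\<lambda>K. if \<gamma> = 0 then 0 else real K powr - \<gamma>)"
  have "err \<longlonglongrightarrow> 0"
    unfolding err_def using \<gamma>_range
    by (cases "\<gamma> = 0") (auto intro!: tendsto_neg_powr filterlim_real_sequentially)
  then have "\<forall>\<^sub>F K in sequentially. err K < \<epsilon>"
    using \<epsilon> by (rule order_tendstoD)
  then have "\<forall>\<^sub>F K in sequentially. err K < \<epsilon> \<and> K \<ge> 2"
    using eventually_ge_at_top by (rule eventually_conj)
  then obtain K where err: "err K < \<epsilon>" and K: "K \<ge> 2"
    using eventually_happens trivial_limit_sequentially by blast
  define R where "R = (\<lambda>m r N. A (m * N + r) / A N)"
  have R: "R m r \<longlonglongrightarrow> real m powr \<gamma>" for m r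
    unfolding R_def by (rule A_affine')
  have Rs: "(\<lambda>N. R m r N powr s) \<longlonglongrightarrow> (real m powr \<gamma>) powr s" for m r
    using s A_pos by (intro tendsto_powr' tendsto_const R) (auto simp: R_def less_imp_le)
  have R_s1: "(\<lambda>N. R K r N powr (s + 1)) \<longlonglongrightarrow> (real K powr \<gamma>) powr (s + 1)" for r
    using K by (intro tendsto_powr tendsto_const R) auto
  have inv: "(\<lambda>N. 1 / A N) \<longlonglongrightarrow> 0"
    by (rule real_tendsto_divide_at_top[OF tendsto_const A_lim])
  \<comment> \<open>\<open>up\<close> and \<open>lo\<close> are the bounds of
    \<open>convolution_bounds\<close> after division by A(N)^(s + 1), expressed through the
    convergent ratios R. The denominator A(n) is replaced by A(KN) for the upper and by A(KN + K)
    for the lower bound.\<close>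
  define up where "up = (\<lambda>N. (p 0 * (1 / A N) * R K K N powr s
      + (\<Sum>i<K. (R (Suc i) 0 N - R i 0 N) * R (K - i) K N powr s)
      + (R K K N - R K 0 N) * R 0 K N powr s) / R K 0 N powr (s + 1))"
  define lo where "lo = (\<lambda>N. (\<Sum>i<K. (R (Suc i) 0 N - R i 0 N) * R (K - Suc i) 0 N powr s) / R K K N powr (s + 1))"
  define \<Delta> where "\<Delta> = (\<lambda>i. (real (Suc i) / K) powr \<gamma> - (real i / K) powr \<gamma>)"
  define v where "v = (\<lambda>i. (real (K - i) / K) powr (s * \<gamma>))"
  have conv: "((real (Suc i) powr \<gamma> - real i powr \<gamma>) * (real (K - j) powr \<gamma>) powr s) / (real K powr \<gamma>) powr (s + 1)
      = \<Delta> i * v j" for i j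
    unfolding \<Delta>_def v_def using K
    by (simp add: powr_divide powr_powr powr_add field_simps)
  define U where "U = (p 0 * 0 * (real K powr \<gamma>) powr s
      + (\<Sum>i<K. (real (Suc i) powr \<gamma> - real i powr \<gamma>) * (real (K - i) powr \<gamma>) powr s)
      + (real K powr \<gamma> - real K powr \<gamma>) * (real 0 powr \<gamma>) powr s) / (real K powr \<gamma>) powr (s + 1)"
  have "up \<longlonglongrightarrow> U"
    unfolding up_def U_def using K by (intro tendsto_intros inv R Rs R_s1) auto
  also have "U = (\<Sum>i<K. \<Delta> i * v i)"
    by (simp add: U_def sum_divide_distrib conv del: of_nat_Suc of_nat_diff)
  finally have "up \<longlonglongrightarrow> (\<Sum>i<K. \<Delta> i * v i)" .
  moreover have "(\<Sum>i<K. \<Delta> i * v i) < kappa \<gamma> s + \<epsilon>"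
    using powr_Beta_bounds(1)[OF \<gamma>_range s K] err unfolding err_def \<Delta>_def v_def by linarith
  ultimately have up_ev: "\<forall>\<^sub>F N in sequentially. up N < kappa \<gamma> s + \<epsilon>"
    by (rule order_tendstoD)
  define L where "L = (\<Sum>i<K. (real (Suc i) powr \<gamma> - real i powr \<gamma>) * (real (K - Suc i) powr \<gamma>) powr s)
      / (real K powr \<gamma>) powr (s + 1)"
  have "lo \<longlonglongrightarrow> L"
    unfolding lo_def L_def using K by (intro tendsto_intros inv R Rs R_s1) auto
  also have "L = (\<Sum>i<K. \<Delta> i * v (Suc i))"
    by (simp add: L_def sum_divide_distrib conv del: of_nat_Suc of_nat_diff)
  finally have "lo \<longlonglongrightarrow> (\<Sum>i<K. \<Delta> i * v (Suc i))" .
  moreover have "(\<Sum>i<K. \<Delta> i * v (Suc i)) > kappa \<gamma> s - \<epsilon>"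
    using powr_Beta_bounds(2)[OF \<gamma>_range s K] err unfolding err_def \<Delta>_def v_def by linarith
  ultimately have lo_ev: "\<forall>\<^sub>F N in sequentially. lo N > kappa \<gamma> s - \<epsilon>"
    by (rule order_tendstoD)
  have div: "filterlim (\<lambda>n. n div K) at_top sequentially"
    using K by (intro filterlim_div_const_nat) auto
  have "\<forall>\<^sub>F n in sequentially. up (n div K) < kappa \<gamma> s + \<epsilon> \<and> lo (n div K) > kappa \<gamma> s - \<epsilon>"
    using eventually_compose_filterlim[OF up_ev div] eventually_compose_filterlim[OF lo_ev div]
    by (rule eventually_conj)
  then show "\<forall>\<^sub>F n in sequentially. dist ((\<Sum>l\<le>n. p l * A (n - l) powr s) / A n powr (s + 1)) (kappa \<gamma> s) < \<epsilon>"
  proof eventually_elim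
    case (elim n)
    define N where "N = n div K"
    define S where "S = (\<Sum>l\<le>n. p l * A (n - l) powr s)"
    have AR: "A (m * N + r) = A N * R m r N" "A (m * N) = A N * R m 0 N" "A K = A N * R 0 K N" for m r
      unfolding R_def using A_pos[of N] by auto
    have RR: "R m r N \<ge> 0" for m r
      unfolding R_def using A_pos by (simp add: less_imp_le)
    have R0: "R K r N > 0" for r
      unfolding R_def using A_pos by simp
    have split: "x powr (s + 1) = x powr s * x" if "x > 0" for x :: real
      using that by (simp add: powr_add)
    note b = convolution_bounds[OF s, of K n, folded N_def S_def]
    have "S \<ge> 0"
      unfolding S_def using p_pos by (intro sum_nonneg mult_nonneg_nonneg) (auto intro: less_imp_le)
    have "S / A n powr (s + 1) \<le> S / A (K * N) powr (s + 1)"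
      using b(3) K s A_pos \<open>S \<ge> 0\<close>
      by (intro divide_left_mono powr_mono2 mult_pos_pos) (auto intro: less_imp_le)
    also have "\<dots> \<le> (p 0 * A (K * N + K) powr s
      + (\<Sum>i<K. (A (Suc i * N) - A (i * N)) * A ((K - i) * N + K) powr s)
      + (A (K * N + K) - A (K * N)) * A K powr s) / A (K * N) powr (s + 1)"
      using b(1) K by (intro divide_right_mono) auto
    also have "\<dots> = up N"
      unfolding up_def AR powr_mult split[OF A_pos] right_diff_distrib[symmetric]
      using A_pos[of N] R0[of 0]
      by (simp add: sum_distrib_left[symmetric] sum_distrib_right[symmetric] field_simps
          sum_distrib_left)
    finally have 1: "S / A n powr (s + 1) \<le> up N" .
    have "lo N = (\<Sum>i<K. (A (Suc i * N) - A (i * N)) * A ((K - Suc i) * N) powr s) / A (K * N + K) powr (s + 1)"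
      unfolding lo_def AR powr_mult split[OF A_pos] right_diff_distrib[symmetric]
      using A_pos[of N] R0[of K]
      by (simp add: field_simps sum_distrib_left)
    also have "\<dots> \<le> S / A (K * N + K) powr (s + 1)"
      using b(2) K by (intro divide_right_mono) auto
    also have "\<dots> \<le> S / A n powr (s + 1)"
      using b(4) K s A_pos \<open>S \<ge> 0\<close>
      by (intro divide_left_mono powr_mono2 mult_pos_pos) (auto intro: less_imp_le)
    finally have "lo N \<le> S / A n powr (s + 1)" .
    with 1 elim show ?case
      unfolding S_def[symmetric] N_def[symmetric] by (simp add: dist_real_def abs_less_iff)
  qed
qed

text \<open>Writing f = c A^s + h reduces the claim to h = o(A^s). The early values of h are bounded
  by a constant D, which contributes D A(n) and is negligible against A(n)^(s + 1) because s >
  0.\<close>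

lemma convolution_limit:
  assumes s: "s > 0" and f: "(\<lambda>n. f n / A n powr s) \<longlonglongrightarrow> c"
  shows "(\<lambda>n. (\<Sum>l\<le>n. p l * f (n - l)) / A n powr (s + 1)) \<longlonglongrightarrow> c * kappa \<gamma> s"
proof -
  define h where "h = (\<lambda>n. f n - c * A n powr s)"
  have h0: "(\<lambda>n. h n / A n powr s) \<longlonglongrightarrow> 0"
    using tendsto_diff[OF f tendsto_const[of c]] A_pos
    by (simp add: h_def diff_divide_distrib less_imp_neq[symmetric])
  have "(\<lambda>n. (\<Sum>l\<le>n. p l * h (n - l)) / A n powr (s + 1)) \<longlonglongrightarrow> 0"
  proof (rule tendstoI)
    fix \<epsilon> :: real assume \<epsilon>: "\<epsilon> > 0"
    from tendstoD[OF h0, of "\<epsilon>/2"] \<epsilon> obtain m where m: "\<And>n. n \<ge> m \<Longrightarrow> \<bar>h n\<bar> / A n powr s < \<epsilon>/2"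
      by (auto simp: eventually_sequentially dist_real_def abs_divide)
    define D where "D = (\<Sum>n<m. \<bar>h n\<bar>)"
    have "D \<ge> 0" unfolding D_def by (simp add: sum_nonneg)
    have hb: "\<bar>h n\<bar> \<le> \<epsilon> / 2 * A n powr s + D" for n
    proof (cases "n < m")
      case True
      then have "\<bar>h n\<bar> \<le> D"
        unfolding D_def by (intro member_le_sum) auto
      moreover have "0 \<le> \<epsilon> / 2 * A n powr s"
        using \<epsilon> by simp
      ultimately show ?thesis by linarith
    next
      case False
      then have "\<bar>h n\<bar> < \<epsilon> / 2 * A n powr s"
        using m[of n] A_pos[of n] by (simp add: divide_less_eq)
      with \<open>D \<ge> 0\<close> show ?thesis by linarith
    qed
    have "(\<lambda>n. D / A n powr s) \<longlonglongrightarrow> 0"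
      by (rule real_tendsto_divide_at_top[OF tendsto_const A_powr_lim[OF s]])
    then have "\<forall>\<^sub>F n in sequentially. D / A n powr s < \<epsilon> / 2"
      using \<epsilon> by (intro order_tendstoD(2)) auto
    then show "\<forall>\<^sub>F n in sequentially. dist ((\<Sum>l\<le>n. p l * h (n - l)) / A n powr (s + 1)) 0 < \<epsilon>"
    proof eventually_elim
      case (elim n)
      have "\<bar>\<Sum>l\<le>n. p l * h (n - l)\<bar> \<le> (\<Sum>l\<le>n. p l * \<bar>h (n - l)\<bar>)"
        by (rule order_trans[OF sum_abs]) (simp add: abs_mult p_pos less_imp_le)
      also have "\<dots> \<le> (\<Sum>l\<le>n. p l * (\<epsilon> / 2 * A n powr s + D))"
      proof (intro sum_mono mult_left_mono less_imp_le[OF p_pos])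
        fix l
        have "A (n - l) powr s \<le> A n powr s"
          using s A_pos A_mono[of "n - l" n] by (intro powr_mono2) (auto intro: less_imp_le)
        then have "\<epsilon> / 2 * A (n - l) powr s \<le> \<epsilon> / 2 * A n powr s"
          using \<epsilon> by (intro mult_left_mono) auto
        then show "\<bar>h (n - l)\<bar> \<le> \<epsilon> / 2 * A n powr s + D"
          using hb[of "n - l"] by linarith
      qed
      also have "\<dots> = A n * (\<epsilon> / 2 * A n powr s + D)"
        by (simp add: A_eq sum_distrib_right)
      also have "\<dots> < A n * (\<epsilon> * A n powr s)"
        using elim A_pos[of n] by (intro mult_strict_left_mono) (auto simp: divide_less_eq)
      also have "\<dots> = \<epsilon> * A n powr (s + 1)"
        using A_pos[of n] by (simp add: powr_add)
      finally show ?case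
        using A_pos[of n] by (simp add: dist_real_def abs_divide divide_less_eq)
    qed
  qed
  from tendsto_add[OF this tendsto_mult_left[OF convolution_powr_limit[OF s], of c]]
  have "(\<lambda>n. (\<Sum>l\<le>n. p l * h (n - l)) / A n powr (s + 1)
      + c * ((\<Sum>l\<le>n. p l * A (n - l) powr s) / A n powr (s + 1))) \<longlonglongrightarrow> c * kappa \<gamma> s"
    by simp
  moreover have "(\<Sum>l\<le>n. p l * h (n - l)) / A n powr (s + 1)
      + c * ((\<Sum>l\<le>n. p l * A (n - l) powr s) / A n powr (s + 1)) = (\<Sum>l\<le>n. p l * f (n - l)) / A n powr (s + 1)" for n
    by (simp add: h_def sum_distrib_left add_divide_distrib[symmetric] sum.distrib[symmetric] algebra_simps)
  ultimately show ?thesis by (simp only:)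
qed

end

section \<open>The method of moments\<close>

text \<open>Weak convergence tests only bounded continuous functions, so powers are clamped to
  [-R, R]. Clamped even powers stay below the even moments, and monotone convergence in R gives
  integrability of the limit. The clamping error is controlled by a higher even moment divided by R,
  uniformly in n, so the two limits may be exchanged.\<close>

lemma weak_conv_moments:
  assumes \<mu>: "\<And>n. real_distribution (\<mu> n)" and \<nu>: "real_distribution \<nu>"
    and weak: "weak_conv_m \<mu> \<nu>"
    and int: "\<And>n k. integrable (\<mu> n) (\<lambda>x. x ^ k)"
    and lim: "\<And>k. (\<lambda>n. \<integral>x. x ^ k \<partial>\<mu> n) \<longlonglongrightarrow> m k"
  shows "integrable \<nu> (\<lambda>x. x ^ k)" "(\<integral>x. x ^ k \<partial>\<nu>) = m k"
proof -
  interpret \<mu>: real_distribution "\<mu> n" for n by (rule \<mu>)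
  interpret \<nu>: real_distribution \<nu> by (rule \<nu>)
  define cl where "cl = (\<lambda>R x::real. max (- R) (min R x))"
  have cl_abs: "R \<ge> 0 \<Longrightarrow> \<bar>cl R x\<bar> \<le> \<bar>x\<bar>" "R \<ge> 0 \<Longrightarrow> \<bar>cl R x\<bar> \<le> R" "\<bar>x\<bar> \<le> R \<Longrightarrow> cl R x = x" for R x
    by (auto simp: cl_def)
  have cl_cont: "continuous_on UNIV (\<lambda>x. cl R x ^ k)" for R k
    unfolding cl_def by (intro continuous_intros)
  have cl_meas [measurable]: "(\<lambda>x. cl R x ^ k) \<in> borel_measurable borel" for R k
    by (rule borel_measurable_continuous_onI[OF cl_cont])
  have cl_bd: "norm (cl R x ^ k) \<le> R ^ k" if "R \<ge> 0" for R x k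
    using cl_abs(2)[OF that] by (simp add: power_abs power_mono)
  have cl_int\<mu>: "integrable (\<mu> n) (\<lambda>x. cl R x ^ k)" if "R \<ge> 0" for n k R
    using cl_bd[OF that] by (intro \<mu>.integrable_const_bound[where B="R ^ k"]) auto
  have cl_int\<nu>: "integrable \<nu> (\<lambda>x. cl R x ^ k)" if "R \<ge> 0" for k R
    using cl_bd[OF that] by (intro \<nu>.integrable_const_bound[where B="R ^ k"]) auto
  have cl_lim: "(\<lambda>n. \<integral>x. cl R x ^ k \<partial>\<mu> n) \<longlonglongrightarrow> (\<integral>x. cl R x ^ k \<partial>\<nu>)" if "R \<ge> 0" for k R
    using cl_cont[of R k]
    by (intro weak_conv_imp_integral_bdd_continuous_conv[OF \<mu> \<nu> weak, of _ "R ^ k"] cl_bd[OF that])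
      (simp add: continuous_on_eq_continuous_at)
  have even_le: "(\<integral>x. cl R x ^ (2 * k) \<partial>\<nu>) \<le> m (2 * k)" if "R \<ge> 0" for R k
  proof (rule LIMSEQ_le[OF cl_lim[OF that] lim])
    have "cl R x ^ (2 * k) \<le> x ^ (2 * k)" for x
      using power_mono[OF cl_abs(1)[OF that, of x], of "2 * k"] by (simp add: power_even_abs)
    then show "\<exists>N. \<forall>n\<ge>N. (\<integral>x. cl R x ^ (2 * k) \<partial>\<mu> n) \<le> (\<integral>x. x ^ (2 * k) \<partial>\<mu> n)"
      using cl_int\<mu>[OF that] int by (auto intro!: integral_mono)
  qed
  have even: "integrable \<nu> (\<lambda>x. x ^ (2 * k)) \<and> (\<integral>x. x ^ (2 * k) \<partial>\<nu>) \<le> m (2 * k)" for k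
  proof -
    define f where "f = (\<lambda>i x. cl (real i) x ^ (2 * k))"
    have f_mono: "f i x \<le> f j x" if "i \<le> j" for i j x
    proof -
      have "\<bar>cl (real i) x\<bar> \<le> \<bar>cl (real j) x\<bar>"
        using that by (auto simp: cl_def)
      from power_mono[OF this, of "2 * k"] show ?thesis
        by (simp add: f_def power_even_abs)
    qed
    have f_int: "integrable \<nu> (f i)" for i
      unfolding f_def by (intro cl_int\<nu>) simp
    have "incseq (\<lambda>i. \<integral>x. f i x \<partial>\<nu>)"
      by (intro monoI integral_mono f_int f_mono)
    moreover have le: "(\<integral>x. f i x \<partial>\<nu>) \<le> m (2 * k)" for i
      unfolding f_def by (intro even_le) simp
    ultimately obtain L where L: "(\<lambda>i. \<integral>x. f i x \<partial>\<nu>) \<longlonglongrightarrow> L"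
      using incseq_convergent[of "\<lambda>i. \<integral>x. f i x \<partial>\<nu>" "m (2 * k)"] by blast
    have lim: "(\<lambda>i. f i x) \<longlonglongrightarrow> x ^ (2 * k)" for x
    proof (rule tendsto_eventually)
      obtain i0 :: nat where "\<bar>x\<bar> \<le> real i0" using real_arch_simple by blast
      then show "\<forall>\<^sub>F i in sequentially. f i x = x ^ (2 * k)"
        unfolding eventually_sequentially f_def
        by (intro exI[of _ i0]) (auto intro!: arg_cong[of _ _ "\<lambda>y. y ^ (2 * k)"] cl_abs(3))
    qed
    have mono: "AE x in \<nu>. mono (\<lambda>i. f i x)" "AE x in \<nu>. (\<lambda>i. f i x) \<longlonglongrightarrow> x ^ (2 * k)"
      using lim by (auto intro!: monoI f_mono)
    have meas: "(\<lambda>x. x ^ (2 * k)) \<in> borel_measurable \<nu>"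
      by simp
    from integrable_monotone_convergence[OF f_int mono L meas]
      integral_monotone_convergence[OF f_int mono L meas]
    show ?thesis
      using LIMSEQ_le_const2[OF L] le by auto
  qed
  have int_\<nu>: "integrable \<nu> (\<lambda>x. x ^ k)" for k
  proof (rule Bochner_Integration.integrable_bound[where f="\<lambda>x. 1 + x ^ (2 * k)"])
    show "integrable \<nu> (\<lambda>x. 1 + x ^ (2 * k))"
      using even[of k] by simp
    have "\<bar>x ^ k\<bar> \<le> 1 + x ^ (2 * k)" for x :: real
      using zero_le_power2[of "\<bar>x ^ k\<bar> - 1"] abs_ge_zero[of "x ^ k"]
      unfolding power2_diff power2_abs power_mult[symmetric] mult.commute[of k 2] by simp
    then show "AE x in \<nu>. norm (x ^ k) \<le> norm (1 + x ^ (2 * k))"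
      by (auto simp: power_mult intro: order_trans[OF _ abs_ge_self])
  qed simp
  then show "integrable \<nu> (\<lambda>x. x ^ k)" .
  \<comment> \<open>Beyond R there is a spare factor |x| / R >= 1. Raising the exponent to the even
    number 2k + 2, allowed since |x| > 1 there, removes the absolute value.\<close>
  have trunc: "\<bar>x ^ k - cl R x ^ k\<bar> \<le> 2 * x ^ (2 * Suc k) / R" if R: "R \<ge> 1" for x R :: real
  proof (cases "\<bar>x\<bar> \<le> R")
    case True
    have "0 \<le> 2 * x ^ (2 * Suc k) / R"
      using R by (intro divide_nonneg_nonneg mult_nonneg_nonneg zero_le_even_power) auto
    then show ?thesis
      by (simp only: cl_abs(3)[OF True] diff_self abs_zero)
  next
    case False
    have "\<bar>x ^ k - cl R x ^ k\<bar> \<le> \<bar>x\<bar> ^ k + \<bar>cl R x\<bar> ^ k"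
      by (metis abs_triangle_ineq4 power_abs)
    also have "\<dots> \<le> 2 * \<bar>x\<bar> ^ k"
      using power_mono[OF cl_abs(1)[of R x], of k] R by simp
    finally have 1: "\<bar>x ^ k - cl R x ^ k\<bar> \<le> 2 * \<bar>x\<bar> ^ k" .
    have "\<bar>x\<bar> ^ k * R \<le> \<bar>x\<bar> ^ k * \<bar>x\<bar>"
      using False by (intro mult_left_mono) auto
    also have "\<dots> = \<bar>x\<bar> ^ Suc k" by simp
    also have "\<dots> \<le> \<bar>x\<bar> ^ (2 * Suc k)"
      using False R by (intro power_increasing) auto
    also have "\<dots> = x ^ (2 * Suc k)"
      by (intro power_even_abs) simp
    finally have "2 * \<bar>x\<bar> ^ k \<le> 2 * x ^ (2 * Suc k) / R"
      using R by (simp add: field_simps)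
    with 1 show ?thesis by linarith
  qed
  have diff: "\<bar>(\<integral>x. x ^ k \<partial>\<rho>) - (\<integral>x. cl R x ^ k \<partial>\<rho>)\<bar> \<le> 2 * (\<integral>x. x ^ (2 * Suc k) \<partial>\<rho>) / R"
    if R: "R \<ge> 1" and i: "\<And>k. integrable \<rho> (\<lambda>x. x ^ k)" "integrable \<rho> (\<lambda>x. cl R x ^ k)" for \<rho> and R :: real
  proof -
    have "\<bar>(\<integral>x. x ^ k \<partial>\<rho>) - (\<integral>x. cl R x ^ k \<partial>\<rho>)\<bar> = \<bar>\<integral>x. x ^ k - cl R x ^ k \<partial>\<rho>\<bar>"
      using i by simp
    also have "\<dots> \<le> (\<integral>x. \<bar>x ^ k - cl R x ^ k\<bar> \<partial>\<rho>)"
      by (rule integral_abs_bound)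
    also have "\<dots> \<le> (\<integral>x. 2 * x ^ (2 * Suc k) / R \<partial>\<rho>)"
      by (intro integral_mono integrable_abs Bochner_Integration.integrable_diff integrable_divide_zero
          integrable_mult_right i trunc[OF R])
    finally show ?thesis by simp
  qed
  define D where "D = \<bar>(\<integral>x. x ^ k \<partial>\<nu>) - m k\<bar>"
  have D: "D \<le> 4 * m (2 * Suc k) / R" if R: "R \<ge> 1" for R :: real
  proof -
    have "\<bar>m k - (\<integral>x. cl R x ^ k \<partial>\<nu>)\<bar> \<le> 2 * m (2 * Suc k) / R"
    proof (rule LIMSEQ_le)
      show "(\<lambda>n. \<bar>(\<integral>x. x ^ k \<partial>\<mu> n) - (\<integral>x. cl R x ^ k \<partial>\<mu> n)\<bar>) \<longlonglongrightarrow> \<bar>m k - (\<integral>x. cl R x ^ k \<partial>\<nu>)\<bar>"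
        using R by (intro tendsto_intros lim cl_lim) auto
      show "(\<lambda>n. 2 * (\<integral>x. x ^ (2 * Suc k) \<partial>\<mu> n) / R) \<longlonglongrightarrow> 2 * m (2 * Suc k) / R"
        using R by (intro tendsto_intros lim) auto
    qed (use R cl_int\<mu> int diff[OF R] in auto)
    moreover have "\<bar>(\<integral>x. x ^ k \<partial>\<nu>) - (\<integral>x. cl R x ^ k \<partial>\<nu>)\<bar> \<le> 2 * m (2 * Suc k) / R"
    proof -
      have "\<bar>(\<integral>x. x ^ k \<partial>\<nu>) - (\<integral>x. cl R x ^ k \<partial>\<nu>)\<bar> \<le> 2 * (\<integral>x. x ^ (2 * Suc k) \<partial>\<nu>) / R"
        using R cl_int\<nu> int_\<nu> by (intro diff) auto
      also have "\<dots> \<le> 2 * m (2 * Suc k) / R"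
        using R conjunct2[OF even[of "Suc k"]] by (intro divide_right_mono mult_left_mono) auto
      finally show ?thesis .
    qed
    moreover have "4 * m (2 * Suc k) / R = 2 * m (2 * Suc k) / R + 2 * m (2 * Suc k) / R"
      by simp
    ultimately show ?thesis
      unfolding D_def by linarith
  qed
  have "(\<lambda>n. 4 * m (2 * Suc k) / real (Suc n)) \<longlonglongrightarrow> 0"
    by (intro real_tendsto_divide_at_top[OF tendsto_const] filterlim_compose[OF filterlim_real_sequentially filterlim_Suc])
  then have "D \<le> 0"
    by (rule LIMSEQ_le_const) (use D in auto)
  then show "(\<integral>x. x ^ k \<partial>\<nu>) = m k"
    unfolding D_def by simp
qed

lemma tight_of_second_moments:
  assumes \<mu>: "\<And>n. real_distribution (\<mu> n)"
    and int: "\<And>n. integrable (\<mu> n) (\<lambda>x. x\<^sup>2)"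
    and bd: "\<And>n. (\<integral>x. x\<^sup>2 \<partial>\<mu> n) \<le> C"
  shows "tight \<mu>"
  unfolding tight_def
proof (intro conjI allI impI \<mu>)
  fix \<epsilon> :: real assume \<epsilon>: "\<epsilon> > 0"
  define a where "a = sqrt (\<bar>C\<bar> / \<epsilon> + 1)"
  have a2: "a\<^sup>2 = \<bar>C\<bar> / \<epsilon> + 1" "a > 0"
    using \<epsilon> by (auto simp: a_def intro!: add_nonneg_pos)
  have "1 - \<epsilon> < measure (\<mu> n) {-a<..a}" for n
  proof -
    interpret real_distribution "\<mu> n" by (rule \<mu>)
    have "prob {x \<in> space (\<mu> n). a \<le> \<bar>x\<bar>} \<le> (\<integral>x. x\<^sup>2 \<partial>\<mu> n) / a\<^sup>2"
      using int a2 by (intro second_moment_method) auto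
    also have "\<dots> \<le> \<bar>C\<bar> / a\<^sup>2"
      using bd[of n] by (intro divide_right_mono) auto
    also have "\<dots> < \<epsilon>"
      using \<epsilon> unfolding a2 by (simp add: field_simps add_pos_nonneg)
    finally have "prob {x. a \<le> \<bar>x\<bar>} < \<epsilon>" by simp
    moreover have "prob (space (\<mu> n) - {-a<..a}) \<le> prob {x. a \<le> \<bar>x\<bar>}"
      by (intro finite_measure_mono) auto
    moreover have "prob (space (\<mu> n) - {-a<..a}) = 1 - prob {-a<..a}"
      by (intro prob_compl) auto
    ultimately show ?thesis by linarith
  qed
  with a2 show "\<exists>a b. a < b \<and> (\<forall>n. 1 - \<epsilon> < measure (\<mu> n) {a<..b})"
    by (intro exI[of _ "-a"] exI[of _ a]) auto
qed

lemma tight_of_convergent_moments: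
  assumes \<mu>: "\<And>n. real_distribution (\<mu> n)"
    and int: "\<And>n k. integrable (\<mu> n) (\<lambda>x. x ^ k)"
    and lim: "\<And>k. (\<lambda>n. \<integral>x. x ^ k \<partial>\<mu> n) \<longlonglongrightarrow> m k"
  shows "tight \<mu>"
proof -
  have "convergent (\<lambda>n. \<integral>x. x\<^sup>2 \<partial>\<mu> n)"
    using lim[of 2] by (auto simp: convergent_def)
  then have "Bseq (\<lambda>n. \<integral>x. x\<^sup>2 \<partial>\<mu> n)"
    by (rule convergent_imp_Bseq)
  then obtain C where "\<And>n. norm (\<integral>x. x\<^sup>2 \<partial>\<mu> n) \<le> C"
    unfolding Bseq_def by blast
  then have "(\<integral>x. x\<^sup>2 \<partial>\<mu> n) \<le> C" for n
    by (metis abs_ge_self order_trans real_norm_def)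
  with \<mu> int show ?thesis
    by (intro tight_of_second_moments) auto
qed

text \<open>Prokhorov compactness turns a convergent sequence of moments into an actual law having
  the limit moments. The Mittag-Leffler law arises in this way.\<close>

lemma moment_problem_solvable:
  assumes \<mu>: "\<And>n. real_distribution (\<mu> n)"
    and int: "\<And>n k. integrable (\<mu> n) (\<lambda>x. x ^ k)"
    and lim: "\<And>k. (\<lambda>n. \<integral>x. x ^ k \<partial>\<mu> n) \<longlonglongrightarrow> m k"
  obtains r \<nu> where "strict_mono (r :: nat \<Rightarrow> nat)" "real_distribution \<nu>" "weak_conv_m (\<mu> \<circ> r) \<nu>"
    "\<And>k. integrable \<nu> (\<lambda>x. x ^ k)" "\<And>k. (\<integral>x. x ^ k \<partial>\<nu>) = m k"
proof -
  from tight_imp_convergent_subsubsequence[OF tight_of_convergent_moments[OF assms] strict_mono_id]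
  obtain r \<nu> where r: "strict_mono (r :: nat \<Rightarrow> nat)" "real_distribution \<nu>" "weak_conv_m (\<mu> \<circ> r) \<nu>"
    by (auto simp: comp_def)
  have "integrable \<nu> (\<lambda>x. x ^ k) \<and> (\<integral>x. x ^ k \<partial>\<nu>) = m k" for k
    using weak_conv_moments[OF _ r(2,3), of m k] \<mu> int LIMSEQ_subseq_LIMSEQ[OF lim r(1)]
    by (auto simp: comp_def)
  with r that show thesis by blast
qed

lemma abs_power_le_exp:
  fixes x s :: real
  assumes s: "s > 0"
  shows "\<bar>x\<bar> ^ k \<le> fact k / s ^ k * exp (s * \<bar>x\<bar>)"
proof -
  have "(s * \<bar>x\<bar>) ^ k / fact k \<le> exp (s * \<bar>x\<bar>)"
  proof -
    have "(\<Sum>n\<in>{k}. (s * \<bar>x\<bar>) ^ n / fact n) \<le> (\<Sum>n. (s * \<bar>x\<bar>) ^ n / fact n)"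
      using s summable_exp[of "s * \<bar>x\<bar>"]
      by (intro sum_le_suminf) (auto simp: divide_inverse mult.commute)
    then show ?thesis
      by (simp add: exp_def divide_inverse scaleR_conv_of_real mult.commute)
  qed
  then show ?thesis
    using s by (simp add: power_mult_distrib field_simps)
qed

lemma exp_moment_weighted_integrable:
  fixes M :: "real measure"
  assumes [measurable_cong]: "sets M = sets borel" and s: "s > 0"
    and i: "integrable M (\<lambda>x. exp (s * \<bar>x\<bar>))"
  shows "integrable M (\<lambda>x. \<bar>x\<bar> ^ k * exp (s / 2 * \<bar>x\<bar>))"
proof (rule Bochner_Integration.integrable_bound[OF integrable_mult_right[OF i, of "fact k / (s / 2) ^ k"]])
  have "\<bar>x\<bar> ^ k * exp (s / 2 * \<bar>x\<bar>) \<le> fact k / (s / 2) ^ k * exp (s * \<bar>x\<bar>)" for x :: real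
  proof -
    have "\<bar>x\<bar> ^ k * exp (s / 2 * \<bar>x\<bar>) \<le> (fact k / (s / 2) ^ k * exp (s / 2 * \<bar>x\<bar>)) * exp (s / 2 * \<bar>x\<bar>)"
      using s by (intro mult_right_mono abs_power_le_exp) auto
    also have "\<dots> = fact k / (s / 2) ^ k * (exp (s / 2 * \<bar>x\<bar>) * exp (s / 2 * \<bar>x\<bar>))"
      by simp
    also have "exp (s / 2 * \<bar>x\<bar>) * exp (s / 2 * \<bar>x\<bar>) = exp (s * \<bar>x\<bar>)"
      by (simp add: exp_add[symmetric])
    finally show ?thesis .
  qed
  then show "AE x in M. norm (\<bar>x\<bar> ^ k * exp (s / 2 * \<bar>x\<bar>)) \<le> norm (fact k / (s / 2) ^ k * exp (s * \<bar>x\<bar>))"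
    using s by (auto simp: abs_mult)
qed simp

text \<open>Up to powers of the imaginary unit, this is the Taylor series at t of the k-th
  derivative of the characteristic function. The dominating function |x|^k exp(s|x| / 2) does not
  involve t, so the radius s / 2 is the same at every centre.\<close>

lemma iexp_moment_expansion:
  fixes M :: "real measure"
  assumes sets [measurable_cong]: "sets M = sets borel" and s: "s > 0"
    and i: "integrable M (\<lambda>x. exp (s * \<bar>x\<bar>))" and h: "\<bar>h\<bar> \<le> s / 2"
  shows "(\<lambda>n. \<Sum>j<n. (\<i> * complex_of_real h) ^ j / fact j * (\<integral>x. of_real x ^ (k + j) * iexp (t * x) \<partial>M))
    \<longlonglongrightarrow> (\<integral>x. of_real x ^ k * iexp ((t + h) * x) \<partial>M)"
proof -
  have moment: "integrable M (\<lambda>x. complex_of_real x ^ n * iexp (t * x))" for n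
  proof (rule Bochner_Integration.integrable_bound[OF exp_moment_weighted_integrable[OF sets s i, of n]])
    have "\<bar>x\<bar> ^ n * 1 \<le> \<bar>x\<bar> ^ n * exp (s * \<bar>x\<bar> / 2)" for x
      using s by (intro mult_left_mono) auto
    then show "AE x in M. norm (complex_of_real x ^ n * iexp (t * x)) \<le> norm (\<bar>x\<bar> ^ n * exp (s / 2 * \<bar>x\<bar>))"
      by (auto simp: norm_mult norm_power abs_mult)
  qed simp
  define f where "f = (\<lambda>n x. \<Sum>j<n. (\<i> * complex_of_real h) ^ j / fact j * (of_real x ^ (k + j) * iexp (t * x)))"
  have f_eq: "f n x = of_real x ^ k * iexp (t * x) * (\<Sum>j<n. (\<i> * complex_of_real (h * x)) ^ j /\<^sub>R fact j)" for n x
    unfolding f_def sum_distrib_left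
    by (intro sum.cong) (auto simp: power_add power_mult_distrib scaleR_conv_of_real divide_inverse)
  have "(\<lambda>n. \<integral>x. f n x \<partial>M) \<longlonglongrightarrow> (\<integral>x. of_real x ^ k * iexp ((t + h) * x) \<partial>M)"
  proof (rule integral_dominated_convergence)
    show "integrable M (\<lambda>x. \<bar>x\<bar> ^ k * exp (s / 2 * \<bar>x\<bar>))"
      by (rule exp_moment_weighted_integrable[OF sets s i])
    show "AE x in M. (\<lambda>n. f n x) \<longlonglongrightarrow> of_real x ^ k * iexp ((t + h) * x)"
    proof (rule AE_I2)
      fix x
      have "(\<lambda>j. (\<i> * complex_of_real (h * x)) ^ j /\<^sub>R fact j) sums iexp (h * x)"
        using exp_converges[of "\<i> * complex_of_real (h * x)"] by simp
      then have "(\<lambda>n. of_real x ^ k * iexp (t * x) * (\<Sum>j<n. (\<i> * complex_of_real (h * x)) ^ j /\<^sub>R fact j))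
        \<longlonglongrightarrow> of_real x ^ k * iexp (t * x) * iexp (h * x)"
        unfolding sums_def by (intro tendsto_mult_left)
      also have "of_real x ^ k * iexp (t * x) * iexp (h * x) = of_real x ^ k * iexp ((t + h) * x)"
        by (simp add: exp_add[symmetric] algebra_simps)
      finally show "(\<lambda>n. f n x) \<longlonglongrightarrow> of_real x ^ k * iexp ((t + h) * x)"
        unfolding f_eq .
    qed
    show "AE x in M. norm (f n x) \<le> \<bar>x\<bar> ^ k * exp (s / 2 * \<bar>x\<bar>)" for n
    proof (rule AE_I2)
      fix x
      have "norm (\<Sum>j<n. (\<i> * complex_of_real (h * x)) ^ j /\<^sub>R fact j) \<le> (\<Sum>j<n. \<bar>h * x\<bar> ^ j /\<^sub>R fact j)"
        by (rule order_trans[OF norm_sum]) (simp add: norm_mult norm_power abs_mult)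
      also have "\<dots> \<le> exp \<bar>h * x\<bar>"
        unfolding exp_def by (intro sum_le_suminf summable_exp_generic) auto
      also have "\<dots> \<le> exp (s / 2 * \<bar>x\<bar>)"
        unfolding abs_mult exp_le_cancel_iff by (intro mult_right_mono h) simp
      finally show "norm (f n x) \<le> \<bar>x\<bar> ^ k * exp (s / 2 * \<bar>x\<bar>)"
        unfolding f_eq by (simp add: norm_mult norm_power mult_left_mono)
    qed
  qed (simp_all add: f_def)
  moreover have "(\<integral>x. f n x \<partial>M)
      = (\<Sum>j<n. (\<i> * complex_of_real h) ^ j / fact j * (\<integral>x. of_real x ^ (k + j) * iexp (t * x) \<partial>M))" for n
    unfolding f_def using moment by (subst Bochner_Integration.integral_sum) auto
  ultimately show ?thesis by simp
qed

text \<open>Continuation along the real axis: the moments give all derivatives of the characteristic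
  function at 0, and the uniform radius s / 2 carries equality of all derivatives from each interval
  to a longer one.\<close>

lemma exp_moments_determine:
  assumes M: "real_distribution M" and N: "real_distribution N" and s: "s > 0"
    and iM: "integrable M (\<lambda>x. exp (s * \<bar>x\<bar>))" and iN: "integrable N (\<lambda>x. exp (s * \<bar>x\<bar>))"
    and eq: "\<And>k. (\<integral>x. x ^ k \<partial>M) = (\<integral>x. x ^ k \<partial>N)"
  shows "M = N"
proof (rule Levy_uniqueness[OF M N])
  interpret M: real_distribution M by (rule M)
  interpret N: real_distribution N by (rule N)
  define \<phi> where "\<phi> = (\<lambda>L k t. \<integral>x. complex_of_real x ^ k * iexp (t * x) \<partial>(L :: real measure))"
  have zero: "\<phi> L k 0 = complex_of_real (\<integral>x. x ^ k \<partial>L)" for L k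
    unfolding \<phi>_def by (simp flip: of_real_power)
  have "\<forall>k t. \<bar>t\<bar> \<le> real n * (s / 2) \<longrightarrow> \<phi> M k t = \<phi> N k t" for n
  proof (induction n)
    case 0
    then show ?case by (auto simp: zero eq)
  next
    case (Suc n)
    show ?case
    proof (intro allI impI)
      fix k t assume t: "\<bar>t\<bar> \<le> real (Suc n) * (s / 2)"
      \<comment> \<open>The step has length at most s / 2, and the remaining point t - h = n h lies
        in the interval of the induction hypothesis.\<close>
      define h where "h = t / real (Suc n)"
      have t': "t = (t - h) + h" by simp
      have h: "\<bar>h\<bar> \<le> s / 2"
        using t by (simp add: h_def abs_divide field_simps)
      have "t - h = real n * h"
        by (simp add: h_def field_simps)
      then have "\<bar>t - h\<bar> = real n * \<bar>h\<bar>"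
        by (simp add: abs_mult)
      also have "\<dots> \<le> real n * (s / 2)"
        by (intro mult_left_mono h) simp
      finally have IH: "\<phi> M j (t - h) = \<phi> N j (t - h)" for j
        using Suc by blast
      have "(\<lambda>n. \<Sum>j<n. (\<i> * complex_of_real h) ^ j / fact j * \<phi> M (k + j) (t - h)) \<longlonglongrightarrow> \<phi> M k t"
        using iexp_moment_expansion[OF M.events_eq_borel s iM h, of k "t - h"] unfolding \<phi>_def by simp
      moreover have "(\<lambda>n. \<Sum>j<n. (\<i> * complex_of_real h) ^ j / fact j * \<phi> N (k + j) (t - h)) \<longlonglongrightarrow> \<phi> N k t"
        using iexp_moment_expansion[OF N.events_eq_borel s iN h, of k "t - h"] unfolding \<phi>_def by simp
      ultimately show "\<phi> M k t = \<phi> N k t"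
        unfolding IH by (rule LIMSEQ_unique)
    qed
  qed
  then have "\<phi> M 0 t = \<phi> N 0 t" for t
    using ex_less_of_nat_mult[of "s / 2" "\<bar>t\<bar>"] s by (auto intro: less_imp_le)
  then show "char M = char N"
    unfolding char_def \<phi>_def by auto
qed

text \<open>The factorial in the moment bound cancels that of the exponential series, leaving a
  geometric series of ratio s^2 C.\<close>

lemma exp_integrable_of_even_moments:
  fixes M :: "real measure"
  assumes [measurable_cong]: "sets M = sets borel"
    and int: "\<And>k. integrable M (\<lambda>x. x ^ k)"
    and bd: "\<And>k. (\<integral>x. x ^ (2 * k) \<partial>M) \<le> C ^ k * fact (2 * k)"
    and s: "s > 0" "s\<^sup>2 * C < 1" and C: "C \<ge> 0"
  shows "integrable M (\<lambda>x. exp (s * \<bar>x\<bar>))"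
proof -
  \<comment> \<open>Partial sums of exp(sx) + exp(-sx): this function has only even powers, with
    nonnegative terms, and dominates exp(s|x|).\<close>
  define f where "f = (\<lambda>n x. \<Sum>j<n. 2 * (s * x) ^ (2 * j) / fact (2 * j))"
  have f_int: "integrable M (f n)" for n
    unfolding f_def using int
    by (auto simp: power_mult_distrib intro!: Bochner_Integration.integrable_sum)
  have f_mono: "f i x \<le> f j x" if "i \<le> j" for i j x
    unfolding f_def using that by (intro sum_mono2) auto
  have cosh_sums: "(\<lambda>j. 2 * (s * x) ^ (2 * j) / fact (2 * j)) sums (exp (s * x) + exp (- (s * x)))" for x
  proof -
    have "(\<lambda>n. (s * x) ^ n /\<^sub>R fact n + (- (s * x)) ^ n /\<^sub>R fact n) sums (exp (s * x) + exp (- (s * x)))"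
      by (intro sums_add exp_converges)
    then have "(\<lambda>j. (s * x) ^ (2 * j) /\<^sub>R fact (2 * j) + (- (s * x)) ^ (2 * j) /\<^sub>R fact (2 * j)) sums (exp (s * x) + exp (- (s * x)))"
      by (subst sums_mono_reindex[of "\<lambda>j. 2 * j"])
        (auto simp: strict_mono_def power_mult_distrib uminus_power_if elim!: oddE evenE intro: rangeI)
    then show ?thesis
      by (simp add: divide_inverse mult_ac)
  qed
  have geo: "(\<Sum>j<n. 2 * (s\<^sup>2 * C) ^ j) \<le> 2 / (1 - s\<^sup>2 * C)" for n
  proof -
    have "(\<Sum>j<n. (s\<^sup>2 * C) ^ j) \<le> (\<Sum>j. (s\<^sup>2 * C) ^ j)"
      using s C by (intro sum_le_suminf summable_geometric) auto
    also have "\<dots> = 1 / (1 - s\<^sup>2 * C)"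
      using s C by (intro suminf_geometric) auto
    finally show ?thesis
      by (simp add: sum_distrib_left[symmetric])
  qed
  have le: "(\<integral>x. f n x \<partial>M) \<le> 2 / (1 - s\<^sup>2 * C)" for n
  proof -
    have "(\<integral>x. f n x \<partial>M) = (\<Sum>j<n. 2 * s ^ (2 * j) / fact (2 * j) * (\<integral>x. x ^ (2 * j) \<partial>M))"
      unfolding f_def using int by (subst Bochner_Integration.integral_sum) (auto simp: power_mult_distrib mult.assoc)
    also have "\<dots> \<le> (\<Sum>j<n. 2 * s ^ (2 * j) / fact (2 * j) * (C ^ j * fact (2 * j)))"
      using bd s by (intro sum_mono mult_left_mono) auto
    also have "\<dots> = (\<Sum>j<n. 2 * (s\<^sup>2 * C) ^ j)"
      by (intro sum.cong) (auto simp: power_mult power_mult_distrib)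
    also note geo
    finally show ?thesis .
  qed
  have "incseq (\<lambda>n. \<integral>x. f n x \<partial>M)"
    by (intro monoI integral_mono f_int f_mono)
  then obtain L where L: "(\<lambda>n. \<integral>x. f n x \<partial>M) \<longlonglongrightarrow> L"
    using incseq_convergent[of "\<lambda>n. \<integral>x. f n x \<partial>M" "2 / (1 - s\<^sup>2 * C)"] le by blast
  have "integrable M (\<lambda>x. exp (s * x) + exp (- (s * x)))"
  proof (rule integrable_monotone_convergence[OF f_int _ _ L])
    show "AE x in M. mono (\<lambda>i. f i x)"
      by (auto intro!: monoI f_mono)
    show "AE x in M. (\<lambda>i. f i x) \<longlonglongrightarrow> exp (s * x) + exp (- (s * x))"
      using cosh_sums unfolding f_def sums_def by auto
  qed simp
  then show ?thesis
  proof (rule Bochner_Integration.integrable_bound)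
    have "exp (s * \<bar>x\<bar>) \<le> exp (s * x) + exp (- (s * x))" for x
      by (simp add: abs_if)
    then show "AE x in M. norm (exp (s * \<bar>x\<bar>)) \<le> norm (exp (s * x) + exp (- (s * x)))"
      by (auto intro: order_trans[OF _ abs_ge_self])
  qed simp
qed

text \<open>Convergent moments give tightness, and every subsequential limit has the moments of N.
  The growth bound gives both laws an exponential moment, so they coincide.\<close>

lemma method_of_moments:
  assumes \<mu>: "\<And>n. real_distribution (\<mu> n)" and N: "real_distribution N"
    and int: "\<And>n k. integrable (\<mu> n) (\<lambda>x. x ^ k)" and int_N: "\<And>k. integrable N (\<lambda>x. x ^ k)"
    and lim: "\<And>k. (\<lambda>n. \<integral>x. x ^ k \<partial>\<mu> n) \<longlonglongrightarrow> (\<integral>x. x ^ k \<partial>N)"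
    and bd: "\<And>k. (\<integral>x. x ^ (2 * k) \<partial>N) \<le> C ^ k * fact (2 * k)" and C: "C \<ge> 0"
  shows "weak_conv_m \<mu> N"
proof (rule tight_subseq_weak_converge[OF \<mu> N tight_of_convergent_moments[OF \<mu> int lim]])
  interpret N: real_distribution N by (rule N)
  fix r \<nu> assume r: "strict_mono (r :: nat \<Rightarrow> nat)" and \<nu>: "real_distribution \<nu>" and w: "weak_conv_m (\<mu> \<circ> r) \<nu>"
  interpret \<nu>: real_distribution \<nu> by (rule \<nu>)
  have m: "integrable \<nu> (\<lambda>x. x ^ k)" "(\<integral>x. x ^ k \<partial>\<nu>) = (\<integral>x. x ^ k \<partial>N)" for k
    using weak_conv_moments[OF _ \<nu> w, of "\<lambda>k. \<integral>x. x ^ k \<partial>N" k] \<mu> int LIMSEQ_subseq_LIMSEQ[OF lim r]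
    by (auto simp: comp_def)
  \<comment> \<open>With this s <= 1, so s^2 C <= s C < 1.\<close>
  define s where "s = 1 / (C + 1)"
  have "s > 0" "s \<le> 1" using C by (auto simp: s_def)
  have "s\<^sup>2 * C \<le> s * C"
    using \<open>s > 0\<close> \<open>s \<le> 1\<close> C by (intro mult_right_mono) (auto simp: power2_eq_square mult_le_one mult_left_le)
  also have "s * C < 1"
    using C by (simp add: s_def)
  finally have s: "s > 0" "s\<^sup>2 * C < 1"
    using \<open>s > 0\<close> by auto
  have "\<nu> = N"
    by (intro exp_moments_determine[OF \<nu> N s(1)] m exp_integrable_of_even_moments[OF _ _ _ s C] int_N bd)
      (auto simp: m int_N bd)
  with w show "weak_conv_m (\<mu> \<circ> r) N" by simp
qed

lemma converges_dist_momentsI: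
  assumes M: "prob_space M" and \<Omega>: "prob_space \<Omega>"
    and X [measurable]: "\<And>n. X n \<in> borel_measurable M" and L [measurable]: "L \<in> borel_measurable \<Omega>"
    and int: "\<And>n N. integrable M (\<lambda>x. X n x ^ N)" and int_L: "\<And>N. integrable \<Omega> (\<lambda>w. L w ^ N)"
    and lim: "\<And>N. (\<lambda>n. \<integral>x. X n x ^ N \<partial>M) \<longlonglongrightarrow> (\<integral>w. L w ^ N \<partial>\<Omega>)"
    and bd: "\<And>k. (\<integral>w. L w ^ (2 * k) \<partial>\<Omega>) \<le> C ^ k * fact (2 * k)" and C: "C \<ge> 0"
  shows "converges_dist_moments M X \<Omega> L"
proof -
  interpret M: prob_space M by (rule M)
  interpret \<Omega>: prob_space \<Omega> by (rule \<Omega>)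
  have "weak_conv_m (\<lambda>n. distr M borel (X n)) (distr \<Omega> borel L)"
    by (rule method_of_moments[where C = C])
      (use int int_L lim bd C in \<open>auto simp: integrable_distr_eq integral_distr intro: M.real_distribution_distr \<Omega>.real_distribution_distr\<close>)
  with assms show ?thesis
    unfolding converges_dist_moments_def by auto
qed

section \<open>Negligibility of single terms, shifts and lower powers of A\<close>

context regular_sums
begin

lemma p_over_A: "(\<lambda>n. p n / A n) \<longlonglongrightarrow> 0"
proof -
  have "(\<lambda>n. A (1 * n + 1) / A n) \<longlonglongrightarrow> real 1 powr \<gamma>"
    by (rule A_affine) simp
  then have "(\<lambda>n. inverse (A (Suc n) / A n)) \<longlonglongrightarrow> inverse 1"
    by (intro tendsto_inverse) auto
  then have "(\<lambda>n. 1 - A n / A (Suc n)) \<longlonglongrightarrow> 1 - 1"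
    by (intro tendsto_intros) simp
  moreover have "1 - A n / A (Suc n) = p (Suc n) / A (Suc n)" for n
  proof -
    have "p (Suc n) = A (Suc n) - A n"
      by (simp add: A_eq)
    then show ?thesis
      by (simp add: diff_divide_distrib)
  qed
  ultimately have "(\<lambda>n. p (Suc n) / A (Suc n)) \<longlonglongrightarrow> 0"
    by simp
  then show ?thesis
    by (rule LIMSEQ_imp_Suc)
qed

lemma A_shift_back: "(\<lambda>n. A (n - l) / A n) \<longlonglongrightarrow> 1"
proof -
  have "(\<lambda>n. A (1 * n + l) / A n) \<longlonglongrightarrow> real 1 powr \<gamma>"
    by (rule A_affine) simp
  then have "(\<lambda>n. inverse (A (n + l) / A n)) \<longlonglongrightarrow> inverse 1"
    by (intro tendsto_inverse) auto
  then have "(\<lambda>n. A (n + l - l) / A (n + l)) \<longlonglongrightarrow> 1"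
    by simp
  then show ?thesis
    by (rule LIMSEQ_offset[of _ l])
qed

lemma weighted_null:
  assumes "\<delta> \<longlonglongrightarrow> 0"
  shows "(\<lambda>n. (\<Sum>k\<le>n. p k * \<delta> k) / A n) \<longlonglongrightarrow> 0"
  by (rule weighted_cesaro[OF A_eq less_imp_le[OF p_pos] A_lim assms])

text \<open>A is bounded below by \<open>A 0 > 0\<close>, so bounds of lower order can be raised to
  a common exponent at the price of a constant.\<close>

lemma A_power_le: "i \<le> j \<Longrightarrow> A n powr i \<le> A 0 powr (i - j) * A n powr j"
proof -
  assume ij: "i \<le> j"
  have "A n powr (i - j) \<le> A 0 powr (i - j)"
    using ij A_mono[of 0 n] A_pos by (intro powr_mono2') auto
  then have "A n powr (i - j) * A n powr j \<le> A 0 powr (i - j) * A n powr j"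
    by (intro mult_right_mono) auto
  then show ?thesis
    by (simp add: powr_add[symmetric])
qed

lemma A_powr_mono: "s \<ge> 0 \<Longrightarrow> m \<le> n \<Longrightarrow> A m powr s \<le> A n powr s"
  using A_pos A_mono by (intro powr_mono2) (auto intro: less_imp_le)

lemma A_powr_null: "s < t \<Longrightarrow> (\<lambda>n. C * A n powr s / A n powr t) \<longlonglongrightarrow> 0"
proof -
  assume "s < t"
  then have "(\<lambda>n. C / A n powr (t - s)) \<longlonglongrightarrow> 0"
    by (intro real_tendsto_divide_at_top[OF tendsto_const A_powr_lim]) simp
  then show ?thesis
    by (simp add: powr_diff field_simps)
qed

end

section \<open>Operator renewal sequences\<close>

text \<open>\<open>E\<close> and \<open>sn\<close> stand for the real part of the integral and for the \<open>L\<^sup>1\<close> seminorm of the real part;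
  \<open>T0_bound\<close> and \<open>T0_asymp\<close> are Hypothesis A.\<close>

locale walk_operators = regular_sums +
  fixes T :: "nat \<Rightarrow> 'i::ab_group_add \<Rightarrow> 'b::banach \<Rightarrow> 'b" and e :: 'b
    and E :: "'b \<Rightarrow> real" and sn :: "'b \<Rightarrow> real" and \<Phi> C0 Cn :: real and \<delta> :: "nat \<Rightarrow> real"
  assumes T_lin: "\<And>k a. bounded_linear (T k a)"
    and E_lin: "bounded_linear E"
    and sn_triangle: "\<And>u v. sn (u + v) \<le> sn u + sn v"
    and sn_scale: "\<And>c u. sn (c *\<^sub>R u) = \<bar>c\<bar> * sn u"
    and sn_le: "\<And>u. sn u \<le> Cn * norm u"
    and E_le: "\<And>u. \<bar>E u\<bar> \<le> sn u"
    and E_T_le: "\<And>k a u. \<bar>E (T k a u)\<bar> \<le> sn u"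
    and E_e: "E e = 1"
    and T0_bound: "\<And>k u. norm (T k 0 u) \<le> C0 * p k * norm u"
    and T0_asymp: "\<And>k u. sn (T k 0 u - (\<Phi> * p k * E u) *\<^sub>R e) \<le> \<delta> k * p k * norm u"
    and \<delta>_null: "\<delta> \<longlonglongrightarrow> 0"
    and C_nonneg: "C0 \<ge> 0" "Cn \<ge> 0"
begin

lemma sn_nonneg: "sn u \<ge> 0"
  using E_le[of u] by linarith

lemma sn_zero [simp]: "sn 0 = 0"
  using sn_scale[of 0 0] by simp

lemma sn_sum: "sn (sum f I) \<le> (\<Sum>i\<in>I. sn (f i))"
proof (induction I rule: infinite_finite_induct)
  case (insert i I)
  then show ?case
    using sn_triangle[of "f i" "sum f I"] by simp
qed auto

lemma sn_diff_triangle: "sn (u - w) \<le> sn (u - v) + sn (v - w)"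
  using sn_triangle[of "u - v" "v - w"] by simp

text \<open>Convergence to the constant function c in the real part of L1, the only sense in which
  Hypothesis A provides an asymptotic expansion.\<close>

definition tends :: "(nat \<Rightarrow> 'b) \<Rightarrow> real \<Rightarrow> bool" where
  "tends X c \<longleftrightarrow> (\<lambda>n. sn (X n - c *\<^sub>R e)) \<longlonglongrightarrow> 0"

lemma tends_E: "tends X c \<Longrightarrow> (\<lambda>n. E (X n)) \<longlonglongrightarrow> c"
proof -
  assume X: "tends X c"
  have "\<bar>E (X n) - c\<bar> \<le> sn (X n - c *\<^sub>R e)" for n
  proof -
    have "E (X n) - c = E (X n - c *\<^sub>R e)"
      by (simp add: linear_diff[OF bounded_linear.linear[OF E_lin]]
          linear_scale[OF bounded_linear.linear[OF E_lin]] E_e)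
    then show ?thesis
      using E_le by simp
  qed
  then have "(\<lambda>n. E (X n) - c) \<longlonglongrightarrow> 0"
    by (intro Lim_null_comparison[OF _ X[unfolded tends_def]]) auto
  then show ?thesis
    by (simp add: LIM_zero_iff)
qed

lemma tends_perturb:
  assumes X: "tends X c" and Y: "(\<lambda>n. sn (Y n - X n)) \<longlonglongrightarrow> 0"
  shows "tends Y c"
  unfolding tends_def
proof (rule Lim_null_comparison)
  show "\<forall>\<^sub>F n in sequentially. norm (sn (Y n - c *\<^sub>R e)) \<le> sn (Y n - X n) + sn (X n - c *\<^sub>R e)"
    using sn_diff_triangle sn_nonneg by simp
  show "(\<lambda>n. sn (Y n - X n) + sn (X n - c *\<^sub>R e)) \<longlonglongrightarrow> 0"
    using tendsto_add[OF Y X[unfolded tends_def]] by simp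
qed

lemma tends_const_scale:
  assumes "c \<longlonglongrightarrow> d"
  shows "tends (\<lambda>n. c n *\<^sub>R e) d"
proof -
  have "(\<lambda>n. \<bar>c n - d\<bar> * sn e) \<longlonglongrightarrow> \<bar>d - d\<bar> * sn e"
    by (intro tendsto_intros assms)
  then show ?thesis
    unfolding tends_def scaleR_diff_left[symmetric] sn_scale by simp
qed

text \<open>The norm bound on V controls the error of replacing \<open>T l 0\<close> by its rank one
  approximation, since the weights \<delta>(l) p(l) average to zero against A. What remains is a
  scalar convolution of p with \<open>E (V n)\<close>, so the limit of V is required only through
  E.\<close>

lemma renewal_limit:
  assumes s: "s > 0" and V: "\<And>n. norm (V n) \<le> K * A n powr s"
    and EV: "(\<lambda>n. E (V n) / A n powr s) \<longlonglongrightarrow> \<mu>"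
  shows "tends (\<lambda>n. (1 / A n powr (s + 1)) *\<^sub>R (\<Sum>l=1..n. T l 0 (V (n - l)))) (\<Phi> * kappa \<gamma> s * \<mu>)"
proof -
  have K: "K \<ge> 0"
    using V[of 0] norm_ge_zero[of "V 0"] A_pos[of 0]
    by (metis less_le_not_le linorder_linear mult_nonpos_nonneg order_trans powr_gt_zero zero_le_mult_iff A_nz)
  define f where "f = (\<lambda>n. (\<Sum>l=1..n. p l * E (V (n - l))) / A n powr (s + 1))"
  \<comment> \<open>The renewal sum starts at l = 1 and the convolution at l = 0; the missing term
    p(0) E(V n) has order A^s and disappears after division by A^(s + 1).\<close>
  have "f \<longlonglongrightarrow> \<mu> * kappa \<gamma> s - p 0 * 0 * \<mu>"
  proof -
    have "(\<lambda>n. (\<Sum>l\<le>n. p l * E (V (n - l))) / A n powr (s + 1)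
        - p 0 * (1 / A n) * (E (V n) / A n powr s)) \<longlonglongrightarrow> \<mu> * kappa \<gamma> s - p 0 * 0 * \<mu>"
      by (intro tendsto_diff tendsto_mult convolution_limit[OF s EV] EV tendsto_const
          real_tendsto_divide_at_top[OF tendsto_const A_lim])
    moreover have "(\<Sum>l\<le>n. p l * E (V (n - l))) = p 0 * E (V n) + (\<Sum>l=1..n. p l * E (V (n - l)))" for n
      using sum.atMost_shift[of "\<lambda>l. p l * E (V (n - l))" n]
      by (simp add: sum.atLeast1_atMost_eq lessThan_Suc_atMost)
    ultimately show ?thesis
      unfolding f_def using A_pos
      by (simp add: powr_add add_divide_distrib less_imp_le mult.commute[of "A _" "A _ powr s"])
  qed
  then have lim: "tends (\<lambda>n. (\<Phi> * f n) *\<^sub>R e) (\<Phi> * kappa \<gamma> s * \<mu>)"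
    using tendsto_mult_left[of f "\<mu> * kappa \<gamma> s" sequentially \<Phi>]
    by (intro tends_const_scale) (simp add: mult_ac)
  show ?thesis
  proof (rule tends_perturb[OF lim], rule Lim_null_comparison)
    show "(\<lambda>n. K * ((\<Sum>k\<le>n. p k * \<bar>\<delta> k\<bar>) / A n)) \<longlonglongrightarrow> 0"
      using weighted_null[OF tendsto_rabs_zero[OF \<delta>_null]] by (intro tendsto_mult_right_zero)
    show "\<forall>\<^sub>F n in sequentially. norm (sn ((1 / A n powr (s + 1)) *\<^sub>R (\<Sum>l=1..n. T l 0 (V (n - l))) - (\<Phi> * f n) *\<^sub>R e))
        \<le> K * ((\<Sum>k\<le>n. p k * \<bar>\<delta> k\<bar>) / A n)"
    proof (intro always_eventually allI)
      fix n
      define D where "D = (\<Sum>l=1..n. T l 0 (V (n - l)) - (\<Phi> * p l * E (V (n - l))) *\<^sub>R e)"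
      have "(1 / A n powr (s + 1)) *\<^sub>R (\<Sum>l=1..n. T l 0 (V (n - l))) - (\<Phi> * f n) *\<^sub>R e = (1 / A n powr (s + 1)) *\<^sub>R D"
        unfolding D_def f_def sum_subtractf scaleR_diff_right
        by (simp add: scaleR_sum_left[symmetric] sum_distrib_left sum_divide_distrib mult.assoc)
      then have "sn ((1 / A n powr (s + 1)) *\<^sub>R (\<Sum>l=1..n. T l 0 (V (n - l))) - (\<Phi> * f n) *\<^sub>R e) = sn D / A n powr (s + 1)"
        by (simp add: sn_scale)
      also have "sn D \<le> (\<Sum>l=1..n. sn (T l 0 (V (n - l)) - (\<Phi> * p l * E (V (n - l))) *\<^sub>R e))"
        unfolding D_def by (rule sn_sum)
      also have "\<dots> \<le> (\<Sum>l=1..n. \<bar>\<delta> l\<bar> * p l * (K * A n powr s))"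
      proof (intro sum_mono)
        fix l assume "l \<in> {1..n}"
        have "norm (V (n - l)) \<le> K * A n powr s"
          using V[of "n - l"] A_powr_mono[of s "n - l" n] s K
          by (meson diff_le_self less_imp_le mult_left_mono order_trans)
        then have "\<delta> l * p l * norm (V (n - l)) \<le> \<bar>\<delta> l\<bar> * p l * (K * A n powr s)"
          using p_pos[of l] by (intro mult_mono mult_right_mono) auto
        then show "sn (T l 0 (V (n - l)) - (\<Phi> * p l * E (V (n - l))) *\<^sub>R e) \<le> \<bar>\<delta> l\<bar> * p l * (K * A n powr s)"
          using T0_asymp order_trans by blast
      qed
      also have "\<dots> \<le> (\<Sum>l\<le>n. \<bar>\<delta> l\<bar> * p l * (K * A n powr s))"
        using p_pos K by (intro sum_mono2) (auto intro!: mult_nonneg_nonneg less_imp_le[OF p_pos])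
      also have "\<dots> = K * (\<Sum>k\<le>n. p k * \<bar>\<delta> k\<bar>) * A n powr s"
        by (simp add: sum_distrib_left sum_distrib_right mult_ac)
      finally have "sn ((1 / A n powr (s + 1)) *\<^sub>R (\<Sum>l=1..n. T l 0 (V (n - l))) - (\<Phi> * f n) *\<^sub>R e)
          \<le> K * (\<Sum>k\<le>n. p k * \<bar>\<delta> k\<bar>) * A n powr s / A n powr (s + 1)"
        by (simp add: divide_right_mono)
      also have "\<dots> = K * ((\<Sum>k\<le>n. p k * \<bar>\<delta> k\<bar>) / A n)"
        using A_pos[of n] by (simp add: powr_add)
      finally show "norm (sn ((1 / A n powr (s + 1)) *\<^sub>R (\<Sum>l=1..n. T l 0 (V (n - l))) - (\<Phi> * f n) *\<^sub>R e))
        \<le> K * ((\<Sum>k\<le>n. p k * \<bar>\<delta> k\<bar>) / A n)"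
        using sn_nonneg by simp
    qed
  qed
qed

lemma renewal_bound:
  assumes s: "s \<ge> 0" and V: "\<And>n. norm (V n) \<le> K * A n powr s" and K: "K \<ge> 0"
  shows "norm (\<Sum>l=1..n. T l 0 (V (n - l))) \<le> C0 * K * A n powr (s + 1)"
proof -
  have "norm (\<Sum>l=1..n. T l 0 (V (n - l))) \<le> (\<Sum>l=1..n. C0 * p l * (K * A n powr s))"
  proof (rule order_trans[OF norm_sum sum_mono])
    fix l assume "l \<in> {1..n}"
    have "norm (V (n - l)) \<le> K * A n powr s"
      using V[of "n - l"] A_powr_mono[of s "n - l" n] s K
      by (meson diff_le_self mult_left_mono order_trans)
    then show "norm (T l 0 (V (n - l))) \<le> C0 * p l * (K * A n powr s)"
      using T0_bound[of l "V (n - l)"] C_nonneg p_pos[of l]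
      by (meson less_imp_le mult_left_mono mult_nonneg_nonneg order_trans)
  qed
  also have "\<dots> \<le> (\<Sum>l\<le>n. C0 * p l * (K * A n powr s))"
    using p_pos K C_nonneg by (intro sum_mono2) (auto intro!: mult_nonneg_nonneg less_imp_le[OF p_pos])
  also have "\<dots> = C0 * K * A n powr (s + 1)"
    using A_pos[of n] by (simp add: powr_add A_eq sum_distrib_left sum_distrib_right mult_ac)
  finally show ?thesis .
qed

lemma green_bound: "norm (\<Sum>k<n. T k 0 e) \<le> C0 * norm e * A n"
proof -
  have "norm (\<Sum>k<n. T k 0 e) \<le> (\<Sum>k<n. C0 * p k * norm e)"
    by (rule order_trans[OF norm_sum sum_mono]) (rule T0_bound)
  also have "\<dots> \<le> (\<Sum>k\<le>n. C0 * p k * norm e)"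
    using p_pos C_nonneg by (intro sum_mono2) (auto intro!: mult_nonneg_nonneg less_imp_le[OF p_pos])
  also have "\<dots> = C0 * norm e * A n"
    by (simp add: A_eq sum_distrib_left sum_distrib_right mult_ac)
  finally show ?thesis .
qed

text \<open>Base of both inductions, corresponding to s = 0. The sum stops at n - 1 whereas
  \<open>A n\<close> includes \<open>p n\<close>, whence the factor 1 - p(n) / A(n).\<close>

lemma green_limit: "tends (\<lambda>n. (1 / A n) *\<^sub>R (\<Sum>k<n. T k 0 e)) \<Phi>"
proof -
  have "(\<lambda>n. \<Phi> * (1 - p n / A n)) \<longlonglongrightarrow> \<Phi> * (1 - 0)"
    by (intro tendsto_intros p_over_A)
  then have lim: "tends (\<lambda>n. (\<Phi> * (1 - p n / A n)) *\<^sub>R e) \<Phi>"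
    by (intro tends_const_scale) simp
  show ?thesis
  proof (rule tends_perturb[OF lim], rule Lim_null_comparison)
    show "(\<lambda>n. norm e * ((\<Sum>k\<le>n. p k * \<bar>\<delta> k\<bar>) / A n)) \<longlonglongrightarrow> 0"
      using weighted_null[OF tendsto_rabs_zero[OF \<delta>_null]] by (intro tendsto_mult_right_zero)
    show "\<forall>\<^sub>F n in sequentially. norm (sn ((1 / A n) *\<^sub>R (\<Sum>k<n. T k 0 e) - (\<Phi> * (1 - p n / A n)) *\<^sub>R e))
        \<le> norm e * ((\<Sum>k\<le>n. p k * \<bar>\<delta> k\<bar>) / A n)"
    proof (intro always_eventually allI)
      fix n
      define D where "D = (\<Sum>k<n. T k 0 e - (\<Phi> * p k * E e) *\<^sub>R e)"
      have "1 - p n / A n = (\<Sum>k<n. p k) / A n"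
      proof -
        have "A n = (\<Sum>k<n. p k) + p n"
          unfolding A_eq by (simp add: lessThan_Suc_atMost[symmetric])
        then have "(\<Sum>k<n. p k) = A n - p n" by simp
        then show ?thesis by (simp add: diff_divide_distrib)
      qed
      then have "(1 / A n) *\<^sub>R (\<Sum>k<n. T k 0 e) - (\<Phi> * (1 - p n / A n)) *\<^sub>R e = (1 / A n) *\<^sub>R D"
        unfolding D_def sum_subtractf scaleR_diff_right
        by (simp add: scaleR_sum_left[symmetric] sum_distrib_left sum_divide_distrib E_e)
      then have "sn ((1 / A n) *\<^sub>R (\<Sum>k<n. T k 0 e) - (\<Phi> * (1 - p n / A n)) *\<^sub>R e) = sn D / A n"
        using A_pos[of n] by (simp add: sn_scale)
      also have "sn D \<le> (\<Sum>k<n. \<bar>\<delta> k\<bar> * p k * norm e)"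
        unfolding D_def
      proof (rule order_trans[OF sn_sum sum_mono])
        fix k
        have "\<delta> k * p k * norm e \<le> \<bar>\<delta> k\<bar> * p k * norm e"
          using p_pos[of k] by (intro mult_right_mono) auto
        then show "sn (T k 0 e - (\<Phi> * p k * E e) *\<^sub>R e) \<le> \<bar>\<delta> k\<bar> * p k * norm e"
          using T0_asymp order_trans by blast
      qed
      also have "\<dots> \<le> (\<Sum>k\<le>n. \<bar>\<delta> k\<bar> * p k * norm e)"
        by (intro sum_mono2) (auto intro!: mult_nonneg_nonneg less_imp_le[OF p_pos])
      also have "\<dots> = norm e * (\<Sum>k\<le>n. p k * \<bar>\<delta> k\<bar>)"
        by (simp add: sum_distrib_left mult_ac)
      finally show "norm (sn ((1 / A n) *\<^sub>R (\<Sum>k<n. T k 0 e) - (\<Phi> * (1 - p n / A n)) *\<^sub>R e))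
        \<le> norm e * ((\<Sum>k\<le>n. p k * \<bar>\<delta> k\<bar>) / A n)"
        using sn_nonneg A_pos[of n] by (simp add: divide_right_mono)
    qed
  qed
qed

text \<open>Since \<open>w (N - j)\<close> has order A^(N - j + 1), only j = 1 contributes to V at
  order A^N. Its coefficient N cancels the denominator in the limit of \<open>w (N - 1)\<close>, and
  the renewal step then multiplies by \<Phi> \<open>kappa \<gamma> N\<close>.\<close>

lemma indicator_moments:
  fixes w V :: "nat \<Rightarrow> nat \<Rightarrow> 'b"
  assumes w0: "\<And>n. w 0 n = (\<Sum>k<n. T k 0 e)"
    and wS: "\<And>N n. N > 0 \<Longrightarrow> w N n = (\<Sum>l=1..n. T l 0 (V N (n - l)))"
    and V: "\<And>N n. V N n = (\<Sum>j=1..N. real (N choose j) *\<^sub>R w (N - j) n)"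
    and N: "N > 0"
  shows "(\<lambda>n. E (V N n) / A n powr real N)
    \<longlonglongrightarrow> \<Phi> ^ N * fact N * Gamma (1 + \<gamma>) ^ N / Gamma (1 + real N * \<gamma>)"
proof -
  define \<mu> where "\<mu> = (\<lambda>N. \<Phi> ^ N * fact N * Gamma (1 + \<gamma>) ^ N / Gamma (1 + real N * \<gamma>))"
  have Gamma_pos: "Gamma (1 + real N * \<gamma>) > 0" for N
    using \<gamma>_range by (intro Gamma_real_pos add_pos_nonneg) auto
  note E_linear = bounded_linear.linear[OF E_lin]
  have \<mu>1: "\<mu> 1 = \<Phi>"
    using Gamma_pos[of 1] by (simp add: \<mu>_def)
  have \<mu>_Suc: "\<Phi> * kappa \<gamma> (real N) * \<mu> N = \<mu> (Suc N) / real (Suc N)" for N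
    using Gamma_pos[of N] Gamma_pos[of "Suc N"] unfolding \<mu>_def kappa_def
    by (simp add: divide_simps add_ac)
  define bd where "bd = (\<lambda>N. \<exists>G\<ge>0. \<forall>n. norm (w N n) \<le> G * A n powr (real N + 1))"
  define td where "td = (\<lambda>N. tends (\<lambda>n. (1 / A n powr (real N + 1)) *\<^sub>R w N n) (\<mu> (Suc N) / real (Suc N)))"
  have VN: "\<exists>K\<ge>0. \<forall>n. norm (V N n) \<le> K * A n powr real N"
    if N: "N > 0" and IH: "\<And>M. M < N \<Longrightarrow> bd M" for N
  proof -
    from IH have "\<forall>M. \<exists>G. M < N \<longrightarrow> G \<ge> 0 \<and> (\<forall>n. norm (w M n) \<le> G * A n powr (real M + 1))"
      unfolding bd_def by blast
    then obtain G where G: "\<And>M. M < N \<Longrightarrow> G M \<ge> 0"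
        "\<And>M n. M < N \<Longrightarrow> norm (w M n) \<le> G M * A n powr (real M + 1)"
      by metis
    define K where "K = (\<Sum>j=1..N. real (N choose j) * (G (N - j) * A 0 powr (real (N - j) + 1 - real N)))"
    have "K \<ge> 0"
      unfolding K_def using G by (intro sum_nonneg mult_nonneg_nonneg) auto
    moreover have "norm (V N n) \<le> K * A n powr real N" for n
    proof -
      have "norm (V N n) \<le> (\<Sum>j=1..N. real (N choose j) * (G (N - j) * A 0 powr (real (N - j) + 1 - real N)) * A n powr real N)"
        unfolding V
      proof (rule order_trans[OF norm_sum sum_mono])
        fix j assume j: "j \<in> {1..N}"
        then have "norm (w (N - j) n) \<le> G (N - j) * A n powr (real (N - j) + 1)"
          by (intro G) auto
        also have "\<dots> \<le> G (N - j) * (A 0 powr (real (N - j) + 1 - real N) * A n powr real N)"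
          using j by (intro mult_left_mono A_power_le G) (auto simp: of_nat_diff)
        finally have "real (N choose j) * norm (w (N - j) n)
            \<le> real (N choose j) * (G (N - j) * (A 0 powr (real (N - j) + 1 - real N) * A n powr real N))"
          by (intro mult_left_mono) auto
        then show "norm (real (N choose j) *\<^sub>R w (N - j) n)
            \<le> real (N choose j) * (G (N - j) * A 0 powr (real (N - j) + 1 - real N)) * A n powr real N"
          by (simp add: mult_ac)
      qed
      then show ?thesis
        by (simp add: K_def sum_distrib_right)
    qed
    ultimately show ?thesis by blast
  qed
  have EV: "(\<lambda>n. E (V N n) / A n powr real N) \<longlonglongrightarrow> \<mu> N"
    if N: "N > 0" and IH: "\<And>M. M < N \<Longrightarrow> td M" for N
  proof -
    have "(\<lambda>n. \<Sum>j=1..N. real (N choose j) * (E (w (N - j) n) / A n powr (real (N - j) + 1)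
        * (A n powr (real (N - j) + 1) / A n powr real N)))
      \<longlonglongrightarrow> (\<Sum>j=1..N. real (N choose j) * (\<mu> (Suc (N - j)) / real (Suc (N - j)) * (if j = 1 then 1 else 0)))"
    proof (intro tendsto_sum tendsto_mult tendsto_const)
      fix j assume j: "j \<in> {1..N}"
      then have "td (N - j)" by (intro IH) auto
      from tends_E[OF this[unfolded td_def]]
      show "(\<lambda>n. E (w (N - j) n) / A n powr (real (N - j) + 1)) \<longlonglongrightarrow> \<mu> (Suc (N - j)) / real (Suc (N - j))"
        by (simp add: linear_scale[OF E_linear])
      show "(\<lambda>n. A n powr (real (N - j) + 1) / A n powr real N) \<longlonglongrightarrow> (if j = 1 then 1 else 0)"
      proof (cases "j = 1")
        case True
        then show ?thesis using j by (simp add: of_nat_diff)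
      next
        case False
        then show ?thesis using j A_powr_null[of "real (N - j) + 1" "real N" 1] by (simp add: of_nat_diff)
      qed
    qed
    also have "(\<Sum>j=1..N. real (N choose j) * (\<mu> (Suc (N - j)) / real (Suc (N - j)) * (if j = 1 then 1 else 0)))
        = (\<Sum>j=1..N. if j = 1 then \<mu> N else 0)"
      using N by (intro sum.cong) auto
    also have "\<dots> = \<mu> N"
      using N by simp
    finally show ?thesis
      by (simp add: V linear_sum[OF E_linear] linear_scale[OF E_linear] sum_divide_distrib)
  qed
  have main: "bd N \<and> td N" for N
  proof (induction N rule: less_induct)
    case (less N)
    show ?case
    proof (cases "N = 0")
      case True
      have "bd 0"
        unfolding bd_def using green_bound C_nonneg A_pos
        by (intro exI[of _ "C0 * norm e"]) (auto simp: w0 less_imp_le)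
      moreover have "td 0"
        using green_limit A_pos by (simp add: td_def w0 \<mu>1[simplified] less_imp_le)
      ultimately show ?thesis using True by simp
    next
      case False
      with less VN[of N] obtain K where K: "K \<ge> 0" "\<And>n. norm (V N n) \<le> K * A n powr real N"
        by blast
      from False less EV[of N] have EVN: "(\<lambda>n. E (V N n) / A n powr real N) \<longlonglongrightarrow> \<mu> N"
        by blast
      have "bd N"
        unfolding bd_def using renewal_bound[OF _ K(2,1)] K C_nonneg False
        by (intro exI[of _ "C0 * K"]) (auto simp: wS)
      moreover have "td N"
        using renewal_limit[OF _ K(2) EVN] False unfolding td_def \<mu>_Suc[symmetric] by (simp add: wS)
      ultimately show ?thesis by simp
    qed
  qed
  show ?thesis
    using EV[OF N] main unfolding \<mu>_def by blast
qed

end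

section \<open>Sums with centred weights\<close>

lemma summable_on_norm_le:
  fixes f :: "'a \<Rightarrow> 'b::banach"
  assumes "\<And>x. norm (f x) \<le> h x" and "h summable_on UNIV"
  shows "f summable_on UNIV"
  by (rule abs_summable_summable, rule summable_on_comparison_test[OF assms(2)]) (use assms(1) in auto)

lemma norm_infsum_le_infsum:
  fixes f :: "'a \<Rightarrow> 'b::banach"
  assumes "\<And>x. norm (f x) \<le> h x" and "h summable_on UNIV"
  shows "norm (infsum f UNIV) \<le> infsum h UNIV"
  by (rule norm_infsum_le[OF has_sum_infsum[OF summable_on_norm_le[OF assms]] has_sum_infsum[OF assms(2)] assms(1)])

lemma infsum_dominated_tendsto:
  fixes f :: "nat \<Rightarrow> 'a \<Rightarrow> real"
  assumes lim: "\<And>x. (\<lambda>n. f n x) \<longlonglongrightarrow> g x" and bd: "\<And>n x. \<bar>f n x\<bar> \<le> h x" and h: "h summable_on UNIV"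
  shows "(\<lambda>n. infsum (f n) UNIV) \<longlonglongrightarrow> infsum g UNIV"
proof (rule tendstoI)
  fix \<epsilon> :: real assume \<epsilon>: "\<epsilon> > 0"
  have bd_g: "\<bar>g x\<bar> \<le> h x" for x
    by (rule LIMSEQ_le_const2[OF tendsto_rabs[OF lim]]) (use bd in auto)
  obtain F where F: "finite F" "dist (sum h F) (infsum h UNIV) \<le> \<epsilon> / 4"
    using infsum_finite_approximation[OF h, of "\<epsilon> / 4"] \<epsilon> by auto
  have split: "infsum u UNIV = sum u F + infsum u (- F)" if "u summable_on UNIV" for u :: "'a \<Rightarrow> real"
  proof -
    have "infsum u (F \<union> - F) = infsum u F + infsum u (- F)"
      using that F by (intro infsum_Un_disjoint) (auto intro: summable_on_subset_banach)
    then show ?thesis using F by (simp add: Compl_partition)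
  qed
  have tail: "\<bar>infsum u (- F)\<bar> \<le> \<epsilon> / 4" if "\<And>x. \<bar>u x\<bar> \<le> h x" for u :: "'a \<Rightarrow> real"
  proof -
    have "u summable_on UNIV"
      using that h by (intro summable_on_norm_le[of u h]) auto
    then have "u summable_on - F" "h summable_on - F"
      using h by (blast intro: summable_on_subset_banach)+
    then have "norm (infsum u (- F)) \<le> infsum h (- F)"
      using that by (intro norm_infsum_le[OF has_sum_infsum has_sum_infsum]) auto
    moreover have "infsum h (- F) \<le> \<epsilon> / 4"
      using split[OF h] F(2) unfolding dist_real_def by linarith
    ultimately show ?thesis
      unfolding real_norm_def by linarith
  qed
  have "(\<lambda>n. sum (f n) F) \<longlonglongrightarrow> sum g F"
    by (intro tendsto_sum lim)
  then have "\<forall>\<^sub>F n in sequentially. dist (sum (f n) F) (sum g F) < \<epsilon> / 4"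
    using \<epsilon> by (intro tendstoD) auto
  then show "\<forall>\<^sub>F n in sequentially. dist (infsum (f n) UNIV) (infsum g UNIV) < \<epsilon>"
  proof eventually_elim
    case (elim n)
    have "f n summable_on UNIV" "g summable_on UNIV"
      using bd bd_g h by (auto intro!: summable_on_norm_le[of _ h])
    then have "infsum (f n) UNIV = sum (f n) F + infsum (f n) (- F)"
        "infsum g UNIV = sum g F + infsum g (- F)"
      by (auto intro: split)
    then show ?case
      using elim tail[of "f n", OF bd] tail[of g, OF bd_g] \<epsilon> unfolding dist_real_def by linarith
  qed
qed

lemma infsum_finite_sum:
  fixes f :: "'i \<Rightarrow> 'a \<Rightarrow> 'b::{topological_ab_group_add, t2_space}"
  assumes "finite I" "\<And>i. i \<in> I \<Longrightarrow> f i summable_on A"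
  shows "infsum (\<lambda>x. \<Sum>i\<in>I. f i x) A = (\<Sum>i\<in>I. infsum (f i) A)"
    and "(\<lambda>x. \<Sum>i\<in>I. f i x) summable_on A"
proof -
  have "((\<lambda>x. \<Sum>i\<in>I. f i x) has_sum (\<Sum>i\<in>I. infsum (f i) A)) A"
    using assms
  proof (induction I rule: finite_induct)
    case (insert i I)
    then show ?case by (auto intro!: has_sum_add)
  qed auto
  then show "infsum (\<lambda>x. \<Sum>i\<in>I. f i x) A = (\<Sum>i\<in>I. infsum (f i) A)"
    and "(\<lambda>x. \<Sum>i\<in>I. f i x) summable_on A"
    by (auto simp: infsumI summable_on_def)
qed

lemma infsum_of_bounded_linear:
  assumes "bounded_linear h" "f summable_on A"
  shows "infsum (\<lambda>x. h (f x)) A = h (infsum f A)"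
  by (rule infsumI) (rule has_sum_bounded_linear[OF assms(1) has_sum_infsum[OF assms(2)]])

context regular_sums
begin

text \<open>For \<open>q k = \<aa> k powr (- d - \<eta>)\<close>, \<open>r k = \<aa> k powr (- d - 2 * \<eta>)\<close> this is the gain of a square root
  from one difference, \<open>r\<close> being summable because \<open>d + 2 * \<eta> > \<alpha>\<close>.\<close>

lemma geometric_mean_sums:
  assumes q: "\<And>k. q k \<ge> 0" and r: "\<And>k. r k \<ge> 0" "summable r" and qq: "\<And>k. (q k)\<^sup>2 \<le> p k * r k"
  shows "(\<lambda>n. (\<Sum>k\<le>n. q k) / A n powr (1/2)) \<longlonglongrightarrow> 0"
proof (rule tendstoI)
  fix \<epsilon> :: real assume \<epsilon>: "\<epsilon> > 0"
  define \<theta> where "\<theta> = \<epsilon> / 2"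
  have \<theta>: "\<theta> > 0" using \<epsilon> by (simp add: \<theta>_def)
  obtain m where m: "norm (sum r {m..<n}) < \<theta>\<^sup>2" for n
    using r(2) \<theta> unfolding summable_Cauchy by (metis order_refl zero_less_power)
  define D where "D = (\<Sum>k<m. q k)"
  have "(\<lambda>n. D / A n powr (1/2)) \<longlonglongrightarrow> 0"
    by (intro real_tendsto_divide_at_top[OF tendsto_const A_powr_lim]) simp
  then have "\<forall>\<^sub>F n in sequentially. D / A n powr (1/2) < \<theta>"
    using \<theta> by (rule order_tendstoD)
  then show "\<forall>\<^sub>F n in sequentially. dist ((\<Sum>k\<le>n. q k) / A n powr (1/2)) 0 < \<epsilon>"
  proof eventually_elim
    case (elim n)
    define t where "t = A n powr (1/2)"
    have t: "t > 0" "t * t = A n"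
      using A_pos[of n] by (auto simp: t_def powr_add[symmetric])
    \<comment> \<open>Arithmetic-geometric mean with weights balanced so that both sums are of size
      \<theta> t: the sum of p is at most A = t^2, and the tail of r is below \<theta>^2.\<close>
    have qle: "q k \<le> (\<theta> / t * p k + t / \<theta> * r k) / 2" for k
    proof (rule power2_le_imp_le)
      have "(q k)\<^sup>2 \<le> (\<theta> / t * p k) * (t / \<theta> * r k)"
        using qq[of k] t \<theta> by (simp add: field_simps)
      also have "\<dots> \<le> ((\<theta> / t * p k + t / \<theta> * r k) / 2)\<^sup>2"
      proof -
        have "x * y \<le> ((x + y) / 2)\<^sup>2" for x y :: real
          using zero_le_power2[of "x - y"] by (simp add: power2_eq_square field_simps)
        then show ?thesis .
      qed
      finally show "(q k)\<^sup>2 \<le> ((\<theta> / t * p k + t / \<theta> * r k) / 2)\<^sup>2" .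
      show "0 \<le> (\<theta> / t * p k + t / \<theta> * r k) / 2"
        using \<theta> t p_pos[of k] r(1)[of k] by auto
    qed
    have "(\<Sum>k\<le>n. q k) \<le> (\<Sum>k\<in>{..<m} \<union> {m..<Suc n}. q k)"
      using q by (intro sum_mono2) auto
    also have "\<dots> = D + (\<Sum>k\<in>{m..<Suc n}. q k)"
      unfolding D_def by (rule sum.union_disjoint) auto
    also have "(\<Sum>k\<in>{m..<Suc n}. q k) \<le> (\<Sum>k\<in>{m..<Suc n}. (\<theta> / t * p k + t / \<theta> * r k) / 2)"
      by (intro sum_mono qle)
    also have "\<dots> = (\<theta> / t * sum p {m..<Suc n} + t / \<theta> * sum r {m..<Suc n}) / 2"
      by (simp only: sum_divide_distrib[symmetric] sum.distrib sum_distrib_left[symmetric])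
    also have "\<dots> \<le> (\<theta> / t * A n + t / \<theta> * \<theta>\<^sup>2) / 2"
    proof (intro divide_right_mono add_mono mult_left_mono)
      show "sum p {m..<Suc n} \<le> A n"
        unfolding A_eq using p_pos by (intro sum_mono2) (auto intro: less_imp_le)
      show "sum r {m..<Suc n} \<le> \<theta>\<^sup>2"
        using m[of "Suc n"] by simp
    qed (use \<theta> t in auto)
    also have "\<dots> = \<theta> * t"
      using \<theta> t unfolding t(2)[symmetric] by (simp add: power2_eq_square)
    also have "D < \<theta> * t"
      using elim t by (simp add: t_def[symmetric] divide_less_eq)
    finally have "(\<Sum>k\<le>n. q k) < \<epsilon> * t"
      by (simp add: \<theta>_def)
    moreover have "(\<Sum>k\<le>n. q k) \<ge> 0"
      using q by (simp add: sum_nonneg)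
    ultimately show ?case
      using t by (simp add: t_def[symmetric] dist_real_def abs_divide divide_less_eq)
  qed
qed

end

text \<open>\<open>T_bound\<close>, \<open>T_diff\<close> and \<open>T_diff2\<close> are Hypothesis
  B at a single exponent \<eta>, with \<open>lam a\<close> standing for |a|^\<eta>. The family w is
  given by its recursion alone; summability of the series in it comes from the bounds established by
  induction on N.\<close>

locale walk_recursion = walk_operators p A \<gamma> T e E sn \<Phi> C0 Cn \<delta>
  for p A \<gamma> and T :: "nat \<Rightarrow> 'i::ab_group_add \<Rightarrow> 'b::banach \<Rightarrow> 'b" and e E sn \<Phi> C0 Cn \<delta> +
  fixes q r :: "nat \<Rightarrow> real" and lam \<beta> :: "'i \<Rightarrow> real" and C1 :: real and w :: "nat \<Rightarrow> nat \<Rightarrow> 'i \<Rightarrow> 'b"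
  assumes T_bound: "\<And>k a u. norm (T k a u) \<le> C1 * p k * norm u"
    and T_diff: "\<And>k a b u. norm (T k b u - T k a u) \<le> C1 * (lam (b - a) * q k) * norm u"
    and T_diff2: "\<And>k a b u. norm (T k (a - b) u - T k a u - T k (- b) u + T k 0 u)
        \<le> C1 * (lam a * lam b * r k) * norm u"
    and lam_nonneg: "\<And>a. lam a \<ge> 0" and lam_minus: "\<And>a. lam (- a) = lam a"
    and q_nonneg: "\<And>k. q k \<ge> 0" and r_nonneg: "\<And>k. r k \<ge> 0"
    and r_summable: "summable r" and q_square: "\<And>k. (q k)\<^sup>2 \<le> p k * r k"
    and \<beta>_summable: "(\<lambda>b. \<bar>\<beta> b\<bar>) summable_on UNIV"
    and \<beta>_lam_summable: "(\<lambda>b. \<bar>\<beta> b\<bar> * lam b) summable_on UNIV"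
    and \<beta>_zero: "infsum \<beta> UNIV = 0"
    and C1_nonneg: "C1 \<ge> 0"
    and w0: "\<And>n a. w 0 n a = (\<Sum>k<n. T k a e)"
    and wS: "\<And>N n a. N > 0 \<Longrightarrow> w N n a = (\<Sum>l=1..n. \<Sum>j=1..N. real (N choose j) *\<^sub>R
        (\<Sum>\<^sub>\<infinity>b. \<beta> b ^ j *\<^sub>R T l (a - b) (w (N - j) (n - l) b)))"
begin

definition "\<beta>1 = (\<Sum>\<^sub>\<infinity>b. \<bar>\<beta> b\<bar>)"
definition "\<beta>lam = (\<Sum>\<^sub>\<infinity>b. \<bar>\<beta> b\<bar> * lam b)"
definition "Qs n = (\<Sum>k\<le>n. q k)"

lemma \<beta>1_nonneg: "\<beta>1 \<ge> 0"
  unfolding \<beta>1_def by (intro infsum_nonneg) auto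

lemma \<beta>lam_nonneg: "\<beta>lam \<ge> 0"
  unfolding \<beta>lam_def using lam_nonneg by (intro infsum_nonneg) auto

lemma Qs_nonneg: "Qs n \<ge> 0"
  unfolding Qs_def using q_nonneg by (intro sum_nonneg) auto

lemma Qs_null: "(\<lambda>n. Qs n / A n powr (1/2)) \<longlonglongrightarrow> 0"
  unfolding Qs_def by (rule geometric_mean_sums[OF q_nonneg r_nonneg r_summable q_square])

lemma Qs_le: "\<exists>K\<ge>0. \<forall>n. Qs n \<le> K * A n powr (1/2)"
proof -
  have "Bseq (\<lambda>n. Qs n / A n powr (1/2))"
    using Qs_null convergentI convergent_imp_Bseq by blast
  then obtain K where K: "K > 0" "\<And>n. norm (Qs n / A n powr (1/2)) \<le> K"
    unfolding Bseq_def by blast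
  then have "Qs n \<le> K * A n powr (1/2)" for n
    using K(2)[of n] Qs_nonneg[of n] by (simp add: divide_le_eq)
  with K show ?thesis by (intro exI[of _ K]) auto
qed

lemma \<beta>_le: "\<bar>\<beta> b\<bar> \<le> \<beta>1"
  using finite_sum_le_infsum[OF \<beta>_summable, of "{b}"] by (simp add: \<beta>1_def)

lemma \<beta>_power_le: "j \<ge> 1 \<Longrightarrow> \<bar>\<beta> b ^ j\<bar> \<le> \<beta>1 ^ (j - 1) * \<bar>\<beta> b\<bar>"
proof -
  assume "j \<ge> 1"
  then obtain i where j: "j = Suc i" by (cases j) auto
  have "\<bar>\<beta> b\<bar> ^ i \<le> \<beta>1 ^ i"
    using \<beta>_le by (intro power_mono) auto
  then have "\<bar>\<beta> b\<bar> * \<bar>\<beta> b\<bar> ^ i \<le> \<bar>\<beta> b\<bar> * \<beta>1 ^ i"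
    by (intro mult_left_mono) auto
  then show ?thesis
    unfolding j by (simp add: abs_mult power_abs mult.commute)
qed

lemma \<beta>_sum:
  fixes X :: "'i \<Rightarrow> 'c::banach"
  assumes j: "j \<ge> 1" and X: "\<And>b. norm (X b) \<le> K"
  shows "(\<lambda>b. \<beta> b ^ j *\<^sub>R X b) summable_on UNIV"
    "norm (\<Sum>\<^sub>\<infinity>b. \<beta> b ^ j *\<^sub>R X b) \<le> \<beta>1 ^ (j - 1) * \<beta>1 * K"
proof -
  have le: "norm (\<beta> b ^ j *\<^sub>R X b) \<le> \<beta>1 ^ (j - 1) * K * \<bar>\<beta> b\<bar>" for b
  proof -
    have "norm (\<beta> b ^ j *\<^sub>R X b) \<le> (\<beta>1 ^ (j - 1) * \<bar>\<beta> b\<bar>) * K"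
      unfolding norm_scaleR using \<beta>_power_le[OF j] X \<beta>1_nonneg by (intro mult_mono) auto
    then show ?thesis by (simp add: mult_ac)
  qed
  have s: "(\<lambda>b. \<beta>1 ^ (j - 1) * K * \<bar>\<beta> b\<bar>) summable_on UNIV"
    by (intro summable_on_cmult_right \<beta>_summable)
  show "(\<lambda>b. \<beta> b ^ j *\<^sub>R X b) summable_on UNIV"
    by (rule summable_on_norm_le[OF le s])
  show "norm (\<Sum>\<^sub>\<infinity>b. \<beta> b ^ j *\<^sub>R X b) \<le> \<beta>1 ^ (j - 1) * \<beta>1 * K"
  proof -
    have "infsum (\<lambda>b. \<beta>1 ^ (j - 1) * K * \<bar>\<beta> b\<bar>) UNIV = \<beta>1 ^ (j - 1) * K * \<beta>1"
      unfolding \<beta>1_def by (rule infsum_cmult_right')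
    then show ?thesis
      using norm_infsum_le_infsum[OF le s] by (simp only: mult_ac)
  qed
qed

lemma \<beta>_lam_sum:
  fixes X :: "'i \<Rightarrow> 'c::banach"
  assumes j: "j \<ge> 1" and X: "\<And>b. norm (X b) \<le> K * lam b"
  shows "(\<lambda>b. \<beta> b ^ j *\<^sub>R X b) summable_on UNIV"
    "norm (\<Sum>\<^sub>\<infinity>b. \<beta> b ^ j *\<^sub>R X b) \<le> \<beta>1 ^ (j - 1) * \<beta>lam * K"
proof -
  have le: "norm (\<beta> b ^ j *\<^sub>R X b) \<le> \<beta>1 ^ (j - 1) * K * (\<bar>\<beta> b\<bar> * lam b)" for b
  proof -
    have "norm (\<beta> b ^ j *\<^sub>R X b) \<le> (\<beta>1 ^ (j - 1) * \<bar>\<beta> b\<bar>) * (K * lam b)"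
      unfolding norm_scaleR using \<beta>_power_le[OF j] X \<beta>1_nonneg by (intro mult_mono) auto
    then show ?thesis by (simp add: mult_ac)
  qed
  have s: "(\<lambda>b. \<beta>1 ^ (j - 1) * K * (\<bar>\<beta> b\<bar> * lam b)) summable_on UNIV"
    by (intro summable_on_cmult_right \<beta>_lam_summable)
  show "(\<lambda>b. \<beta> b ^ j *\<^sub>R X b) summable_on UNIV"
    by (rule summable_on_norm_le[OF le s])
  show "norm (\<Sum>\<^sub>\<infinity>b. \<beta> b ^ j *\<^sub>R X b) \<le> \<beta>1 ^ (j - 1) * \<beta>lam * K"
  proof -
    have "infsum (\<lambda>b. \<beta>1 ^ (j - 1) * K * (\<bar>\<beta> b\<bar> * lam b)) UNIV = \<beta>1 ^ (j - 1) * K * \<beta>lam"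
      unfolding \<beta>lam_def by (rule infsum_cmult_right')
    then show ?thesis
      using norm_infsum_le_infsum[OF le s] by (simp only: mult_ac)
  qed
qed

text \<open>Here the vanishing sum of the weights enters: it turns values of \<open>w N n\<close>
  into differences, which are half a power of A smaller.\<close>

lemma \<beta>_sum_centre:
  fixes X :: "'i \<Rightarrow> 'c::banach"
  assumes X: "\<And>b. norm (X b) \<le> K"
  shows "(\<Sum>\<^sub>\<infinity>b. \<beta> b *\<^sub>R X b) = (\<Sum>\<^sub>\<infinity>b. \<beta> b *\<^sub>R (X b - x))"
proof -
  have \<beta>: "\<beta> summable_on UNIV"
    using \<beta>_summable by (intro summable_on_norm_le[of \<beta> "\<lambda>b. \<bar>\<beta> b\<bar>"]) auto
  have "(\<lambda>b. \<beta> b *\<^sub>R X b) summable_on UNIV"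
    using \<beta>_sum(1)[of 1 X K] X by simp
  moreover have "((\<lambda>b. \<beta> b *\<^sub>R x) has_sum (0 *\<^sub>R x)) UNIV"
    using has_sum_bounded_linear[OF bounded_linear_scaleR_left has_sum_infsum[OF \<beta>]] \<beta>_zero by simp
  ultimately have "((\<lambda>b. \<beta> b *\<^sub>R X b + - (\<beta> b *\<^sub>R x)) has_sum ((\<Sum>\<^sub>\<infinity>b. \<beta> b *\<^sub>R X b) + - (0 *\<^sub>R x))) UNIV"
    by (intro has_sum_add has_sum_infsum) (simp_all add: has_sum_uminus)
  then show ?thesis
    by (simp add: infsumI scaleR_diff_right)
qed

text \<open>The recursion is split as w = (sum of \<open>T l a\<close> applied to V) + U. V no
  longer depends on the end point a, and \<open>E (V N n)\<close> will be the N-th moment of the sum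
  under study. U collects the errors of replacing \<open>T l (a - b)\<close> by
  \<open>T l a\<close>, and \<open>UD\<close> is the part with multiplicity j of its variation in
  a.\<close>

definition "V N n = (\<Sum>j=1..N. real (N choose j) *\<^sub>R (\<Sum>\<^sub>\<infinity>b. \<beta> b ^ j *\<^sub>R w (N - j) n b))"

definition "DD l a b u = T l (a - b) u - T l a u - T l (- b) u + T l 0 u"

definition "U N n a = (\<Sum>l=1..n. \<Sum>j=1..N. real (N choose j) *\<^sub>R
   (\<Sum>\<^sub>\<infinity>b. \<beta> b ^ j *\<^sub>R (T l (a - b) (w (N - j) (n - l) b) - T l a (w (N - j) (n - l) b))))"

definition "UD N j n a = (\<Sum>l=1..n. \<Sum>\<^sub>\<infinity>b. \<beta> b ^ j *\<^sub>R DD l a b (w (N - j) (n - l) b))"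

text \<open>One full power of A for the free final time and half a power for each of the N centred
  factors; \<open>w_diff_bound\<close> records the further half power saved by differencing the end
  point.\<close>

definition "w_bound N G \<longleftrightarrow> G \<ge> 0 \<and> (\<forall>n a. norm (w N n a) \<le> G * A n powr (real N / 2 + 1))"

definition "w_diff_bound N H \<longleftrightarrow> H \<ge> 0 \<and> (\<forall>n a. norm (w N n a - w N n 0) \<le> H * A n powr ((real N + 1) / 2) * lam a)"

lemma w_boundD: "w_bound N G \<Longrightarrow> G \<ge> 0" "w_bound N G \<Longrightarrow> norm (w N n a) \<le> G * A n powr (real N / 2 + 1)"
  by (auto simp: w_bound_def)

lemma w_diff_boundD: "w_diff_bound N H \<Longrightarrow> H \<ge> 0"
  "w_diff_bound N H \<Longrightarrow> norm (w N n a - w N n 0) \<le> H * A n powr ((real N + 1) / 2) * lam a"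
  by (auto simp: w_diff_bound_def)

lemma w_bound_back: "w_bound N G \<Longrightarrow> norm (w N (n - l) a) \<le> G * A n powr (real N / 2 + 1)"
  using w_boundD(2)[of N G "n - l" a] A_powr_mono[of "real N / 2 + 1" "n - l" n] w_boundD(1)[of N G]
  by (meson add_nonneg_nonneg diff_le_self divide_nonneg_nonneg mult_left_mono of_nat_0_le_iff order_trans
      zero_le_numeral zero_le_one)

lemma T_norm_diff: "norm (T l (a - b) u - T l a u) \<le> C1 * q l * norm u * lam b"
  using T_diff[of l "a - b" u a] lam_minus[of b] by (simp add: mult_ac)

lemma T_norm_diff0: "norm (T l a u - T l 0 u) \<le> C1 * q l * norm u * lam a"
  using T_diff[of l a u 0] by (simp add: mult_ac)

lemma DD_norm: "norm (DD l a b u) \<le> C1 * lam a * r l * norm u * lam b"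
  using T_diff2[of l a b u] by (simp add: DD_def mult_ac)

lemma T_linear: "linear (T l a)"
  by (rule bounded_linear.linear[OF T_lin])

lemma E_linear: "linear E"
  by (rule bounded_linear.linear[OF E_lin])

lemma DD_linear: "linear (DD l a b)"
  unfolding DD_def by (intro linear_compose_add linear_compose_sub T_linear)

lemma E_norm: "\<bar>E u\<bar> \<le> Cn * norm u"
  using E_le sn_le order_trans by blast

text \<open>This bound has no decay in l but uses only the weak seminorm, so limits in the sense of
  \<open>tends\<close> pass through DD for each fixed l. Decay in l, for domination, is supplied by
  \<open>E_DD_bound\<close>.\<close>

lemma E_DD: "\<bar>E (DD l a b u)\<bar> \<le> 4 * sn u"
proof -
  have "E (DD l a b u) = E (T l (a - b) u) - E (T l a u) - E (T l (- b) u) + E (T l 0 u)"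
    by (simp add: DD_def linear_diff[OF E_linear] linear_add[OF E_linear])
  then show ?thesis
    using E_T_le[of l "a - b" u] E_T_le[of l a u] E_T_le[of l "- b" u] E_T_le[of l 0 u] by linarith
qed

lemma T_V:
  assumes "\<forall>M<N. \<exists>G. w_bound M G"
  shows "T l a (V N n) = (\<Sum>j=1..N. real (N choose j) *\<^sub>R (\<Sum>\<^sub>\<infinity>b. \<beta> b ^ j *\<^sub>R T l a (w (N - j) n b)))"
  unfolding V_def linear_sum[OF T_linear] linear_scale[OF T_linear]
proof (intro sum.cong refl arg_cong[where f="\<lambda>x. _ *\<^sub>R x"])
  fix j assume j: "j \<in> {1..N}"
  then obtain G where "w_bound (N - j) G"
    using assms[rule_format, of "N - j"] by auto
  then have "(\<lambda>b. \<beta> b ^ j *\<^sub>R w (N - j) n b) summable_on UNIV"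
    using j by (intro \<beta>_sum(1)[where K="G * A n powr (real (N - j) / 2 + 1)"] w_boundD(2)) auto
  from infsum_of_bounded_linear[OF T_lin this, of l a]
  show "T l a (\<Sum>\<^sub>\<infinity>b. \<beta> b ^ j *\<^sub>R w (N - j) n b) = (\<Sum>\<^sub>\<infinity>b. \<beta> b ^ j *\<^sub>R T l a (w (N - j) n b))"
    by (simp add: linear_scale[OF T_linear])
qed

lemma T_w_summable:
  assumes "w_bound (N - j) G" "j \<ge> 1"
  shows "(\<lambda>b. \<beta> b ^ j *\<^sub>R T l (c b) (w (N - j) n b)) summable_on UNIV"
proof (intro \<beta>_sum(1) assms)
  fix b
  have "norm (T l (c b) (w (N - j) n b)) \<le> C1 * p l * norm (w (N - j) n b)"
    by (rule T_bound)
  also have "\<dots> \<le> C1 * p l * (G * A n powr (real (N - j) / 2 + 1))"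
    using C1_nonneg p_pos[of l] by (intro mult_left_mono w_boundD(2)[OF assms(1)]) auto
  finally show "norm (T l (c b) (w (N - j) n b)) \<le> C1 * p l * (G * A n powr (real (N - j) / 2 + 1))" .
qed

lemma w_decomposition:
  assumes N: "N > 0" and IH: "\<forall>M<N. \<exists>G. w_bound M G"
  shows "w N n a = (\<Sum>l=1..n. T l a (V N (n - l))) + U N n a"
proof -
  have "(\<Sum>l=1..n. T l a (V N (n - l))) + U N n a = (\<Sum>l=1..n. \<Sum>j=1..N. real (N choose j) *\<^sub>R
      ((\<Sum>\<^sub>\<infinity>b. \<beta> b ^ j *\<^sub>R T l a (w (N - j) (n - l) b))
        + (\<Sum>\<^sub>\<infinity>b. \<beta> b ^ j *\<^sub>R (T l (a - b) (w (N - j) (n - l) b) - T l a (w (N - j) (n - l) b)))))"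
    unfolding T_V[OF IH] U_def sum.distrib scaleR_add_right by (rule refl)
  also have "\<dots> = w N n a"
    unfolding wS[OF N]
  proof (intro sum.cong refl arg_cong[where f="\<lambda>x. _ *\<^sub>R x"])
  fix l j assume j: "j \<in> {1..N}"
  then obtain G where G: "w_bound (N - j) G"
    using IH[rule_format, of "N - j"] by auto
  let ?w = "w (N - j) (n - l)"
  have s: "(\<lambda>b. \<beta> b ^ j *\<^sub>R T l (c b) (?w b)) summable_on UNIV" for c
    using T_w_summable[OF G] j by auto
  have "(\<Sum>\<^sub>\<infinity>b. \<beta> b ^ j *\<^sub>R (T l (a - b) (?w b) - T l a (?w b)))
      = (\<Sum>\<^sub>\<infinity>b. \<beta> b ^ j *\<^sub>R T l (a - b) (?w b) - \<beta> b ^ j *\<^sub>R T l a (?w b))"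
    by (simp add: scaleR_diff_right)
  also have "\<dots> = (\<Sum>\<^sub>\<infinity>b. \<beta> b ^ j *\<^sub>R T l (a - b) (?w b)) - (\<Sum>\<^sub>\<infinity>b. \<beta> b ^ j *\<^sub>R T l a (?w b))"
    using infsum_add[OF s[of "\<lambda>b. a - b"] summable_on_uminus[THEN iffD2, OF s[of "\<lambda>b. a"]]]
    by (simp add: infsum_uminus)
  finally show "(\<Sum>\<^sub>\<infinity>b. \<beta> b ^ j *\<^sub>R T l a (?w b))
      + (\<Sum>\<^sub>\<infinity>b. \<beta> b ^ j *\<^sub>R (T l (a - b) (?w b) - T l a (?w b))) = (\<Sum>\<^sub>\<infinity>b. \<beta> b ^ j *\<^sub>R T l (a - b) (?w b))"
    by simp
  qed
  finally show ?thesis by simp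
qed

lemma U_difference:
  assumes IH: "\<forall>M<N. \<exists>G. w_bound M G"
  shows "U N n a - U N n 0 = (\<Sum>j=1..N. real (N choose j) *\<^sub>R UD N j n a)"
proof -
  have "U N n a - U N n 0 = (\<Sum>l=1..n. \<Sum>j=1..N. real (N choose j) *\<^sub>R
      (\<Sum>\<^sub>\<infinity>b. \<beta> b ^ j *\<^sub>R DD l a b (w (N - j) (n - l) b)))"
    unfolding U_def sum_subtractf[symmetric] scaleR_diff_right[symmetric]
  proof (intro sum.cong refl arg_cong[where f="\<lambda>x. _ *\<^sub>R x"])
    fix l j assume j: "j \<in> {1..N}"
    then obtain G where G: "w_bound (N - j) G"
      using IH[rule_format, of "N - j"] by auto
    let ?w = "w (N - j) (n - l)"
    have s: "(\<lambda>b. \<beta> b ^ j *\<^sub>R T l (c b) (?w b)) summable_on UNIV" for c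
      using T_w_summable[OF G] j by auto
    have s': "(\<lambda>b. \<beta> b ^ j *\<^sub>R (T l (c b) (?w b) - T l (c' b) (?w b))) summable_on UNIV" for c c'
      using summable_on_add[OF s[of c] summable_on_uminus[THEN iffD2, OF s[of c']]]
      by (simp add: scaleR_diff_right)
    have "(\<Sum>\<^sub>\<infinity>b. \<beta> b ^ j *\<^sub>R (T l (a - b) (?w b) - T l a (?w b)))
        + - (\<Sum>\<^sub>\<infinity>b. \<beta> b ^ j *\<^sub>R (T l (0 - b) (?w b) - T l 0 (?w b)))
        = (\<Sum>\<^sub>\<infinity>b. \<beta> b ^ j *\<^sub>R (T l (a - b) (?w b) - T l a (?w b))
            + - (\<beta> b ^ j *\<^sub>R (T l (0 - b) (?w b) - T l 0 (?w b))))"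
      unfolding infsum_uminus[symmetric]
      by (rule infsum_add[symmetric]) (auto simp: summable_on_uminus intro: s' simp del: diff_0)
    also have "\<dots> = (\<Sum>\<^sub>\<infinity>b. \<beta> b ^ j *\<^sub>R DD l a b (?w b))"
      by (intro infsum_cong) (simp add: DD_def scaleR_diff_right scaleR_add_right)
    finally show "(\<Sum>\<^sub>\<infinity>b. \<beta> b ^ j *\<^sub>R (T l (a - b) (?w b) - T l a (?w b)))
        - (\<Sum>\<^sub>\<infinity>b. \<beta> b ^ j *\<^sub>R (T l (0 - b) (?w b) - T l 0 (?w b)))
        = (\<Sum>\<^sub>\<infinity>b. \<beta> b ^ j *\<^sub>R DD l a b (?w b))"
      by simp
  qed
  also have "\<dots> = (\<Sum>j=1..N. \<Sum>l=1..n. real (N choose j) *\<^sub>R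
      (\<Sum>\<^sub>\<infinity>b. \<beta> b ^ j *\<^sub>R DD l a b (w (N - j) (n - l) b)))"
    by (rule sum.swap)
  finally show ?thesis
    by (simp add: UD_def scaleR_sum_right)
qed

text \<open>Summability of r makes the convolution cost no power of A. For j = 1 the exponent is (N
  + 1) / 2, exactly that of \<open>w_diff_bound\<close>; for j >= 2 it is lower by at least one
  half.\<close>

lemma UD_bound:
  assumes G: "w_bound (N - j) G" and j: "j \<ge> 1"
  shows "norm (UD N j n a) \<le> \<beta>1 ^ (j - 1) * \<beta>lam * C1 * suminf r * G * A n powr (real (N - j) / 2 + 1) * lam a"
proof -
  have "norm (UD N j n a) \<le> (\<Sum>l=1..n. \<beta>1 ^ (j - 1) * \<beta>lam * (C1 * lam a * r l * (G * A n powr (real (N - j) / 2 + 1))))"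
    unfolding UD_def
  proof (rule order_trans[OF norm_sum sum_mono], rule \<beta>_lam_sum(2)[OF j])
    fix l b
    have "norm (DD l a b (w (N - j) (n - l) b)) \<le> C1 * lam a * r l * norm (w (N - j) (n - l) b) * lam b"
      by (rule DD_norm)
    also have "\<dots> \<le> C1 * lam a * r l * (G * A n powr (real (N - j) / 2 + 1)) * lam b"
      using C1_nonneg lam_nonneg r_nonneg
      by (intro mult_left_mono mult_right_mono w_bound_back[OF G] mult_nonneg_nonneg)
    finally show "norm (DD l a b (w (N - j) (n - l) b)) \<le> C1 * lam a * r l * (G * A n powr (real (N - j) / 2 + 1)) * lam b" .
  qed
  also have "\<dots> = \<beta>1 ^ (j - 1) * \<beta>lam * C1 * G * A n powr (real (N - j) / 2 + 1) * lam a * (\<Sum>l=1..n. r l)"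
    by (simp add: sum_distrib_left sum_distrib_right mult_ac)
  also have "\<dots> \<le> \<beta>1 ^ (j - 1) * \<beta>lam * C1 * G * A n powr (real (N - j) / 2 + 1) * lam a * suminf r"
    using \<beta>1_nonneg \<beta>lam_nonneg C1_nonneg w_boundD(1)[OF G] lam_nonneg r_nonneg r_summable
    by (intro mult_left_mono sum_le_suminf mult_nonneg_nonneg) auto
  finally show ?thesis by (simp only: mult_ac)
qed

text \<open>A single difference costs the partial sum \<open>Qs n\<close>, which is o(A^(1/2)).
  Hence U is of lower order than A^(N/2 + 1) and drops out of the limit of w.\<close>

lemma U_bound:
  assumes IH: "\<forall>M<N. \<exists>G. w_bound M G"
  shows "\<exists>K\<ge>0. \<forall>n a. norm (U N n a) \<le> K * Qs n * A n powr ((real N + 1) / 2)"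
proof -
  from IH have "\<forall>M. \<exists>G. M < N \<longrightarrow> w_bound M G" by blast
  then obtain G where G: "\<And>M. M < N \<Longrightarrow> w_bound M (G M)" by metis
  define c where "c = (\<lambda>j. real (N choose j) * (\<beta>1 ^ (j - 1) * \<beta>lam * (C1 * (G (N - j) *
      A 0 powr (real (N - j) / 2 + 1 - (real N + 1) / 2)))))"
  have c: "c j \<ge> 0" if "j \<in> {1..N}" for j
    unfolding c_def using that \<beta>1_nonneg \<beta>lam_nonneg C1_nonneg w_boundD(1)[OF G[of "N - j"]]
    by (intro mult_nonneg_nonneg) auto
  have "norm (U N n a) \<le> (\<Sum>j=1..N. c j) * Qs n * A n powr ((real N + 1) / 2)" for n a
  proof -
    let ?S = "A n powr ((real N + 1) / 2)"
    have "norm (U N n a) \<le> (\<Sum>l=1..n. \<Sum>j=1..N. c j * q l * ?S)"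
      unfolding U_def
    proof (intro order_trans[OF norm_sum sum_mono])
      fix l j assume j: "j \<in> {1..N}"
      let ?a = "A 0 powr (real (N - j) / 2 + 1 - (real N + 1) / 2)"
      have G': "w_bound (N - j) (G (N - j))" using G j by auto
      have "norm (\<Sum>\<^sub>\<infinity>b. \<beta> b ^ j *\<^sub>R (T l (a - b) (w (N - j) (n - l) b) - T l a (w (N - j) (n - l) b)))
          \<le> \<beta>1 ^ (j - 1) * \<beta>lam * (C1 * q l * (G (N - j) * (?a * ?S)))"
      proof (rule \<beta>_lam_sum(2))
        fix b
        have "norm (T l (a - b) (w (N - j) (n - l) b) - T l a (w (N - j) (n - l) b))
            \<le> C1 * q l * norm (w (N - j) (n - l) b) * lam b"
          by (rule T_norm_diff)
        also have "\<dots> \<le> C1 * q l * (G (N - j) * (?a * ?S)) * lam b"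
        proof (intro mult_left_mono mult_right_mono lam_nonneg mult_nonneg_nonneg C1_nonneg q_nonneg)
          have "norm (w (N - j) (n - l) b) \<le> G (N - j) * A n powr (real (N - j) / 2 + 1)"
            by (rule w_bound_back[OF G'])
          also have "\<dots> \<le> G (N - j) * (?a * ?S)"
            using j by (intro mult_left_mono A_power_le w_boundD(1)[OF G']) (auto simp: of_nat_diff field_simps)
          finally show "norm (w (N - j) (n - l) b) \<le> G (N - j) * (?a * ?S)" .
        qed
        finally show "norm (T l (a - b) (w (N - j) (n - l) b) - T l a (w (N - j) (n - l) b))
            \<le> C1 * q l * (G (N - j) * (?a * ?S)) * lam b" .
      qed (use j in auto)
      then have "real (N choose j) * norm (\<Sum>\<^sub>\<infinity>b. \<beta> b ^ j *\<^sub>R (T l (a - b) (w (N - j) (n - l) b) - T l a (w (N - j) (n - l) b)))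
          \<le> real (N choose j) * (\<beta>1 ^ (j - 1) * \<beta>lam * (C1 * q l * (G (N - j) * (?a * ?S))))"
        by (intro mult_left_mono) auto
      also have "\<dots> = c j * q l * ?S"
        by (simp only: c_def mult_ac)
      finally show "norm (real (N choose j) *\<^sub>R
          (\<Sum>\<^sub>\<infinity>b. \<beta> b ^ j *\<^sub>R (T l (a - b) (w (N - j) (n - l) b) - T l a (w (N - j) (n - l) b)))) \<le> c j * q l * ?S"
        by simp
    qed
    also have "\<dots> = (\<Sum>j=1..N. c j) * (\<Sum>l=1..n. q l) * ?S"
      by (simp add: sum_distrib_left sum_distrib_right)
    also have "\<dots> \<le> (\<Sum>j=1..N. c j) * Qs n * ?S"
      unfolding Qs_def using c q_nonneg
      by (intro mult_right_mono mult_left_mono sum_mono2 sum_nonneg) auto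
    finally show ?thesis .
  qed
  moreover have "(\<Sum>j=1..N. c j) \<ge> 0"
    using c by (rule sum_nonneg)
  ultimately show ?thesis by blast
qed

text \<open>For j = 1 centring replaces \<open>w (N - 1)\<close> by its difference, of order
  A^(N/2). For j >= 2 the bound on \<open>w (N - j)\<close> already has exponent at most N / 2, with
  equality at j = 2.\<close>

lemma V_bound:
  assumes N: "N > 0" and IH: "\<forall>M<N. \<exists>G. w_bound M G" and IHd: "\<forall>M<N. \<exists>H. w_diff_bound M H"
  shows "\<exists>K\<ge>0. \<forall>n. norm (V N n) \<le> K * A n powr (real N / 2)"
proof -
  have ex: "\<exists>K\<ge>0. \<forall>n. norm (\<Sum>\<^sub>\<infinity>b. \<beta> b ^ j *\<^sub>R w (N - j) n b) \<le> K * A n powr (real N / 2)" if j: "j \<in> {1..N}" for j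
  proof (cases "j = 1")
    case True
    obtain G H where G: "w_bound (N - 1) G" and H: "w_diff_bound (N - 1) H"
      using IH[rule_format, of "N - 1"] IHd[rule_format, of "N - 1"] N by auto
    have "norm (\<Sum>\<^sub>\<infinity>b. \<beta> b ^ 1 *\<^sub>R w (N - 1) n b) \<le> (\<beta>1 ^ (1 - 1) * \<beta>lam * H) * A n powr (real N / 2)" for n
    proof -
      have "(\<Sum>\<^sub>\<infinity>b. \<beta> b ^ 1 *\<^sub>R w (N - 1) n b) = (\<Sum>\<^sub>\<infinity>b. \<beta> b ^ 1 *\<^sub>R (w (N - 1) n b - w (N - 1) n 0))"
        unfolding power_one_right by (rule \<beta>_sum_centre[OF w_boundD(2)[OF G]])
      moreover have "norm (\<Sum>\<^sub>\<infinity>b. \<beta> b ^ 1 *\<^sub>R (w (N - 1) n b - w (N - 1) n 0))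
          \<le> \<beta>1 ^ (1 - 1) * \<beta>lam * (H * A n powr (real N / 2))"
        using w_diff_boundD(2)[OF H, of n] N by (intro \<beta>_lam_sum(2)) (auto simp: of_nat_diff)
      ultimately show ?thesis by simp
    qed
    moreover have "\<beta>1 ^ (1 - 1) * \<beta>lam * H \<ge> 0"
      using \<beta>lam_nonneg w_diff_boundD(1)[OF H] by simp
    ultimately show ?thesis
      unfolding True by blast
  next
    case False
    obtain G where G: "w_bound (N - j) G"
      using IH[rule_format, of "N - j"] j by auto
    let ?c = "A 0 powr (real (N - j) / 2 + 1 - real N / 2)"
    have "norm (\<Sum>\<^sub>\<infinity>b. \<beta> b ^ j *\<^sub>R w (N - j) n b) \<le> (\<beta>1 ^ (j - 1) * \<beta>1 * (G * ?c)) * A n powr (real N / 2)" for n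
    proof -
      have "norm (w (N - j) n b) \<le> G * (?c * A n powr (real N / 2))" for b
      proof -
        have "norm (w (N - j) n b) \<le> G * A n powr (real (N - j) / 2 + 1)"
          by (rule w_boundD(2)[OF G])
        also have "\<dots> \<le> G * (?c * A n powr (real N / 2))"
          using j False by (intro mult_left_mono A_power_le w_boundD(1)[OF G]) (auto simp: of_nat_diff field_simps)
        finally show ?thesis .
      qed
      from \<beta>_sum(2)[OF _ this, of j] show ?thesis
        using j by (simp add: mult.assoc)
    qed
    moreover have "\<beta>1 ^ (j - 1) * \<beta>1 * (G * ?c) \<ge> 0"
      using \<beta>1_nonneg w_boundD(1)[OF G] by (intro mult_nonneg_nonneg) auto
    ultimately show ?thesis by blast
  qed
  then have "\<forall>j. \<exists>K. j \<in> {1..N} \<longrightarrow> K \<ge> 0 \<and> (\<forall>n. norm (\<Sum>\<^sub>\<infinity>b. \<beta> b ^ j *\<^sub>R w (N - j) n b) \<le> K * A n powr (real N / 2))"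
    by blast
  then obtain K where K: "\<And>j. j \<in> {1..N} \<Longrightarrow> K j \<ge> 0"
      "\<And>j n. j \<in> {1..N} \<Longrightarrow> norm (\<Sum>\<^sub>\<infinity>b. \<beta> b ^ j *\<^sub>R w (N - j) n b) \<le> K j * A n powr (real N / 2)"
    by metis
  have "norm (V N n) \<le> (\<Sum>j=1..N. real (N choose j) * K j) * A n powr (real N / 2)" for n
  proof -
    have "norm (V N n) \<le> (\<Sum>j=1..N. real (N choose j) * (K j * A n powr (real N / 2)))"
      unfolding V_def
      by (rule order_trans[OF norm_sum sum_mono]) (simp add: K mult_left_mono)
    then show ?thesis
      by (simp add: sum_distrib_right mult.assoc)
  qed
  moreover have "(\<Sum>j=1..N. real (N choose j) * K j) \<ge> 0"
    using K by (intro sum_nonneg) auto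
  ultimately show ?thesis by blast
qed

lemma w_diff_bound_0: "w_diff_bound 0 H \<longleftrightarrow> H \<ge> 0 \<and> (\<forall>n a. norm (w 0 n a - w 0 n 0) \<le> H * A n powr (1/2) * lam a)"
  by (simp add: w_diff_bound_def)

lemma w_0_difference: "norm (w 0 n a - w 0 n 0) \<le> C1 * norm e * Qs n * lam a"
proof -
  have "norm (w 0 n a - w 0 n 0) \<le> (\<Sum>k<n. C1 * q k * norm e * lam a)"
    unfolding w0 sum_subtractf[symmetric] by (rule order_trans[OF norm_sum sum_mono]) (rule T_norm_diff0)
  also have "\<dots> \<le> (\<Sum>k\<le>n. C1 * q k * norm e * lam a)"
    using C1_nonneg q_nonneg lam_nonneg by (intro sum_mono2) auto
  also have "\<dots> = C1 * norm e * Qs n * lam a"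
    by (simp add: Qs_def sum_distrib_left sum_distrib_right mult_ac)
  finally show ?thesis .
qed

lemma V_difference_bound:
  assumes K: "K \<ge> 0" "\<And>n. norm (V N n) \<le> K * A n powr (real N / 2)"
  shows "norm (\<Sum>l=1..n. T l a (V N (n - l)) - T l 0 (V N (n - l))) \<le> C1 * K * lam a * A n powr (real N / 2) * Qs n"
proof -
  have V_back: "norm (V N (n - l)) \<le> K * A n powr (real N / 2)" for l
    using K(2)[of "n - l"] A_powr_mono[of "real N / 2" "n - l" n] K(1)
    by (meson diff_le_self divide_nonneg_nonneg mult_left_mono of_nat_0_le_iff order_trans zero_le_numeral)
  have "norm (\<Sum>l=1..n. T l a (V N (n - l)) - T l 0 (V N (n - l)))
      \<le> (\<Sum>l=1..n. C1 * q l * (K * A n powr (real N / 2)) * lam a)"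
  proof (rule order_trans[OF norm_sum sum_mono])
    fix l
    have "C1 * q l * norm (V N (n - l)) * lam a \<le> C1 * q l * (K * A n powr (real N / 2)) * lam a"
      using C1_nonneg q_nonneg lam_nonneg by (intro mult_left_mono mult_right_mono V_back) auto
    then show "norm (T l a (V N (n - l)) - T l 0 (V N (n - l))) \<le> C1 * q l * (K * A n powr (real N / 2)) * lam a"
      using T_norm_diff0 order_trans by blast
  qed
  also have "\<dots> \<le> (\<Sum>l\<le>n. C1 * q l * (K * A n powr (real N / 2)) * lam a)"
    using C1_nonneg q_nonneg lam_nonneg K by (intro sum_mono2) auto
  also have "\<dots> = C1 * K * lam a * A n powr (real N / 2) * Qs n"
    by (simp add: Qs_def sum_distrib_left sum_distrib_right mult_ac)
  finally show ?thesis .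
qed

text \<open>The two bounds must be proved together: at level N both use the estimate of V, and this
  uses the difference bound at level N - 1 to recover the half power lost by the linear
  term.\<close>

lemma w_bounds: "(\<exists>G. w_bound N G) \<and> (\<exists>H. w_diff_bound N H)"
proof (induction N rule: less_induct)
  case (less N)
  obtain Kq where Kq: "Kq \<ge> 0" "\<And>n. Qs n \<le> Kq * A n powr (1/2)"
    using Qs_le by blast
  show ?case
  proof (cases "N = 0")
    case True
    have "norm (w 0 n a) \<le> C1 * norm e * A n" for n a
    proof -
      have "norm (w 0 n a) \<le> (\<Sum>k<n. C1 * p k * norm e)"
        unfolding w0 by (rule order_trans[OF norm_sum sum_mono]) (rule T_bound)
      also have "\<dots> \<le> (\<Sum>k\<le>n. C1 * p k * norm e)"
        using C1_nonneg p_pos by (intro sum_mono2) (auto intro!: mult_nonneg_nonneg less_imp_le[OF p_pos])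
      also have "\<dots> = C1 * norm e * A n"
        by (simp add: A_eq sum_distrib_left sum_distrib_right mult_ac)
      finally show ?thesis .
    qed
    then have "w_bound 0 (C1 * norm e)"
      using C1_nonneg A_pos by (simp add: w_bound_def less_imp_le)
    moreover have "w_diff_bound 0 (C1 * norm e * Kq)"
      unfolding w_diff_bound_0
    proof (intro conjI allI)
      show "0 \<le> C1 * norm e * Kq" using C1_nonneg Kq by simp
      fix n a
      have "C1 * norm e * Qs n * lam a \<le> C1 * norm e * (Kq * A n powr (1/2)) * lam a"
        using C1_nonneg lam_nonneg Kq by (intro mult_left_mono mult_right_mono) auto
      then show "norm (w 0 n a - w 0 n 0) \<le> C1 * norm e * Kq * A n powr (1/2) * lam a"
        using w_0_difference[of n a] by (simp only: mult_ac)
    qed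
    ultimately show ?thesis using True by blast
  next
    case False
    then have N: "N > 0" by simp
    have IH: "\<forall>M<N. \<exists>G. w_bound M G" "\<forall>M<N. \<exists>H. w_diff_bound M H"
      using less by blast+
    obtain K where K: "K \<ge> 0" "\<And>n. norm (V N n) \<le> K * A n powr (real N / 2)"
      using V_bound[OF N IH] by blast
    obtain KU where KU: "KU \<ge> 0" "\<And>n a. norm (U N n a) \<le> KU * Qs n * A n powr ((real N + 1) / 2)"
      using U_bound[OF IH(1)] by blast
    have V_back: "norm (V N (n - l)) \<le> K * A n powr (real N / 2)" for n l
      using K(2)[of "n - l"] A_powr_mono[of "real N / 2" "n - l" n] K(1)
      by (meson diff_le_self divide_nonneg_nonneg mult_left_mono of_nat_0_le_iff order_trans zero_le_numeral)
    have powr_half: "A n powr (1/2) * A n powr x = A n powr (x + 1/2)" for n x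
      by (simp add: powr_add)
    have KU': "norm (U N n a) \<le> KU * Kq * A n powr (real N / 2 + 1)" for n a
    proof -
      have "norm (U N n a) \<le> KU * (Kq * A n powr (1/2)) * A n powr ((real N + 1) / 2)"
        using KU(2)[of n a] Kq(2)[of n] KU(1) by (meson mult_left_mono mult_right_mono order_trans powr_ge_zero)
      also have "\<dots> = KU * Kq * (A n powr (1/2) * A n powr ((real N + 1) / 2))"
        by simp
      also have "A n powr (1/2) * A n powr ((real N + 1) / 2) = A n powr (real N / 2 + 1)"
        unfolding powr_half by (simp add: field_simps)
      finally show ?thesis .
    qed
    have "norm (w N n a) \<le> (C1 * K + KU * Kq) * A n powr (real N / 2 + 1)" for n a
    proof -
      have "norm (\<Sum>l=1..n. T l a (V N (n - l))) \<le> (\<Sum>l=1..n. C1 * p l * (K * A n powr (real N / 2)))"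
      proof (rule order_trans[OF norm_sum sum_mono])
        fix l
        have "C1 * p l * norm (V N (n - l)) \<le> C1 * p l * (K * A n powr (real N / 2))"
          using C1_nonneg p_pos[of l] by (intro mult_left_mono V_back) auto
        then show "norm (T l a (V N (n - l))) \<le> C1 * p l * (K * A n powr (real N / 2))"
          using T_bound order_trans by blast
      qed
      also have "\<dots> \<le> (\<Sum>l\<le>n. C1 * p l * (K * A n powr (real N / 2)))"
        using C1_nonneg K by (intro sum_mono2) (auto intro!: mult_nonneg_nonneg less_imp_le[OF p_pos])
      also have "\<dots> = C1 * K * A n powr (real N / 2 + 1)"
        using A_pos[of n] by (simp add: powr_add A_eq sum_distrib_left sum_distrib_right mult_ac)
      finally have "norm (\<Sum>l=1..n. T l a (V N (n - l))) \<le> C1 * K * A n powr (real N / 2 + 1)" .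
      with KU'[of n a] norm_triangle_ineq[of "\<Sum>l=1..n. T l a (V N (n - l))" "U N n a"]
      show ?thesis
        unfolding w_decomposition[OF N IH(1)] by (simp add: distrib_right)
    qed
    then have 1: "w_bound N (C1 * K + KU * Kq)"
      using C1_nonneg K KU Kq by (simp add: w_bound_def)
    from IH(1) have "\<forall>M. \<exists>G. M < N \<longrightarrow> w_bound M G" by blast
    then obtain G where G: "\<And>M. M < N \<Longrightarrow> w_bound M (G M)" by metis
    define c where "c = (\<lambda>j. real (N choose j) * (\<beta>1 ^ (j - 1) * \<beta>lam * C1 * suminf r * G (N - j)
        * A 0 powr (real (N - j) / 2 + 1 - (real N + 1) / 2)))"
    have suminf_r: "suminf r \<ge> 0"
      using r_nonneg r_summable by (rule suminf_nonneg[rotated])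
    have c: "c j \<ge> 0" if "j \<in> {1..N}" for j
      unfolding c_def using that \<beta>1_nonneg \<beta>lam_nonneg C1_nonneg w_boundD(1)[OF G[of "N - j"]] suminf_r
      by (intro mult_nonneg_nonneg) auto
    have "norm (w N n a - w N n 0) \<le> (C1 * K * Kq + (\<Sum>j=1..N. c j)) * A n powr ((real N + 1) / 2) * lam a" for n a
    proof -
      \<comment> \<open>In the V part the end point a produces one difference of operators. U
        already contains a difference in b, so it yields double differences.\<close>
      have eq: "w N n a - w N n 0 = (\<Sum>l=1..n. T l a (V N (n - l)) - T l 0 (V N (n - l)))
          + (\<Sum>j=1..N. real (N choose j) *\<^sub>R UD N j n a)"
        unfolding w_decomposition[OF N IH(1)] U_difference[OF IH(1), symmetric] sum_subtractf by simp
      have "norm (\<Sum>l=1..n. T l a (V N (n - l)) - T l 0 (V N (n - l)))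
          \<le> C1 * K * lam a * A n powr (real N / 2) * Qs n"
        by (rule V_difference_bound[OF K])
      also have "\<dots> \<le> C1 * K * lam a * A n powr (real N / 2) * (Kq * A n powr (1/2))"
        using C1_nonneg lam_nonneg K by (intro mult_left_mono Kq) auto
      also have "\<dots> = C1 * K * Kq * lam a * (A n powr (1/2) * A n powr (real N / 2))"
        by simp
      also have "A n powr (1/2) * A n powr (real N / 2) = A n powr ((real N + 1) / 2)"
        unfolding powr_half by (simp add: field_simps)
      finally have 1: "norm (\<Sum>l=1..n. T l a (V N (n - l)) - T l 0 (V N (n - l)))
          \<le> C1 * K * Kq * lam a * A n powr ((real N + 1) / 2)" .
      have "norm (\<Sum>j=1..N. real (N choose j) *\<^sub>R UD N j n a) \<le> (\<Sum>j=1..N. c j * A n powr ((real N + 1) / 2) * lam a)"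
      proof (rule order_trans[OF norm_sum sum_mono])
        fix j assume j: "j \<in> {1..N}"
        let ?d = "\<beta>1 ^ (j - 1) * \<beta>lam * C1 * suminf r * G (N - j)"
        have G': "w_bound (N - j) (G (N - j))" using G j by auto
        have "norm (UD N j n a) \<le> ?d * A n powr (real (N - j) / 2 + 1) * lam a"
          using UD_bound[OF G'] j by simp
        also have "\<dots> \<le> ?d * (A 0 powr (real (N - j) / 2 + 1 - (real N + 1) / 2) * A n powr ((real N + 1) / 2)) * lam a"
          using j \<beta>1_nonneg \<beta>lam_nonneg C1_nonneg w_boundD(1)[OF G'] suminf_r lam_nonneg
          by (intro mult_left_mono mult_right_mono A_power_le mult_nonneg_nonneg) (auto simp: of_nat_diff field_simps)
        finally have "real (N choose j) * norm (UD N j n a) \<le> real (N choose j) *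
            (?d * (A 0 powr (real (N - j) / 2 + 1 - (real N + 1) / 2) * A n powr ((real N + 1) / 2)) * lam a)"
          by (intro mult_left_mono) auto
        then show "norm (real (N choose j) *\<^sub>R UD N j n a) \<le> c j * A n powr ((real N + 1) / 2) * lam a"
          unfolding norm_scaleR c_def by (simp only: mult_ac abs_of_nat)
      qed
      with 1 norm_triangle_ineq[of "\<Sum>l=1..n. T l a (V N (n - l)) - T l 0 (V N (n - l))"
          "\<Sum>j=1..N. real (N choose j) *\<^sub>R UD N j n a"]
      show ?thesis
        unfolding eq by (simp add: sum_distrib_right[symmetric] algebra_simps)
    qed
    moreover have "(\<Sum>j=1..N. c j) \<ge> 0"
      using c by (rule sum_nonneg)
    ultimately have 2: "w_diff_bound N (C1 * K * Kq + (\<Sum>j=1..N. c j))"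
      using C1_nonneg K Kq by (simp add: w_diff_bound_def)
    from 1 2 show ?thesis by blast
  qed
qed

text \<open>Because \<open>E (T l c e)\<close> is the probability of S(l) = c, this is the centred
  term at lag l of the variance series; the factor 2 in \<open>\<sigma>2\<close> below accounts for
  negative lags.\<close>

definition "\<rho> l = (\<Sum>\<^sub>\<infinity>a. \<beta> a * (\<Sum>\<^sub>\<infinity>b. \<beta> b * E (DD l a b e)))"

definition "\<sigma>2 = (\<Sum>\<^sub>\<infinity>b. (\<beta> b)\<^sup>2) + 2 * (\<Sum>l. \<rho> (Suc l))"

lemma tends_scaled_shift:
  assumes X: "tends (\<lambda>n. (1 / A n powr s) *\<^sub>R X n) c"
  shows "tends (\<lambda>n. (1 / A n powr s) *\<^sub>R X (n - l)) c"
proof -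
  define t where "t = (\<lambda>n. A (n - l) powr s / A n powr s)"
  have "(\<lambda>n. (A (n - l) / A n) powr s) \<longlonglongrightarrow> 1 powr s"
    by (intro tendsto_powr A_shift_back tendsto_const) simp
  then have t: "t \<longlonglongrightarrow> 1"
    using A_pos by (simp add: t_def powr_divide less_imp_le)
  have tpos: "t n \<ge> 0" for n by (simp add: t_def)
  have "(\<lambda>n. sn ((1 / A (n - l) powr s) *\<^sub>R X (n - l) - c *\<^sub>R e)) \<longlonglongrightarrow> 0"
    by (rule filterlim_compose[OF X[unfolded tends_def] filterlim_minus_const_nat_at_top])
  then have lim: "(\<lambda>n. t n * sn ((1 / A (n - l) powr s) *\<^sub>R X (n - l) - c *\<^sub>R e) + \<bar>t n - 1\<bar> * \<bar>c\<bar> * sn e) \<longlonglongrightarrow> 1 * 0 + \<bar>1 - 1\<bar> * \<bar>c\<bar> * sn e"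
    by (intro tendsto_intros t)
  show ?thesis
    unfolding tends_def
  proof (rule Lim_null_comparison)
    show "(\<lambda>n. t n * sn ((1 / A (n - l) powr s) *\<^sub>R X (n - l) - c *\<^sub>R e) + \<bar>t n - 1\<bar> * \<bar>c\<bar> * sn e) \<longlonglongrightarrow> 0"
      using lim by simp
    show "\<forall>\<^sub>F n in sequentially. norm (sn ((1 / A n powr s) *\<^sub>R X (n - l) - c *\<^sub>R e))
        \<le> t n * sn ((1 / A (n - l) powr s) *\<^sub>R X (n - l) - c *\<^sub>R e) + \<bar>t n - 1\<bar> * \<bar>c\<bar> * sn e"
    proof (intro always_eventually allI)
      fix n
      have "(1 / A n powr s) *\<^sub>R X (n - l) - c *\<^sub>R e
          = t n *\<^sub>R ((1 / A (n - l) powr s) *\<^sub>R X (n - l) - c *\<^sub>R e) + ((t n - 1) * c) *\<^sub>R e"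
        using A_pos[of "n - l"] by (simp add: t_def scaleR_diff_right algebra_simps)
      then show "norm (sn ((1 / A n powr s) *\<^sub>R X (n - l) - c *\<^sub>R e))
        \<le> t n * sn ((1 / A (n - l) powr s) *\<^sub>R X (n - l) - c *\<^sub>R e) + \<bar>t n - 1\<bar> * \<bar>c\<bar> * sn e"
        using sn_triangle[of "t n *\<^sub>R ((1 / A (n - l) powr s) *\<^sub>R X (n - l) - c *\<^sub>R e)" "((t n - 1) * c) *\<^sub>R e"]
          tpos[of n] sn_nonneg by (simp add: sn_scale abs_mult)
    qed
  qed
qed

text \<open>Moving the end point from 0 to b changes w by a lower order, so the limit is the same
  for every b.\<close>

lemma tends_w_all:
  assumes X: "tends (\<lambda>n. (1 / A n powr (real N / 2 + 1)) *\<^sub>R w N n 0) c"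
  shows "tends (\<lambda>n. (1 / A n powr (real N / 2 + 1)) *\<^sub>R w N n b) c"
proof -
  obtain H where H: "w_diff_bound N H" using w_bounds by blast
  show ?thesis
  proof (rule tends_perturb[OF X], rule Lim_null_comparison)
  show "(\<lambda>n. (Cn * H * lam b) * A n powr ((real N + 1) / 2) / A n powr (real N / 2 + 1)) \<longlonglongrightarrow> 0"
    by (intro A_powr_null) (simp add: field_simps)
  show "\<forall>\<^sub>F n in sequentially. norm (sn ((1 / A n powr (real N / 2 + 1)) *\<^sub>R w N n b - (1 / A n powr (real N / 2 + 1)) *\<^sub>R w N n 0))
      \<le> (Cn * H * lam b) * A n powr ((real N + 1) / 2) / A n powr (real N / 2 + 1)"
  proof (intro always_eventually allI)
    fix n
    have "sn (w N n b - w N n 0) \<le> Cn * (H * A n powr ((real N + 1) / 2) * lam b)"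
      using sn_le[of "w N n b - w N n 0"] w_diff_boundD(2)[OF H, of n b] C_nonneg
      by (meson mult_left_mono order_trans)
    then show "norm (sn ((1 / A n powr (real N / 2 + 1)) *\<^sub>R w N n b - (1 / A n powr (real N / 2 + 1)) *\<^sub>R w N n 0))
      \<le> (Cn * H * lam b) * A n powr ((real N + 1) / 2) / A n powr (real N / 2 + 1)"
      unfolding scaleR_diff_right[symmetric] sn_scale using sn_nonneg
      by (simp add: divide_right_mono mult_ac)
  qed
  qed
qed

lemma E_DD_tendsto:
  assumes "tends X c"
  shows "(\<lambda>n. E (DD l a b (X n))) \<longlonglongrightarrow> c * E (DD l a b e)"
proof -
  have "(\<lambda>n. E (DD l a b (X n)) - c * E (DD l a b e)) \<longlonglongrightarrow> 0"
  proof (rule Lim_null_comparison)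
    show "(\<lambda>n. 4 * sn (X n - c *\<^sub>R e)) \<longlonglongrightarrow> 0"
      using tendsto_mult_left[OF assms[unfolded tends_def], of 4] by simp
    have "E (DD l a b (X n)) - c * E (DD l a b e) = E (DD l a b (X n - c *\<^sub>R e))" for n
      by (simp add: linear_diff[OF DD_linear] linear_scale[OF DD_linear] linear_diff[OF E_linear] linear_scale[OF E_linear])
    then show "\<forall>\<^sub>F n in sequentially. norm (E (DD l a b (X n)) - c * E (DD l a b e)) \<le> 4 * sn (X n - c *\<^sub>R e)"
      using E_DD by simp
  qed
  then show ?thesis by (simp add: LIM_zero_iff)
qed

lemma E_DD_bound: "\<bar>E (DD l a b u)\<bar> \<le> Cn * C1 * norm u * r l * lam a * lam b"
proof -
  have "\<bar>E (DD l a b u)\<bar> \<le> Cn * norm (DD l a b u)"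
    by (rule E_norm)
  also have "\<dots> \<le> Cn * (C1 * lam a * r l * norm u * lam b)"
    by (intro mult_left_mono DD_norm C_nonneg)
  finally show ?thesis by (simp add: mult_ac)
qed

text \<open>Dominated convergence in three layers, over b, a and l, with dominating factors
  |\<beta>(b)| lam(b), |\<beta>(a)| lam(a) and r(l). For fixed l the shift from n to n - l is
  invisible in the limit, and every w is replaced by c times the constant function.\<close>

lemma interaction_limit:
  assumes X: "tends (\<lambda>n. (1 / A n powr (real R / 2 + 1)) *\<^sub>R w R n 0) c"
  shows "summable (\<lambda>l. norm (\<rho> (Suc l)))"
    "(\<lambda>n. (\<Sum>l=1..n. \<Sum>\<^sub>\<infinity>a. \<beta> a * (\<Sum>\<^sub>\<infinity>b. \<beta> b * E (DD l a b (w R (n - l) b)))) / A n powr (real R / 2 + 1))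
      \<longlonglongrightarrow> c * (\<Sum>l. \<rho> (Suc l))"
proof -
  obtain G where G: "w_bound R G" using w_bounds by blast
  let ?s = "real R / 2 + 1"
  define W where "W = (\<lambda>n l b. (1 / A n powr ?s) *\<^sub>R w R (n - l) b)"
  have W_norm: "\<forall>b. norm (W n l b) \<le> G" for n l
    using w_bound_back[OF G, of n l] A_pos[of n] by (simp add: W_def divide_le_eq)
  have W_lim: "tends (\<lambda>n. W n l b) c" for l b
    unfolding W_def by (rule tends_scaled_shift[where X="\<lambda>n. w R n b", OF tends_w_all[OF X]])
  define X where "X = (\<lambda>u l a. \<Sum>\<^sub>\<infinity>b. \<beta> b * E (DD l a b (u b)))"
  define Z where "Z = (\<lambda>u l. \<Sum>\<^sub>\<infinity>a. \<beta> a * X u l a)"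
  have X_term: "\<bar>E (DD l a b (u b))\<bar> \<le> Cn * C1 * K * r l * lam a * lam b" if "\<forall>b. norm (u b) \<le> K" for u l a b K
  proof -
    have "\<bar>E (DD l a b (u b))\<bar> \<le> Cn * C1 * norm (u b) * r l * lam a * lam b"
      by (rule E_DD_bound)
    also have "\<dots> \<le> Cn * C1 * K * r l * lam a * lam b"
      by (intro mult_right_mono mult_left_mono mult_nonneg_nonneg that[rule_format] C_nonneg C1_nonneg r_nonneg lam_nonneg)
    finally show ?thesis .
  qed
  have X_bound: "\<bar>X u l a\<bar> \<le> \<beta>lam * (Cn * C1 * K * r l) * lam a" if "\<forall>b. norm (u b) \<le> K" for u l a K
  proof -
    have "norm (\<Sum>\<^sub>\<infinity>b. \<beta> b ^ 1 *\<^sub>R E (DD l a b (u b))) \<le> \<beta>1 ^ (1 - 1) * \<beta>lam * (Cn * C1 * K * r l * lam a)"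
      using X_term[OF that] by (intro \<beta>_lam_sum(2)) auto
    then show ?thesis by (simp add: X_def mult_ac)
  qed
  have Z_bound: "\<bar>Z u l\<bar> \<le> \<beta>lam * (\<beta>lam * (Cn * C1 * K)) * r l" if "\<forall>b. norm (u b) \<le> K" for u l K
  proof -
    have "norm (\<Sum>\<^sub>\<infinity>a. \<beta> a ^ 1 *\<^sub>R X u l a) \<le> \<beta>1 ^ (1 - 1) * \<beta>lam * (\<beta>lam * (Cn * C1 * K * r l))"
      using X_bound[OF that] by (intro \<beta>_lam_sum(2)) auto
    then show ?thesis by (simp add: Z_def mult_ac)
  qed
  have X_lim: "(\<lambda>n. X (W n l) l a) \<longlonglongrightarrow> c * X (\<lambda>_. e) l a" for l a
  proof -
    have "(\<lambda>n. X (W n l) l a) \<longlonglongrightarrow> (\<Sum>\<^sub>\<infinity>b. \<beta> b * (c * E (DD l a b e)))"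
      unfolding X_def
    proof (rule infsum_dominated_tendsto)
      show "(\<lambda>n. \<beta> b * E (DD l a b (W n l b))) \<longlonglongrightarrow> \<beta> b * (c * E (DD l a b e))" for b
        by (intro tendsto_mult_left E_DD_tendsto W_lim)
      show "(\<lambda>b. (Cn * C1 * G * r l * lam a) * (\<bar>\<beta> b\<bar> * lam b)) summable_on UNIV"
        by (intro summable_on_cmult_right \<beta>_lam_summable)
      fix n b
      have "\<bar>\<beta> b\<bar> * \<bar>E (DD l a b (W n l b))\<bar> \<le> \<bar>\<beta> b\<bar> * (Cn * C1 * G * r l * lam a * lam b)"
        by (intro mult_left_mono X_term W_norm) auto
      then show "\<bar>\<beta> b * E (DD l a b (W n l b))\<bar> \<le> (Cn * C1 * G * r l * lam a) * (\<bar>\<beta> b\<bar> * lam b)"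
        by (simp add: abs_mult mult_ac)
    qed
    also have "(\<Sum>\<^sub>\<infinity>b. \<beta> b * (c * E (DD l a b e))) = c * X (\<lambda>_. e) l a"
      unfolding X_def infsum_cmult_right'[symmetric] by (simp add: mult_ac)
    finally show ?thesis .
  qed
  have Z_lim: "(\<lambda>n. Z (W n l) l) \<longlonglongrightarrow> c * Z (\<lambda>_. e) l" for l
  proof -
    have "(\<lambda>n. Z (W n l) l) \<longlonglongrightarrow> (\<Sum>\<^sub>\<infinity>a. \<beta> a * (c * X (\<lambda>_. e) l a))"
      unfolding Z_def
    proof (rule infsum_dominated_tendsto)
      show "(\<lambda>n. \<beta> a * X (W n l) l a) \<longlonglongrightarrow> \<beta> a * (c * X (\<lambda>_. e) l a)" for a
        by (intro tendsto_mult_left X_lim)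
      show "(\<lambda>a. (\<beta>lam * (Cn * C1 * G * r l)) * (\<bar>\<beta> a\<bar> * lam a)) summable_on UNIV"
        by (intro summable_on_cmult_right \<beta>_lam_summable)
      fix n a
      have "\<bar>\<beta> a\<bar> * \<bar>X (W n l) l a\<bar> \<le> \<bar>\<beta> a\<bar> * (\<beta>lam * (Cn * C1 * G * r l) * lam a)"
        by (intro mult_left_mono X_bound W_norm) auto
      then show "\<bar>\<beta> a * X (W n l) l a\<bar> \<le> (\<beta>lam * (Cn * C1 * G * r l)) * (\<bar>\<beta> a\<bar> * lam a)"
        by (simp add: abs_mult mult_ac)
    qed
    also have "(\<Sum>\<^sub>\<infinity>a. \<beta> a * (c * X (\<lambda>_. e) l a)) = c * Z (\<lambda>_. e) l"
      unfolding Z_def infsum_cmult_right'[symmetric] by (simp add: mult_ac)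
    finally show ?thesis .
  qed
  have Z_e: "Z (\<lambda>_. e) l = \<rho> l" for l
    by (simp add: Z_def X_def \<rho>_def)
  have r_Suc: "summable (\<lambda>k. M * r (Suc k))" for M
    using r_summable by (intro summable_mult) (simp add: summable_Suc_iff)
  show abs: "summable (\<lambda>l. norm (\<rho> (Suc l)))"
    by (rule summable_comparison_test'[OF r_Suc[of "\<beta>lam * (\<beta>lam * (Cn * C1 * norm e))"], of 0])
      (use Z_bound[of "\<lambda>_. e" "norm e"] in \<open>simp add: Z_e\<close>)
  \<comment> \<open>The truncated sum is extended by zeros to a series over all lags so that
    Tannery's theorem applies; k stands for the lag k + 1.\<close>
  have "(\<lambda>n. \<Sum>k. if k < n then Z (W n (Suc k)) (Suc k) else 0) \<longlonglongrightarrow> (\<Sum>k. c * \<rho> (Suc k))"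
  proof (rule conjunct2[OF conjunct2[OF tannerys_theorem]])
    show "summable (\<lambda>k. \<beta>lam * (\<beta>lam * (Cn * C1 * G)) * r (Suc k))"
      by (rule r_Suc)
    show "(\<lambda>n. if k < n then Z (W n (Suc k)) (Suc k) else 0) \<longlonglongrightarrow> c * \<rho> (Suc k)" for k
      using Z_lim[of "Suc k"] unfolding Z_e
    proof (rule Lim_transform_eventually)
      show "\<forall>\<^sub>F n in sequentially. Z (W n (Suc k)) (Suc k) = (if k < n then Z (W n (Suc k)) (Suc k) else 0)"
        using eventually_gt_at_top[of k] by eventually_elim simp
    qed
    have "0 \<le> \<beta>lam * (\<beta>lam * (Cn * C1 * G)) * r (Suc k)" for k
      using \<beta>lam_nonneg C_nonneg C1_nonneg w_boundD(1)[OF G] r_nonneg by simp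
    then show "\<forall>\<^sub>F (k, n) in sequentially \<times>\<^sub>F sequentially.
        norm (if k < n then Z (W n (Suc k)) (Suc k) else 0) \<le> \<beta>lam * (\<beta>lam * (Cn * C1 * G)) * r (Suc k)"
      using Z_bound[OF W_norm] by (intro always_eventually) auto
  qed simp
  moreover have "(\<Sum>k. if k < n then Z (W n (Suc k)) (Suc k) else 0)
      = (\<Sum>l=1..n. \<Sum>\<^sub>\<infinity>a. \<beta> a * (\<Sum>\<^sub>\<infinity>b. \<beta> b * E (DD l a b (w R (n - l) b)))) / A n powr ?s" for n
  proof -
    have sc: "Z (W n l) l = (\<Sum>\<^sub>\<infinity>a. \<beta> a * (\<Sum>\<^sub>\<infinity>b. \<beta> b * E (DD l a b (w R (n - l) b)))) / A n powr ?s" for l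
    proof -
      have "X (W n l) l a = (1 / A n powr ?s) * (\<Sum>\<^sub>\<infinity>b. \<beta> b * E (DD l a b (w R (n - l) b)))" for a
        unfolding X_def W_def infsum_cmult_right'[symmetric]
        by (intro infsum_cong) (simp add: linear_scale[OF DD_linear] linear_scale[OF E_linear])
      then have "Z (W n l) l = (\<Sum>\<^sub>\<infinity>a. (1 / A n powr ?s) * (\<beta> a * (\<Sum>\<^sub>\<infinity>b. \<beta> b * E (DD l a b (w R (n - l) b)))))"
        unfolding Z_def by (intro infsum_cong) simp
      then show ?thesis
        unfolding infsum_cmult_right' by simp
    qed
    have "(\<Sum>k. if k < n then Z (W n (Suc k)) (Suc k) else 0) = (\<Sum>k<n. if k < n then Z (W n (Suc k)) (Suc k) else 0)"
      by (rule suminf_finite) auto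
    also have "\<dots> = (\<Sum>l=1..n. Z (W n l) l)"
      by (simp add: sum.atLeast1_atMost_eq)
    finally show ?thesis
      by (simp add: sc sum_divide_distrib)
  qed
  moreover have "(\<Sum>k. c * \<rho> (Suc k)) = c * (\<Sum>k. \<rho> (Suc k))"
    by (rule suminf_mult[OF summable_norm_cancel[OF abs]])
  ultimately show "(\<lambda>n. (\<Sum>l=1..n. \<Sum>\<^sub>\<infinity>a. \<beta> a * (\<Sum>\<^sub>\<infinity>b. \<beta> b * E (DD l a b (w R (n - l) b)))) / A n powr ?s)
      \<longlonglongrightarrow> c * (\<Sum>l. \<rho> (Suc l))"
    by simp
qed

lemma E_\<beta>_sum_le:
  assumes "j \<ge> 1" "\<And>b. norm (X b) \<le> K * lam b"
  shows "\<bar>E (\<Sum>\<^sub>\<infinity>b. \<beta> b ^ j *\<^sub>R X b)\<bar> \<le> Cn * (\<beta>1 ^ (j - 1) * \<beta>lam * K)"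
  using E_norm[of "\<Sum>\<^sub>\<infinity>b. \<beta> b ^ j *\<^sub>R X b"] \<beta>_lam_sum(2)[OF assms] C_nonneg
  by (meson mult_left_mono order_trans)

lemma E_infsum:
  assumes "(\<lambda>b. \<beta> b ^ j *\<^sub>R X b) summable_on UNIV"
  shows "E (\<Sum>\<^sub>\<infinity>b. \<beta> b ^ j *\<^sub>R X b) = (\<Sum>\<^sub>\<infinity>b. \<beta> b ^ j * E (X b))"
    "(\<lambda>b. \<beta> b ^ j * E (X b)) summable_on UNIV"
  using infsum_of_bounded_linear[OF E_lin assms] summable_on_bounded_linear[OF E_lin assms]
  by (simp_all add: linear_scale[OF E_linear])

lemma higher_order_null:
  assumes j: "3 \<le> j" "j \<le> N"
  shows "(\<lambda>n. E (\<Sum>\<^sub>\<infinity>b. \<beta> b ^ j *\<^sub>R w (N - j) n b) / A n powr (real N / 2)) \<longlonglongrightarrow> 0"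
proof -
  obtain G where G: "w_bound (N - j) G" using w_bounds by blast
  define K where "K = Cn * (\<beta>1 ^ (j - 1) * \<beta>1 * G)"
  have lim: "(\<lambda>n. K * A n powr (real (N - j) / 2 + 1) / A n powr (real N / 2)) \<longlonglongrightarrow> 0"
    using j by (intro A_powr_null) (simp add: of_nat_diff field_simps)
  show ?thesis
  proof (rule Lim_null_comparison[OF _ lim], intro always_eventually allI)
    fix n
    have "\<bar>E (\<Sum>\<^sub>\<infinity>b. \<beta> b ^ j *\<^sub>R w (N - j) n b)\<bar> \<le> Cn * norm (\<Sum>\<^sub>\<infinity>b. \<beta> b ^ j *\<^sub>R w (N - j) n b)"
      by (rule E_norm)
    also have "\<dots> \<le> Cn * (\<beta>1 ^ (j - 1) * \<beta>1 * (G * A n powr (real (N - j) / 2 + 1)))"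
      using j by (intro mult_left_mono \<beta>_sum(2) w_boundD(2)[OF G] C_nonneg) auto
    finally show "norm (E (\<Sum>\<^sub>\<infinity>b. \<beta> b ^ j *\<^sub>R w (N - j) n b) / A n powr (real N / 2))
        \<le> K * A n powr (real (N - j) / 2 + 1) / A n powr (real N / 2)"
      by (simp add: K_def abs_divide divide_right_mono mult_ac)
  qed
qed

lemma square_term_limit:
  assumes X: "tends (\<lambda>n. (1 / A n powr (real R / 2 + 1)) *\<^sub>R w R n 0) c"
  shows "(\<lambda>n. E (\<Sum>\<^sub>\<infinity>b. \<beta> b ^ 2 *\<^sub>R w R n b) / A n powr (real R / 2 + 1)) \<longlonglongrightarrow> c * (\<Sum>\<^sub>\<infinity>b. (\<beta> b)\<^sup>2)"
proof -
  obtain G H where G: "w_bound R G" and H: "w_diff_bound R H" using w_bounds by blast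
  let ?s = "real R / 2 + 1"
  define K where "K = Cn * (\<beta>1 * \<beta>lam * H)"
  have null: "(\<lambda>n. E (\<Sum>\<^sub>\<infinity>b. \<beta> b ^ 2 *\<^sub>R (w R n b - w R n 0)) / A n powr ?s) \<longlonglongrightarrow> 0"
  proof (rule Lim_null_comparison)
    show "(\<lambda>n. K * A n powr ((real R + 1) / 2) / A n powr ?s) \<longlonglongrightarrow> 0"
      by (intro A_powr_null) (simp add: field_simps)
    show "\<forall>\<^sub>F n in sequentially. norm (E (\<Sum>\<^sub>\<infinity>b. \<beta> b ^ 2 *\<^sub>R (w R n b - w R n 0)) / A n powr ?s)
        \<le> K * A n powr ((real R + 1) / 2) / A n powr ?s"
    proof (intro always_eventually allI)
      fix n
      show "norm (E (\<Sum>\<^sub>\<infinity>b. \<beta> b ^ 2 *\<^sub>R (w R n b - w R n 0)) / A n powr ?s)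
        \<le> K * A n powr ((real R + 1) / 2) / A n powr ?s"
        using E_\<beta>_sum_le[of 2 "\<lambda>b. w R n b - w R n 0" "H * A n powr ((real R + 1) / 2)"] w_diff_boundD(2)[OF H, of n]
        by (simp add: K_def abs_divide divide_right_mono mult_ac)
    qed
  qed
  have "(\<lambda>n. E ((1 / A n powr ?s) *\<^sub>R w R n 0) * (\<Sum>\<^sub>\<infinity>b. (\<beta> b)\<^sup>2)
      + E (\<Sum>\<^sub>\<infinity>b. \<beta> b ^ 2 *\<^sub>R (w R n b - w R n 0)) / A n powr ?s) \<longlonglongrightarrow> c * (\<Sum>\<^sub>\<infinity>b. (\<beta> b)\<^sup>2) + 0"
    by (intro tendsto_add tendsto_mult tendsto_const tends_E X null)
  moreover have "E ((1 / A n powr ?s) *\<^sub>R w R n 0) * (\<Sum>\<^sub>\<infinity>b. (\<beta> b)\<^sup>2)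
      + E (\<Sum>\<^sub>\<infinity>b. \<beta> b ^ 2 *\<^sub>R (w R n b - w R n 0)) / A n powr ?s
      = E (\<Sum>\<^sub>\<infinity>b. \<beta> b ^ 2 *\<^sub>R w R n b) / A n powr ?s" for n
  proof -
    have s1: "(\<lambda>b. \<beta> b ^ 2 *\<^sub>R w R n 0) summable_on UNIV"
      by (rule \<beta>_sum(1)[where K="norm (w R n 0)"]) auto
    have s2: "(\<lambda>b. \<beta> b ^ 2 *\<^sub>R (w R n b - w R n 0)) summable_on UNIV"
      by (rule \<beta>_lam_sum(1)[where K="H * A n powr ((real R + 1) / 2)"]) (use w_diff_boundD(2)[OF H] in auto)
    have "(\<Sum>\<^sub>\<infinity>b. \<beta> b ^ 2 *\<^sub>R w R n b) = (\<Sum>\<^sub>\<infinity>b. \<beta> b ^ 2 *\<^sub>R w R n 0 + \<beta> b ^ 2 *\<^sub>R (w R n b - w R n 0))"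
      by (simp add: scaleR_diff_right)
    also have "\<dots> = (\<Sum>\<^sub>\<infinity>b. \<beta> b ^ 2 *\<^sub>R w R n 0) + (\<Sum>\<^sub>\<infinity>b. \<beta> b ^ 2 *\<^sub>R (w R n b - w R n 0))"
      by (rule infsum_add[OF s1 s2])
    finally have "E (\<Sum>\<^sub>\<infinity>b. \<beta> b ^ 2 *\<^sub>R w R n b)
        = (\<Sum>\<^sub>\<infinity>b. (\<beta> b)\<^sup>2 * E (w R n 0)) + E (\<Sum>\<^sub>\<infinity>b. \<beta> b ^ 2 *\<^sub>R (w R n b - w R n 0))"
      by (simp add: linear_add[OF E_linear] E_infsum(1)[OF s1])
    then show ?thesis
      by (simp add: linear_scale[OF E_linear] infsum_cmult_left' add_divide_distrib)
  qed
  ultimately show ?thesis by simp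
qed

text \<open>After centring, the difference of \<open>w (Suc R)\<close> is decomposed once more. The
  only part of order A^(R/2 + 1) is the double difference with multiplicity 1: two successive
  visits, each counted once, interacting through DD. Its binomial coefficient gives the factor R +
  1.\<close>

lemma linear_term_limit:
  assumes X: "tends (\<lambda>n. (1 / A n powr (real R / 2 + 1)) *\<^sub>R w R n 0) c"
  shows "(\<lambda>n. E (\<Sum>\<^sub>\<infinity>b. \<beta> b *\<^sub>R w (Suc R) n b) / A n powr (real R / 2 + 1))
    \<longlonglongrightarrow> real (Suc R) * (c * (\<Sum>l. \<rho> (Suc l)))"
proof -
  let ?s = "real R / 2 + 1"
  define M where "M = Suc R"
  have IH: "\<forall>k<M. \<exists>G. w_bound k G" "\<forall>k<M. \<exists>H. w_diff_bound k H"
    using w_bounds by blast+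
  obtain K where K: "K \<ge> 0" "\<And>n. norm (V M n) \<le> K * A n powr (real M / 2)"
    using V_bound[OF _ IH] by (auto simp: M_def)
  obtain G where G: "\<And>k. w_bound k (G k)"
    using w_bounds by metis
  define d where "d = (\<lambda>j. real (M choose j) * (\<beta>1 ^ (j - 1) * \<beta>lam * C1 * suminf r * G (M - j)))"
  \<comment> \<open>All contributions other than \<open>UD M 1\<close>. The V part is o(A^(R/2 + 1))
    by \<open>Qs_null\<close>, and the double differences with j >= 2 have a strictly smaller
    exponent.\<close>
  define rest where "rest = (\<lambda>n a. (\<Sum>l=1..n. T l a (V M (n - l)) - T l 0 (V M (n - l)))
      + (\<Sum>j=2..M. real (M choose j) *\<^sub>R UD M j n a))"
  define Kn where "Kn = (\<lambda>n. C1 * K * A n powr (real M / 2) * Qs n + (\<Sum>j=2..M. d j * A n powr (real (M - j) / 2 + 1)))"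
  have rest_norm: "norm (rest n a) \<le> Kn n * lam a" for n a
  proof -
    have "norm (\<Sum>j=2..M. real (M choose j) *\<^sub>R UD M j n a) \<le> (\<Sum>j=2..M. d j * A n powr (real (M - j) / 2 + 1) * lam a)"
    proof (rule order_trans[OF norm_sum sum_mono])
      fix j assume j: "j \<in> {2..M}"
      have "norm (UD M j n a) \<le> \<beta>1 ^ (j - 1) * \<beta>lam * C1 * suminf r * G (M - j) * A n powr (real (M - j) / 2 + 1) * lam a"
        using j by (intro UD_bound G) auto
      then have "real (M choose j) * norm (UD M j n a) \<le> real (M choose j) *
          (\<beta>1 ^ (j - 1) * \<beta>lam * C1 * suminf r * G (M - j) * A n powr (real (M - j) / 2 + 1) * lam a)"
        by (intro mult_left_mono) auto
      then show "norm (real (M choose j) *\<^sub>R UD M j n a) \<le> d j * A n powr (real (M - j) / 2 + 1) * lam a"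
        by (simp add: d_def mult_ac)
    qed
    moreover have "norm (\<Sum>l=1..n. T l a (V M (n - l)) - T l 0 (V M (n - l))) \<le> C1 * K * lam a * A n powr (real M / 2) * Qs n"
      by (rule V_difference_bound[OF K])
    moreover have "Kn n * lam a = C1 * K * lam a * A n powr (real M / 2) * Qs n
        + (\<Sum>j=2..M. d j * A n powr (real (M - j) / 2 + 1) * lam a)"
      unfolding Kn_def distrib_right sum_distrib_right by (simp only: mult_ac)
    ultimately show ?thesis
      unfolding rest_def by (intro norm_triangle_le) linarith
  qed
  have Kn_lim: "(\<lambda>n. Kn n / A n powr ?s) \<longlonglongrightarrow> 0"
  proof -
    have "(\<lambda>n. C1 * K * (Qs n / A n powr (1/2)) + (\<Sum>j=2..M. d j * A n powr (real (M - j) / 2 + 1) / A n powr ?s))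
      \<longlonglongrightarrow> C1 * K * 0 + (\<Sum>j=2..M. 0)"
      by (intro tendsto_intros Qs_null A_powr_null) (auto simp: M_def of_nat_diff field_simps)
    moreover have "C1 * K * (Qs n / A n powr (1/2)) = C1 * K * A n powr (real M / 2) * Qs n / A n powr ?s" for n
    proof -
      have "A n powr ?s = A n powr (real M / 2) * A n powr (1/2)"
        by (simp add: powr_add[symmetric] M_def field_simps)
      then show ?thesis by simp
    qed
    ultimately show ?thesis
      by (simp add: Kn_def add_divide_distrib sum_divide_distrib)
  qed
  have rest_lim: "(\<lambda>n. E (\<Sum>\<^sub>\<infinity>a. \<beta> a ^ 1 *\<^sub>R rest n a) / A n powr ?s) \<longlonglongrightarrow> 0"
  proof (rule Lim_null_comparison)
    show "(\<lambda>n. Cn * \<beta>lam * (Kn n / A n powr ?s)) \<longlonglongrightarrow> 0"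
      using tendsto_mult_left[OF Kn_lim, of "Cn * \<beta>lam"] by simp
    have "\<bar>E (\<Sum>\<^sub>\<infinity>a. \<beta> a ^ 1 *\<^sub>R rest n a)\<bar> \<le> Cn * (\<beta>1 ^ (1 - 1) * \<beta>lam * Kn n)" for n
      by (rule E_\<beta>_sum_le) (simp_all add: rest_norm)
    then have "\<bar>E (\<Sum>\<^sub>\<infinity>a. \<beta> a ^ 1 *\<^sub>R rest n a)\<bar> / A n powr ?s \<le> Cn * \<beta>lam * Kn n / A n powr ?s" for n
      by (intro divide_right_mono) (simp_all add: mult.assoc)
    then show "\<forall>\<^sub>F n in sequentially. norm (E (\<Sum>\<^sub>\<infinity>a. \<beta> a ^ 1 *\<^sub>R rest n a) / A n powr ?s) \<le> Cn * \<beta>lam * (Kn n / A n powr ?s)"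
      by (simp add: abs_divide)
  qed
  have pair_bound: "\<bar>E (DD l a b (w R (n - l) b))\<bar> \<le> (Cn * C1 * (G R * A n powr ?s) * r l * lam a) * lam b" for l a b n
  proof -
    have "\<bar>E (DD l a b (w R (n - l) b))\<bar> \<le> Cn * C1 * norm (w R (n - l) b) * r l * lam a * lam b"
      by (rule E_DD_bound)
    also have "\<dots> \<le> Cn * C1 * (G R * A n powr ?s) * r l * lam a * lam b"
      by (intro mult_right_mono mult_left_mono mult_nonneg_nonneg w_bound_back[OF G] C_nonneg C1_nonneg r_nonneg lam_nonneg)
    finally show ?thesis .
  qed
  have E_UD: "E (\<Sum>\<^sub>\<infinity>a. \<beta> a ^ 1 *\<^sub>R UD M 1 n a)
      = (\<Sum>l=1..n. \<Sum>\<^sub>\<infinity>a. \<beta> a * (\<Sum>\<^sub>\<infinity>b. \<beta> b * E (DD l a b (w R (n - l) b))))" for n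
  proof -
    have sUD: "(\<lambda>a. \<beta> a ^ 1 *\<^sub>R UD M 1 n a) summable_on UNIV"
      by (intro \<beta>_lam_sum(1)[OF _ UD_bound[OF G]]) auto
    have E1: "E (UD M 1 n a) = (\<Sum>l=1..n. \<Sum>\<^sub>\<infinity>b. \<beta> b * E (DD l a b (w R (n - l) b)))" for a
    proof -
      have "(\<lambda>b. \<beta> b ^ 1 *\<^sub>R DD l a b (w (M - 1) (n - l) b)) summable_on UNIV" for l
      proof (rule \<beta>_lam_sum(1)[where K="C1 * lam a * r l * (G R * A n powr ?s)"])
        fix b
        have "norm (DD l a b (w (M - 1) (n - l) b)) \<le> C1 * lam a * r l * norm (w (M - 1) (n - l) b) * lam b"
          by (rule DD_norm)
        also have "\<dots> \<le> C1 * lam a * r l * (G R * A n powr ?s) * lam b"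
          unfolding M_def diff_Suc_1
          by (intro mult_right_mono mult_left_mono mult_nonneg_nonneg w_bound_back[OF G] C_nonneg C1_nonneg r_nonneg lam_nonneg)
        finally show "norm (DD l a b (w (M - 1) (n - l) b)) \<le> C1 * lam a * r l * (G R * A n powr ?s) * lam b" .
      qed simp
      from E_infsum(1)[OF this] show ?thesis
        by (simp add: UD_def linear_sum[OF E_linear] M_def)
    qed
    define Y where "Y = (\<lambda>l a. \<Sum>\<^sub>\<infinity>b. \<beta> b * E (DD l a b (w R (n - l) b)))"
    have Y: "\<bar>Y l a\<bar> \<le> \<beta>lam * (Cn * C1 * (G R * A n powr ?s) * r l) * lam a" for l a
    proof -
      have "norm (\<Sum>\<^sub>\<infinity>b. \<beta> b ^ 1 *\<^sub>R E (DD l a b (w R (n - l) b))) \<le> \<beta>1 ^ (1 - 1) * \<beta>lam * (Cn * C1 * (G R * A n powr ?s) * r l * lam a)"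
        using pair_bound by (intro \<beta>_lam_sum(2)) auto
      then show ?thesis by (simp add: Y_def mult_ac)
    qed
    have "(\<lambda>a. \<beta> a ^ 1 *\<^sub>R Y l a) summable_on UNIV" for l
      by (rule \<beta>_lam_sum(1)) (use Y in auto)
    then have sY: "(\<lambda>a. \<beta> a * Y l a) summable_on UNIV" for l
      by simp
    have "E (\<Sum>\<^sub>\<infinity>a. \<beta> a ^ 1 *\<^sub>R UD M 1 n a) = (\<Sum>\<^sub>\<infinity>a. \<beta> a ^ 1 * E (UD M 1 n a))"
      by (rule E_infsum(1)[OF sUD])
    also have "\<dots> = (\<Sum>\<^sub>\<infinity>a. \<Sum>l=1..n. \<beta> a * Y l a)"
      unfolding E1 Y_def by (simp add: sum_distrib_left)
    also have "\<dots> = (\<Sum>l=1..n. \<Sum>\<^sub>\<infinity>a. \<beta> a * Y l a)"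
      by (intro infsum_finite_sum(1) sY) simp
    finally show ?thesis
      unfolding Y_def .
  qed
  have eq: "E (\<Sum>\<^sub>\<infinity>b. \<beta> b *\<^sub>R w (Suc R) n b)
      = E (\<Sum>\<^sub>\<infinity>a. \<beta> a ^ 1 *\<^sub>R rest n a) + real M * E (\<Sum>\<^sub>\<infinity>a. \<beta> a ^ 1 *\<^sub>R UD M 1 n a)" for n
  proof -
    have "w M n a - w M n 0 = rest n a + real M *\<^sub>R UD M 1 n a" for a
    proof -
      have "w M n a - w M n 0 = (\<Sum>l=1..n. T l a (V M (n - l)) - T l 0 (V M (n - l)))
          + (\<Sum>j=1..M. real (M choose j) *\<^sub>R UD M j n a)"
      proof -
        have "M > 0" by (simp add: M_def)
        note dec = w_decomposition[OF this IH(1)]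
        show ?thesis
          unfolding dec U_difference[OF IH(1), symmetric] sum_subtractf by simp
      qed
      also have "(\<Sum>j=1..M. real (M choose j) *\<^sub>R UD M j n a)
          = real (M choose 1) *\<^sub>R UD M 1 n a + (\<Sum>j=Suc 1..M. real (M choose j) *\<^sub>R UD M j n a)"
        by (rule sum.atLeast_Suc_atMost) (simp add: M_def)
      finally show ?thesis
        by (simp add: rest_def numeral_2_eq_2)
    qed
    then have "(\<Sum>\<^sub>\<infinity>b. \<beta> b *\<^sub>R w (Suc R) n b) = (\<Sum>\<^sub>\<infinity>b. \<beta> b ^ 1 *\<^sub>R rest n b + real M *\<^sub>R (\<beta> b ^ 1 *\<^sub>R UD M 1 n b))"
      unfolding \<beta>_sum_centre[OF w_boundD(2)[OF G], where x = "w (Suc R) n 0"]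
      by (simp add: M_def scaleR_add_right mult.commute)
    also have "\<dots> = (\<Sum>\<^sub>\<infinity>b. \<beta> b ^ 1 *\<^sub>R rest n b) + real M *\<^sub>R (\<Sum>\<^sub>\<infinity>b. \<beta> b ^ 1 *\<^sub>R UD M 1 n b)"
    proof -
      have sr: "(\<lambda>b. \<beta> b ^ 1 *\<^sub>R rest n b) summable_on UNIV"
        by (intro \<beta>_lam_sum(1)[OF _ rest_norm]) auto
      have su: "(\<lambda>b. \<beta> b ^ 1 *\<^sub>R UD M 1 n b) summable_on UNIV"
        by (intro \<beta>_lam_sum(1)[OF _ UD_bound[OF G]]) auto
      show ?thesis
        by (simp only: infsum_add[OF sr summable_on_bounded_linear[OF bounded_linear_scaleR_right su]]
            infsum_of_bounded_linear[OF bounded_linear_scaleR_right su])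
    qed
    finally show ?thesis
      by (simp only: linear_add[OF E_linear] linear_scale[OF E_linear] real_scaleR_def)
  qed
  have "(\<lambda>n. E (\<Sum>\<^sub>\<infinity>a. \<beta> a ^ 1 *\<^sub>R rest n a) / A n powr ?s
      + real M * ((\<Sum>l=1..n. \<Sum>\<^sub>\<infinity>a. \<beta> a * (\<Sum>\<^sub>\<infinity>b. \<beta> b * E (DD l a b (w R (n - l) b)))) / A n powr ?s))
      \<longlonglongrightarrow> 0 + real M * (c * (\<Sum>l. \<rho> (Suc l)))"
    by (intro tendsto_add tendsto_mult_left rest_lim interaction_limit(2)[OF X])
  then show ?thesis
    unfolding eq E_UD by (simp add: M_def add_divide_distrib)
qed

text \<open>With N = R + 2, a visit counted twice contributes (N choose 2) times the sum of
  \<beta>(b)^2, and two interacting visits contribute N (N - 1) times the sum of \<rho>. The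
  identity N (N - 1) = 2 (N choose 2) combines them into \<open>\<sigma>2\<close>.\<close>

lemma V_limit:
  assumes X: "tends (\<lambda>n. (1 / A n powr (real R / 2 + 1)) *\<^sub>R w R n 0) c"
  shows "(\<lambda>n. E (V (R + 2) n) / A n powr (real (R + 2) / 2)) \<longlonglongrightarrow> real ((R + 2) choose 2) * \<sigma>2 * c"
proof -
  define N where "N = R + 2"
  have s: "real R / 2 + 1 = real N / 2"
    by (simp add: N_def field_simps)
  define t where "t = (\<lambda>j n. E (\<Sum>\<^sub>\<infinity>b. \<beta> b ^ j *\<^sub>R w (N - j) n b) / A n powr (real N / 2))"
  define L where "L = (\<lambda>j::nat. if j = 1 then real (Suc R) * (c * (\<Sum>l. \<rho> (Suc l)))
      else if j = 2 then c * (\<Sum>\<^sub>\<infinity>b. (\<beta> b)\<^sup>2) else 0)"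
  have "t j \<longlonglongrightarrow> L j" if "j \<in> {1..N}" for j
  proof -
    have "j = 1 \<or> j = 2 \<or> 3 \<le> j"
      using that unfolding atLeastAtMost_iff by linarith
    then consider "j = 1" | "j = 2" | "3 \<le> j" by blast
    then show ?thesis
    proof cases
      case 1
      then show ?thesis
        using linear_term_limit[OF X] by (simp add: t_def L_def N_def s)
    next
      case 2
      then show ?thesis
        using square_term_limit[OF X] by (simp add: t_def L_def N_def s)
    next
      case 3
      then show ?thesis
        using higher_order_null[of j N] that by (simp add: t_def L_def)
    qed
  qed
  then have "(\<lambda>n. \<Sum>j=1..N. real (N choose j) * t j n) \<longlonglongrightarrow> (\<Sum>j=1..N. real (N choose j) * L j)"
    by (intro tendsto_sum tendsto_mult_left)
  moreover have "(\<Sum>j=1..N. real (N choose j) * t j n) = E (V N n) / A n powr (real N / 2)" for n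
    by (simp add: V_def t_def linear_sum[OF E_linear] linear_scale[OF E_linear] sum_divide_distrib)
  moreover have "(\<Sum>j=1..N. real (N choose j) * L j) = real (N choose 2) * \<sigma>2 * c"
  proof -
    have "(\<Sum>j=1..N. real (N choose j) * L j) = (\<Sum>j\<in>{1,2}. real (N choose j) * L j)"
      by (intro sum.mono_neutral_right) (auto simp: N_def L_def)
    also have "\<dots> = real N * (real (Suc R) * (c * (\<Sum>l. \<rho> (Suc l)))) + real (N choose 2) * (c * (\<Sum>\<^sub>\<infinity>b. (\<beta> b)\<^sup>2))"
      by (simp add: L_def)
    also have "real N * real (Suc R) = real (N choose 2) * 2"
    proof -
      have "2 * (N choose 2) = N * Suc R"
        using binomial_absorption[of 1 N] by (simp add: N_def numeral_2_eq_2)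
      then show ?thesis by (metis mult.commute of_nat_mult of_nat_numeral)
    qed
    then have "real N * (real (Suc R) * (c * (\<Sum>l. \<rho> (Suc l)))) = real (N choose 2) * 2 * (c * (\<Sum>l. \<rho> (Suc l)))"
      by (simp only: mult.assoc[symmetric])
    finally show ?thesis
      by (simp add: \<sigma>2_def algebra_simps)
  qed
  ultimately show ?thesis
    by (simp only: N_def[symmetric])
qed

lemma V_1_null: "(\<lambda>n. E (V 1 n) / A n powr (real 1 / 2)) \<longlonglongrightarrow> 0"
proof (rule Lim_null_comparison)
  show "(\<lambda>n. Cn * \<beta>lam * C1 * norm e * (Qs n / A n powr (1/2))) \<longlonglongrightarrow> 0"
    using tendsto_mult_left[OF Qs_null, of "Cn * \<beta>lam * C1 * norm e"] by simp
  obtain G where G: "w_bound 0 G" using w_bounds by blast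
  have "\<bar>E (V 1 n)\<bar> \<le> Cn * (\<beta>1 ^ (1 - 1) * \<beta>lam * (C1 * norm e * Qs n))" for n
  proof -
    have "V 1 n = (\<Sum>\<^sub>\<infinity>b. \<beta> b ^ 1 *\<^sub>R (w 0 n b - w 0 n 0))"
      unfolding power_one_right \<beta>_sum_centre[OF w_boundD(2)[OF G], where x = "w 0 n 0", symmetric] by (simp add: V_def)
    then show ?thesis
      using E_\<beta>_sum_le[of 1 "\<lambda>b. w 0 n b - w 0 n 0" "C1 * norm e * Qs n"] w_0_difference by simp
  qed
  then have "\<bar>E (V 1 n)\<bar> / A n powr (1/2) \<le> Cn * (\<beta>1 ^ (1 - 1) * \<beta>lam * (C1 * norm e * Qs n)) / A n powr (1/2)" for n
    by (intro divide_right_mono) simp_all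
  then show "\<forall>\<^sub>F n in sequentially. norm (E (V 1 n) / A n powr (real 1 / 2)) \<le> Cn * \<beta>lam * C1 * norm e * (Qs n / A n powr (1/2))"
    by (simp add: abs_divide mult_ac)
qed

lemma w_limit:
  assumes N: "N > 0" and EV: "(\<lambda>n. E (V N n) / A n powr (real N / 2)) \<longlonglongrightarrow> \<mu>"
  shows "tends (\<lambda>n. (1 / A n powr (real N / 2 + 1)) *\<^sub>R w N n 0) (\<Phi> * kappa \<gamma> (real N / 2) * \<mu>)"
proof -
  have IH: "\<forall>k<N. \<exists>G. w_bound k G" "\<forall>k<N. \<exists>H. w_diff_bound k H"
    using w_bounds by blast+
  obtain K where K: "K \<ge> 0" "\<And>n. norm (V N n) \<le> K * A n powr (real N / 2)"
    using V_bound[OF N IH] by blast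
  obtain KU where KU: "KU \<ge> 0" "\<And>n a. norm (U N n a) \<le> KU * Qs n * A n powr ((real N + 1) / 2)"
    using U_bound[OF IH(1)] by blast
  let ?s = "real N / 2 + 1"
  have "tends (\<lambda>n. (1 / A n powr ?s) *\<^sub>R (\<Sum>l=1..n. T l 0 (V N (n - l)))) (\<Phi> * kappa \<gamma> (real N / 2) * \<mu>)"
    using N by (intro renewal_limit[OF _ K(2) EV]) auto
  then show ?thesis
  proof (rule tends_perturb)
    show "(\<lambda>n. sn ((1 / A n powr ?s) *\<^sub>R w N n 0 - (1 / A n powr ?s) *\<^sub>R (\<Sum>l=1..n. T l 0 (V N (n - l))))) \<longlonglongrightarrow> 0"
    proof (rule Lim_null_comparison)
      show "(\<lambda>n. Cn * KU * (Qs n / A n powr (1/2))) \<longlonglongrightarrow> 0"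
        using tendsto_mult_left[OF Qs_null, of "Cn * KU"] by simp
      show "\<forall>\<^sub>F n in sequentially. norm (sn ((1 / A n powr ?s) *\<^sub>R w N n 0 - (1 / A n powr ?s) *\<^sub>R (\<Sum>l=1..n. T l 0 (V N (n - l)))))
          \<le> Cn * KU * (Qs n / A n powr (1/2))"
      proof (intro always_eventually allI)
        fix n
        have "A n powr ?s = A n powr ((real N + 1) / 2) * A n powr (1/2)"
          by (simp add: powr_add[symmetric] field_simps)
        then have eq: "Cn * (KU * Qs n * A n powr ((real N + 1) / 2)) / A n powr ?s = Cn * KU * (Qs n / A n powr (1/2))"
          by simp
        have "sn (U N n 0) \<le> Cn * (KU * Qs n * A n powr ((real N + 1) / 2))"
          using sn_le[of "U N n 0"] KU(2)[of n 0] C_nonneg by (meson mult_left_mono order_trans)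
        then have "sn (U N n 0) / A n powr ?s \<le> Cn * KU * (Qs n / A n powr (1/2))"
          unfolding eq[symmetric] by (rule divide_right_mono) simp
        moreover have "w N n 0 - (\<Sum>l=1..n. T l 0 (V N (n - l))) = U N n 0"
          using w_decomposition[OF N IH(1), of n 0] by simp
        ultimately show "norm (sn ((1 / A n powr ?s) *\<^sub>R w N n 0 - (1 / A n powr ?s) *\<^sub>R (\<Sum>l=1..n. T l 0 (V N (n - l)))))
          \<le> Cn * KU * (Qs n / A n powr (1/2))"
          using sn_nonneg by (simp add: scaleR_diff_right[symmetric] sn_scale)
      qed
    qed
  qed
qed

text \<open>Moments of a standard Gaussian times the square root of \<sigma>2 \<Phi> Y. The m! of
  the m-th Mittag-Leffler moment cancels that in the Gaussian moment (2m)! / (2^m m!).\<close>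

definition mu :: "nat \<Rightarrow> real" where
  "mu N = (if even N then fact N / 2 ^ (N div 2) * (\<sigma>2 * \<Phi>) ^ (N div 2) *
     (Gamma (1 + \<gamma>) ^ (N div 2) / Gamma (1 + real (N div 2) * \<gamma>)) else 0)"

lemma mu_step: "mu (R + 2) = real ((R + 2) choose 2) * \<sigma>2 * (\<Phi> * kappa \<gamma> (real R / 2) * mu R)"
proof (cases "even R")
  case True
  then obtain m where R: "R = 2 * m" by blast
  have Gpos: "Gamma (1 + real m * \<gamma>) > 0" for m
    using \<gamma>_range by (intro Gamma_real_pos add_pos_nonneg) auto
  have "2 * ((R + 2) choose 2) = (R + 2) * (R + 1)"
    using binomial_absorption[of 1 "R + 2"] by (simp add: numeral_2_eq_2)
  then have bin: "real ((R + 2) choose 2) = real (R + 2) * real (R + 1) / 2"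
    by (metis mult.commute nonzero_mult_div_cancel_left of_nat_mult of_nat_numeral zero_neq_numeral)
  have fact: "fact (R + 2) = real (R + 2) * real (R + 1) * (fact R :: real)"
    by (simp add: algebra_simps)
  have "(R + 2) div 2 = Suc m" "R div 2 = m" "real R / 2 = real m"
    by (auto simp: R)
  then show ?thesis
    using True Gpos[of m] Gpos[of "Suc m"] unfolding mu_def kappa_def bin fact
    by (simp add: field_simps)
qed (simp add: mu_def)

lemma mu_0: "mu 0 = 1"
  by (simp add: mu_def)

lemma w_tends: "tends (\<lambda>n. (1 / A n powr (real N / 2 + 1)) *\<^sub>R w N n 0) (\<Phi> * kappa \<gamma> (real N / 2) * mu N)"
  and V_tends: "N > 0 \<Longrightarrow> (\<lambda>n. E (V N n) / A n powr (real N / 2)) \<longlonglongrightarrow> mu N"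
proof -
  have "tends (\<lambda>n. (1 / A n powr (real N / 2 + 1)) *\<^sub>R w N n 0) (\<Phi> * kappa \<gamma> (real N / 2) * mu N) \<and>
      (N > 0 \<longrightarrow> (\<lambda>n. E (V N n) / A n powr (real N / 2)) \<longlonglongrightarrow> mu N)"
  proof (induction N rule: less_induct)
    case (less N)
    consider "N = 0" | "N = 1" | R where "N = R + 2"
      by (metis One_nat_def add_2_eq_Suc' not0_implies_Suc)
    then show ?case
    proof cases
      case 1
      then show ?thesis
        using green_limit \<gamma>_range A_pos by (simp add: w0 mu_0 kappa_s0 less_imp_le)
    next
      case 2
      have "mu 1 = 0" by (simp add: mu_def)
      then show ?thesis
        using w_limit[of 1 0] V_1_null 2 by simp
    next
      case 3
      then have "tends (\<lambda>n. (1 / A n powr (real R / 2 + 1)) *\<^sub>R w R n 0) (\<Phi> * kappa \<gamma> (real R / 2) * mu R)"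
        using less by simp
      from V_limit[OF this] have "(\<lambda>n. E (V N n) / A n powr (real N / 2)) \<longlonglongrightarrow> mu N"
        by (simp only: 3 mu_step)
      then show ?thesis
        using w_limit[of N "mu N"] 3 by simp
    qed
  qed
  then show "tends (\<lambda>n. (1 / A n powr (real N / 2 + 1)) *\<^sub>R w N n 0) (\<Phi> * kappa \<gamma> (real N / 2) * mu N)"
    "N > 0 \<Longrightarrow> (\<lambda>n. E (V N n) / A n powr (real N / 2)) \<longlonglongrightarrow> mu N"
    by auto
qed

end

section \<open>The walk over a dynamical system\<close>

text \<open>Countable additivity in the form of an unconditional sum over the values of f; the L1
  norm of \<phi> bounds all finite partial sums of norms.\<close>

lemma has_sum_integral_partition:
  fixes \<phi> :: "'s \<Rightarrow> complex" and f :: "'s \<Rightarrow> 'i::countable"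
  assumes f [measurable]: "f \<in> measurable M (count_space UNIV)" and \<phi> [measurable]: "integrable M \<phi>"
  shows "((\<lambda>b. \<integral>x. of_bool (f x = b) * \<phi> x \<partial>M) has_sum (\<integral>x. \<phi> x \<partial>M)) UNIV"
proof -
  have i: "integrable M (\<lambda>x. of_bool (f x = b) * \<phi> x)" for b
    by (rule Bochner_Integration.integrable_bound[OF \<phi>]) (auto simp: norm_mult)
  have i': "integrable M (\<lambda>x. \<Sum>b\<in>B. of_bool (f x = b) * \<phi> x)" for B
    using i by (intro Bochner_Integration.integrable_sum)
  have sum_eq: "(\<Sum>b\<in>B. of_bool (f x = b) * \<phi> x) = of_bool (f x \<in> B) * \<phi> x" if "finite B" for B x
    using that by (simp add: sum.delta sum_distrib_right[symmetric])
  have bd: "(\<Sum>b\<in>B. norm (\<integral>x. of_bool (f x = b) * \<phi> x \<partial>M)) \<le> (\<integral>x. norm (\<phi> x) \<partial>M)" if B: "finite B" for B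
  proof -
    have "(\<Sum>b\<in>B. norm (\<integral>x. of_bool (f x = b) * \<phi> x \<partial>M)) \<le> (\<Sum>b\<in>B. \<integral>x. norm (of_bool (f x = b) * \<phi> x) \<partial>M)"
      by (intro sum_mono integral_norm_bound)
    also have "\<dots> = (\<integral>x. (\<Sum>b\<in>B. norm (of_bool (f x = b) * \<phi> x)) \<partial>M)"
      using i by (intro Bochner_Integration.integral_sum[symmetric]) auto
    also have "\<dots> \<le> (\<integral>x. norm (\<phi> x) \<partial>M)"
    proof (intro integral_mono)
      show "integrable M (\<lambda>x. \<Sum>b\<in>B. norm (of_bool (f x = b) * \<phi> x))"
        using i by (intro Bochner_Integration.integrable_sum) auto
      show "integrable M (\<lambda>x. norm (\<phi> x))" using \<phi> by auto
      fix x
      have "(\<Sum>b\<in>B. norm (of_bool (f x = b) * \<phi> x)) = (\<Sum>b\<in>B. if f x = b then norm (\<phi> x) else 0)"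
        by (intro sum.cong) auto
      then show "(\<Sum>b\<in>B. norm (of_bool (f x = b) * \<phi> x)) \<le> norm (\<phi> x)"
        using B by simp
    qed
    finally show ?thesis .
  qed
  have "(\<lambda>b. norm (\<integral>x. of_bool (f x = b) * \<phi> x \<partial>M)) summable_on UNIV"
    by (intro nonneg_bdd_above_summable_on bdd_aboveI2[of _ _ "\<integral>x. norm (\<phi> x) \<partial>M"]) (use bd in auto)
  then have s: "(\<lambda>b. \<integral>x. of_bool (f x = b) * \<phi> x \<partial>M) summable_on UNIV"
    by (rule abs_summable_summable)
  \<comment> \<open>Absolute convergence is known, so the sum may be evaluated along one exhaustion
    by finite sets, where sequential dominated convergence applies.\<close>
  define B where "B = (\<lambda>n. {b::'i. to_nat b < n})"
  have B_fin: "finite (B n)" for n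
    using finite_vimageI[OF finite_lessThan[of n] inj_to_nat] by (simp add: B_def vimage_def)
  have "filterlim B (finite_subsets_at_top UNIV) sequentially"
    unfolding filterlim_finite_subsets_at_top
  proof (intro allI impI)
    fix X :: "'i set" assume X: "finite X \<and> X \<subseteq> UNIV"
    obtain m where m: "\<And>b. b \<in> X \<Longrightarrow> to_nat b < m"
      using X finite_nat_set_iff_bounded[of "to_nat ` X"] by auto
    show "\<forall>\<^sub>F n in sequentially. finite (B n) \<and> X \<subseteq> B n \<and> B n \<subseteq> UNIV"
      using eventually_ge_at_top[of m]
    proof eventually_elim
      case (elim n)
      then show ?case using B_fin m by (fastforce simp: B_def)
    qed
  qed
  from filterlim_compose[OF has_sum_infsum[OF s, unfolded has_sum_def] this]
  have "(\<lambda>n. \<Sum>b\<in>B n. \<integral>x. of_bool (f x = b) * \<phi> x \<partial>M) \<longlonglongrightarrow> (\<Sum>\<^sub>\<infinity>b. \<integral>x. of_bool (f x = b) * \<phi> x \<partial>M)" .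
  moreover have "(\<lambda>n. \<Sum>b\<in>B n. \<integral>x. of_bool (f x = b) * \<phi> x \<partial>M) \<longlonglongrightarrow> (\<integral>x. \<phi> x \<partial>M)"
  proof -
    have "(\<lambda>n. \<integral>x. of_bool (f x \<in> B n) * \<phi> x \<partial>M) \<longlonglongrightarrow> (\<integral>x. \<phi> x \<partial>M)"
    proof (rule integral_dominated_convergence[where w="\<lambda>x. norm (\<phi> x)"])
      show "AE x in M. (\<lambda>n. of_bool (f x \<in> B n) * \<phi> x) \<longlonglongrightarrow> \<phi> x"
      proof (rule AE_I2, rule tendsto_eventually)
        fix x
        show "\<forall>\<^sub>F n in sequentially. of_bool (f x \<in> B n) * \<phi> x = \<phi> x"
          using eventually_gt_at_top[of "to_nat (f x)"] by eventually_elim (simp add: B_def)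
      qed
    qed (use \<phi> in \<open>auto simp: norm_mult\<close>)
    moreover have "(\<Sum>b\<in>B n. \<integral>x. of_bool (f x = b) * \<phi> x \<partial>M) = (\<integral>x. of_bool (f x \<in> B n) * \<phi> x \<partial>M)" for n
      using i by (subst Bochner_Integration.integral_sum[symmetric]) (auto simp: sum_eq[OF B_fin])
    ultimately show ?thesis by simp
  qed
  ultimately have "(\<Sum>\<^sub>\<infinity>b. \<integral>x. of_bool (f x = b) * \<phi> x \<partial>M) = (\<integral>x. \<phi> x \<partial>M)"
    by (rule LIMSEQ_unique)
  with has_sum_infsum[OF s] show ?thesis by simp
qed

lemma birkhoff_add: "birkhoff F \<Psi> (n + m) x = birkhoff F \<Psi> n x + birkhoff F \<Psi> m ((F ^^ n) x)"
proof (induction m)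
  case (Suc m)
  have "(F ^^ (n + m)) x = (F ^^ m) ((F ^^ n) x)"
    by (simp add: funpow_add add.commute[of n m])
  with Suc show ?case
    by (simp add: birkhoff_def add.assoc)
qed (simp add: birkhoff_def)

locale dynamical_walk =
  fixes M :: "'s measure" and F :: "'s \<Rightarrow> 's"
    and P :: "('s \<Rightarrow> complex) \<Rightarrow> ('s \<Rightarrow> complex)" and \<Psi> :: "'s \<Rightarrow> int ^ 'd"
    and J :: "'b::banach \<Rightarrow> 's \<Rightarrow> complex" and e :: 'b
  assumes system: "pp_dynamical_system M F"
    and transfer: "transfer_operator M F P"
    and \<Psi>_meas [measurable]: "\<Psi> \<in> measurable M (count_space UNIV)"
    and J_incl: "L1_inclusion M J"
    and J_e: "AE x in M. J e x = 1"
    and pres: "\<And>n a. preserved_by M J (Q_op F P \<Psi> n a)"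
    and T_bdd: "\<And>n a. bounded_linear (restrict_op M J (Q_op F P \<Psi> n a))"
begin

definition "T n a = restrict_op M J (Q_op F P \<Psi> n a)"

abbreviation "S \<equiv> birkhoff F \<Psi>"

sublocale prob_space M
  using system by (simp add: pp_dynamical_system_def)

lemma F_meas [measurable]: "F \<in> measurable M M"
  using system by (simp add: pp_dynamical_system_def)

lemma Fn_meas [measurable]: "F ^^ n \<in> measurable M M"
  by (induction n) (auto simp: measurable_compose[OF _ F_meas] comp_def)

lemma S_meas [measurable]: "S n \<in> measurable M (count_space UNIV)"
proof (induction n)
  case 0
  then show ?case by (simp add: birkhoff_def)
next
  case (Suc n)
  have "(\<lambda>x. \<Psi> ((F ^^ n) x)) \<in> measurable M (count_space UNIV)"
    by (rule measurable_compose[OF Fn_meas \<Psi>_meas])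
  then have "(\<lambda>x. i + \<Psi> ((F ^^ n) x)) \<in> measurable M (count_space UNIV)" for i
    by (rule measurable_compose) simp
  from measurable_compose_countable[OF this Suc]
  have "(\<lambda>x. S n x + \<Psi> ((F ^^ n) x)) \<in> measurable M (count_space UNIV)" .
  moreover have "S (Suc n) = (\<lambda>x. S n x + \<Psi> ((F ^^ n) x))"
    by (simp add: birkhoff_def fun_eq_iff)
  ultimately show ?case by simp
qed

lemma J_int [measurable (raw), intro, simp]: "integrable M (J u)"
  using J_incl by (simp add: L1_inclusion_def)

lemma J_meas [measurable]: "J u \<in> borel_measurable M"
  by (rule borel_measurable_integrable[OF J_int])

lemma J_add: "AE x in M. J (u + v) x = J u x + J v x"
  and J_scale: "AE x in M. J (c *\<^sub>R u) x = c *\<^sub>R J u x"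
  and J_inj: "(AE x in M. J u x = 0) \<Longrightarrow> u = 0"
  and J_bound: "\<exists>C. \<forall>u. (\<integral>x. norm (J u x) \<partial>M) \<le> C * norm u"
  using J_incl by (auto simp: L1_inclusion_def)

lemma J_diff: "AE x in M. J (u - v) x = J u x - J v x"
  using J_add[of "u - v" v] by eventually_elim simp

text \<open>Injectivity of J modulo null sets makes the definite description in
  \<open>restrict_op\<close> denote the class provided by \<open>preserved_by\<close>.\<close>

lemma J_Q: "AE x in M. J (T n a u) x = Q_op F P \<Psi> n a (J u) x"
proof -
  let ?R = "\<lambda>v. AE x in M. J v x = Q_op F P \<Psi> n a (J u) x"
  obtain v where v: "?R v"
    using pres[of n a] by (auto simp: preserved_by_def)
  moreover have "v' = v" if v': "?R v'" for v'
  proof -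
    have "AE x in M. J (v' - v) x = 0"
      using v v' J_diff[of v' v] by eventually_elim simp
    then show ?thesis using J_inj by fastforce
  qed
  ultimately have "?R (THE v. ?R v)"
    by (rule theI)
  then show ?thesis
    by (simp add: T_def restrict_op_def)
qed

definition "test g \<longleftrightarrow> g \<in> borel_measurable M \<and> bounded (g ` space M)" for g :: "'s \<Rightarrow> complex"

lemma test_bound: "test g \<Longrightarrow> \<exists>B\<ge>0. \<forall>x\<in>space M. norm (g x) \<le> B"
  unfolding test_def bounded_iff by (metis imageI norm_ge_zero order_trans linear)

lemma testI: "g \<in> borel_measurable M \<Longrightarrow> (\<And>x. x \<in> space M \<Longrightarrow> norm (g x) \<le> B) \<Longrightarrow> test g"
  unfolding test_def bounded_iff by auto

lemma test_mult_integrable: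
  assumes "integrable M h" "test g"
  shows "integrable M (\<lambda>x. h x * g x)"
proof -
  obtain B where "\<forall>x\<in>space M. norm (g x) \<le> B"
    using test_bound[OF assms(2)] by auto
  then show ?thesis
    using assms
    by (intro Bochner_Integration.integrable_bound[OF integrable_mult_right[OF integrable_norm[OF assms(1)], of B]])
      (auto simp: norm_mult test_def mult.commute intro!: AE_I2 order_trans[OF _ abs_ge_self] mult_right_mono)
qed

lemma test_Fn: "test g \<Longrightarrow> test (\<lambda>x. g ((F ^^ n) x))"
  using test_bound[of g] measurable_space[OF Fn_meas]
  by (metis testI measurable_compose[OF Fn_meas] test_def)

lemma test_const: "test (\<lambda>_. c)"
  by (rule testI[where B="norm c"]) auto

lemma test_of_bool_mult: "test g \<Longrightarrow> test (\<lambda>x. of_bool (S n x = a) * g x)"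
  using test_bound[of g]
  by (auto simp: norm_mult test_def[of g] intro!: testI)

lemma P_duality:
  assumes h: "integrable M h" and g: "test g"
  shows "integrable M (P h)" "(\<integral>x. P h x * g x \<partial>M) = (\<integral>x. h x * g (F x) \<partial>M)"
  using transfer h g by (auto simp: transfer_operator_def test_def)

lemma Pn_duality:
  assumes h: "integrable M h"
  shows "integrable M ((P ^^ n) h)" "\<And>g. test g \<Longrightarrow> (\<integral>x. (P ^^ n) h x * g x \<partial>M) = (\<integral>x. h x * g ((F ^^ n) x) \<partial>M)"
proof (induction n)
  case 0
  { case 1 then show ?case using h by simp }
  { case 2 then show ?case by simp }
next
  case (Suc n)
  { case 1 then show ?case using P_duality(1)[OF Suc(1) test_const] by simp }
  { case (2 g)
    then show ?case
      using P_duality(2)[OF Suc(1) 2] Suc(2)[OF test_Fn[OF 2, of 1]] by (simp add: funpow_swap1) }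
qed

lemma T_duality:
  assumes g: "test g"
  shows "(\<integral>x. J (T n a u) x * g x \<partial>M) = (\<integral>x. J u x * (of_bool (S n x = a) * g ((F ^^ n) x)) \<partial>M)"
proof -
  have i: "integrable M (\<lambda>x. of_bool (S n x = a) * J u x)"
    by (rule Bochner_Integration.integrable_bound[OF J_int[of u]]) (auto simp: norm_mult)
  have "(\<integral>x. J (T n a u) x * g x \<partial>M) = (\<integral>x. Q_op F P \<Psi> n a (J u) x * g x \<partial>M)"
  proof (rule integral_cong_AE)
    show "AE x in M. J (T n a u) x * g x = Q_op F P \<Psi> n a (J u) x * g x"
      using J_Q[of n a u] by eventually_elim simp
  qed (use g Pn_duality(1)[OF i, of n] in \<open>auto simp: test_def Q_op_def\<close>)
  also have "\<dots> = (\<integral>x. of_bool (S n x = a) * J u x * g ((F ^^ n) x) \<partial>M)"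
    unfolding Q_op_def by (rule Pn_duality(2)[OF i g])
  finally show ?thesis by (simp add: mult_ac)
qed

definition "pairing g u = (\<integral>x. J u x * g x \<partial>M)"

lemma pairing_linear: "test g \<Longrightarrow> bounded_linear (pairing g)"
proof -
  assume g: "test g"
  obtain B where B: "B \<ge> 0" "\<And>x. x \<in> space M \<Longrightarrow> norm (g x) \<le> B"
    using test_bound[OF g] by auto
  obtain C where C: "\<And>u. (\<integral>x. norm (J u x) \<partial>M) \<le> C * norm u"
    using J_bound by auto
  have [measurable]: "g \<in> borel_measurable M" using g by (simp add: test_def)
  note i = test_mult_integrable[OF J_int g]
  show ?thesis
  proof (rule bounded_linear_intro[where K="B * C"])
    fix u v :: 'b and c :: real
    have "pairing g (u + v) = (\<integral>x. J u x * g x + J v x * g x \<partial>M)"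
      unfolding pairing_def
      by (rule integral_cong_AE) (use J_add[of u v] in \<open>auto simp: distrib_right elim: eventually_mono\<close>)
    then show "pairing g (u + v) = pairing g u + pairing g v"
      using i by (simp add: pairing_def)
    have "pairing g (c *\<^sub>R u) = (\<integral>x. c *\<^sub>R (J u x * g x) \<partial>M)"
      unfolding pairing_def
      by (rule integral_cong_AE) (use J_scale[of c u] in \<open>auto elim: eventually_mono\<close>)
    then show "pairing g (c *\<^sub>R u) = c *\<^sub>R pairing g u"
      by (simp add: pairing_def)
    have "norm (pairing g u) \<le> (\<integral>x. norm (J u x * g x) \<partial>M)"
      unfolding pairing_def by (rule integral_norm_bound)
    also have "\<dots> \<le> (\<integral>x. B * norm (J u x) \<partial>M)"
      using B by (intro integral_mono integrable_norm i) (auto simp: norm_mult mult.commute mult_right_mono)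
    also have "\<dots> \<le> B * (C * norm u)"
      using B C by (simp add: mult_left_mono)
    finally show "norm (pairing g u) \<le> norm u * (B * C)" by (simp add: mult_ac)
  qed
qed

definition "E u = Re (\<integral>x. J u x \<partial>M)"
definition "sn u = (\<integral>x. \<bar>Re (J u x)\<bar> \<partial>M)"

lemma E_pairing: "E u = Re (pairing (\<lambda>_. 1) u)"
  by (simp add: E_def pairing_def)

lemma E_lin: "bounded_linear E"
  unfolding E_pairing[abs_def]
  by (rule bounded_linear_compose[OF bounded_linear_Re pairing_linear[OF test_const]])

lemma E_eq: "E u = (\<integral>x. Re (J u x) \<partial>M)"
  by (simp add: E_def)

lemma Re_J_int [simp, intro]: "integrable M (\<lambda>x. Re (J u x))" "integrable M (\<lambda>x. \<bar>Re (J u x)\<bar>)"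
  by auto

lemma sn_triangle: "sn (u + v) \<le> sn u + sn v"
proof -
  have "sn (u + v) \<le> (\<integral>x. \<bar>Re (J u x)\<bar> + \<bar>Re (J v x)\<bar> \<partial>M)"
    unfolding sn_def
    by (intro integral_mono_AE) (use J_add[of u v] in \<open>auto elim: eventually_mono\<close>)
  then show ?thesis by (simp add: sn_def)
qed

lemma sn_scale: "sn (c *\<^sub>R u) = \<bar>c\<bar> * sn u"
proof -
  have "sn (c *\<^sub>R u) = (\<integral>x. \<bar>c\<bar> * \<bar>Re (J u x)\<bar> \<partial>M)"
    unfolding sn_def
    by (intro integral_cong_AE) (use J_scale[of c u] in \<open>auto simp: abs_mult elim: eventually_mono\<close>)
  then show ?thesis by (simp add: sn_def)
qed

lemma E_le: "\<bar>E u\<bar> \<le> sn u"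
  unfolding E_eq sn_def by (rule integral_abs_bound)

text \<open>Duality with the constant test function 1 turns the left side into the integral of the
  real part of \<open>J u\<close> over the event S(k) = a.\<close>

lemma E_T_le: "\<bar>E (T k a u)\<bar> \<le> sn u"
proof -
  have "E (T k a u) = Re (\<integral>x. J u x * (of_bool (S k x = a) * 1) \<partial>M)"
    using T_duality[OF test_const, of k a u 1] by (simp add: E_def)
  also have "\<dots> = (\<integral>x. Re (J u x) * of_bool (S k x = a) \<partial>M)"
  proof -
    have "integrable M (\<lambda>x. J u x * (of_bool (S k x = a) * 1))"
      by (intro test_mult_integrable J_int test_of_bool_mult test_const)
    note i = this
    show ?thesis
      unfolding integral_Re[OF i, symmetric] by (intro Bochner_Integration.integral_cong) (auto simp: of_bool_def)
  qed
  also have "\<bar>\<dots>\<bar> \<le> (\<integral>x. \<bar>Re (J u x) * of_bool (S k x = a)\<bar> \<partial>M)"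
    by (rule integral_abs_bound)
  also have "\<dots> \<le> sn u"
    unfolding sn_def
  proof (rule integral_mono')
    show "integrable M (\<lambda>x. \<bar>Re (J u x)\<bar>)" by simp
  qed (auto simp: abs_mult)
  finally show ?thesis .
qed

lemma E_e: "E e = 1"
proof -
  have "(\<integral>x. J e x \<partial>M) = (\<integral>x. 1 \<partial>M)"
    using J_e by (intro integral_cong_AE) auto
  then show ?thesis by (simp add: E_def prob_space)
qed

lemma sn_le: "\<exists>C\<ge>0. \<forall>u. sn u \<le> C * norm u"
proof -
  obtain C where C: "\<And>u. (\<integral>x. norm (J u x) \<partial>M) \<le> C * norm u"
    using J_bound by auto
  have "sn u \<le> \<bar>C\<bar> * norm u" for u
  proof -
    have "sn u \<le> (\<integral>x. norm (J u x) \<partial>M)"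
      unfolding sn_def by (intro integral_mono) (auto simp: abs_Re_le_cmod)
    also have "\<dots> \<le> C * norm u" by (rule C)
    also have "\<dots> \<le> \<bar>C\<bar> * norm u" by (intro mult_right_mono) auto
    finally show ?thesis .
  qed
  then show ?thesis by (intro exI[of _ "\<bar>C\<bar>"]) auto
qed

end

text \<open>\<open>l\<close> is the time elapsed since the last visit counted, \<open>b\<close> the site of that visit and \<open>j\<close> its
  multiplicity among the \<open>N\<close> factors.\<close>

function rec_w :: "(nat \<Rightarrow> 'i::ab_group_add \<Rightarrow> 'b::banach \<Rightarrow> 'b) \<Rightarrow> 'b \<Rightarrow> ('i \<Rightarrow> real) \<Rightarrow> nat \<Rightarrow> nat \<Rightarrow> 'i \<Rightarrow> 'b" where
  "rec_w T e \<beta> N n a = (if N = 0 then (\<Sum>k<n. T k a e) else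
     (\<Sum>l=1..n. \<Sum>j=1..N. real (N choose j) *\<^sub>R (\<Sum>\<^sub>\<infinity>b. \<beta> b ^ j *\<^sub>R T l (a - b) (rec_w T e \<beta> (N - j) (n - l) b))))"
  by auto
termination
  by (relation "Wellfounded.measure (\<lambda>(T, e, \<beta>, N, n, a). N)") auto

declare rec_w.simps [simp del]

lemma rec_w_0: "rec_w T e \<beta> 0 n a = (\<Sum>k<n. T k a e)"
  by (simp add: rec_w.simps)

lemma rec_w_pos: "N > 0 \<Longrightarrow> rec_w T e \<beta> N n a =
   (\<Sum>l=1..n. \<Sum>j=1..N. real (N choose j) *\<^sub>R (\<Sum>\<^sub>\<infinity>b. \<beta> b ^ j *\<^sub>R T l (a - b) (rec_w T e \<beta> (N - j) (n - l) b)))"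
  by (subst rec_w.simps) simp

lemma sum_triangle_diagonals:
  fixes f :: "nat \<Rightarrow> nat \<Rightarrow> 'a::comm_monoid_add"
  shows "(\<Sum>l=1..n. \<Sum>k<n - l. f k l) = (\<Sum>m<n. \<Sum>k<m. f k (m - k))"
proof -
  have "(\<Sum>l=1..n. \<Sum>k<n - l. f k l) = (\<Sum>(l, k)\<in>(SIGMA l:{1..n}. {..<n - l}). f k l)"
    by (rule sum.Sigma) auto
  also have "\<dots> = (\<Sum>(m, k)\<in>(SIGMA m:{..<n}. {..<m}). f k (m - k))"
    by (rule sum.reindex_bij_witness[where i="\<lambda>(m, k). (m - k, k)" and j="\<lambda>(l, k). (l + k, k)"]) auto
  also have "\<dots> = (\<Sum>m<n. \<Sum>k<m. f k (m - k))"
    by (rule sum.Sigma[symmetric]) auto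
  finally show ?thesis .
qed

lemma partial_sum_power:
  fixes x :: "nat \<Rightarrow> real"
  assumes N: "N > 0"
  shows "(\<Sum>k<m. \<Sum>j=1..N. real (N choose j) * (x k ^ j * (\<Sum>i<k. x i) ^ (N - j))) = (\<Sum>i<m. x i) ^ N"
proof (induction m)
  case 0
  then show ?case using N by simp
next
  case (Suc m)
  have "(\<Sum>i<Suc m. x i) ^ N = (x m + (\<Sum>i<m. x i)) ^ N"
    by (simp add: add.commute)
  also have "\<dots> = (\<Sum>j\<le>N. real (N choose j) * x m ^ j * (\<Sum>i<m. x i) ^ (N - j))"
    by (rule binomial_ring)
  also have "{..N} = insert 0 {1..N}" by auto
  also have "(\<Sum>j\<in>insert 0 {1..N}. real (N choose j) * x m ^ j * (\<Sum>i<m. x i) ^ (N - j))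
      = (\<Sum>i<m. x i) ^ N + (\<Sum>j=1..N. real (N choose j) * x m ^ j * (\<Sum>i<m. x i) ^ (N - j))"
    by (subst sum.insert) auto
  finally show ?case
    using Suc by (simp add: mult.assoc)
qed

context dynamical_walk
begin

lemma test_mult: "test f \<Longrightarrow> test g \<Longrightarrow> test (\<lambda>x. f x * g x)"
proof -
  assume f: "test f" and g: "test g"
  obtain A where A: "A \<ge> 0" "\<forall>x\<in>space M. norm (f x) \<le> A" using test_bound[OF f] by auto
  obtain B where B: "B \<ge> 0" "\<forall>x\<in>space M. norm (g x) \<le> B" using test_bound[OF g] by auto
  show ?thesis
    by (rule testI[where B="A * B"]) (use A B f g in \<open>auto simp: norm_mult test_def intro!: mult_mono\<close>)
qed

lemma test_power: "test f \<Longrightarrow> test (\<lambda>x. f x ^ n)"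
  by (induction n) (auto intro: test_mult test_const)

lemma test_add: "test f \<Longrightarrow> test g \<Longrightarrow> test (\<lambda>x. f x + g x)"
proof -
  assume f: "test f" and g: "test g"
  obtain A where A: "A \<ge> 0" "\<forall>x\<in>space M. norm (f x) \<le> A" using test_bound[OF f] by auto
  obtain B where B: "B \<ge> 0" "\<forall>x\<in>space M. norm (g x) \<le> B" using test_bound[OF g] by auto
  show ?thesis
    by (rule testI[where B="A + B"]) (use A B f g in \<open>auto simp: test_def intro!: norm_triangle_mono\<close>)
qed

lemma test_sum: "(\<And>i. i \<in> I \<Longrightarrow> test (f i)) \<Longrightarrow> test (\<lambda>x. \<Sum>i\<in>I. f i x)"
  by (induction I rule: infinite_finite_induct) (auto intro: test_add test_const)

lemma test_integrable: "test g \<Longrightarrow> integrable M g"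
  using test_mult_integrable[of "\<lambda>_. 1" g] by simp

lemma test_of_bool: "test (\<lambda>x. of_bool (S n x = a))"
  using test_of_bool_mult[OF test_const[of 1]] by simp

definition "L \<beta> n x = (\<Sum>k<n. \<beta> (S k x))" for \<beta> :: "int ^ 'd \<Rightarrow> real"

lemma \<beta>S_meas [measurable]: "(\<lambda>x. \<beta> (S k x)) \<in> borel_measurable M" for \<beta> :: "int ^ 'd \<Rightarrow> real"
  by (rule measurable_compose[OF S_meas]) simp

lemma L_meas [measurable]: "L \<beta> n \<in> borel_measurable M"
  unfolding L_def[abs_def] by measurable

lemma test_\<beta>:
  assumes "\<And>b. \<bar>\<beta> b\<bar> \<le> B"
  shows "test (\<lambda>x. complex_of_real (\<beta> (S k x)))"
  by (rule testI[where B=B]) (use assms in auto)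

lemma test_L:
  assumes "\<And>b. \<bar>\<beta> b\<bar> \<le> B"
  shows "test (\<lambda>x. complex_of_real (L \<beta> n x))"
  unfolding L_def of_real_sum by (intro test_sum test_\<beta>[OF assms])

lemma pairing_T: "test g \<Longrightarrow> pairing g (T l c u) = pairing (\<lambda>x. of_bool (S l x = c) * g ((F ^^ l) x)) u"
  unfolding pairing_def by (rule T_duality)

lemma pairing_\<beta>_sum:
  assumes g: "test g" and s: "(\<lambda>b. \<beta> b ^ j *\<^sub>R X b) summable_on UNIV"
  shows "pairing g (\<Sum>\<^sub>\<infinity>b. \<beta> b ^ j *\<^sub>R X b) = (\<Sum>\<^sub>\<infinity>b. complex_of_real (\<beta> b ^ j) * pairing g (X b))"
  using infsum_of_bounded_linear[OF pairing_linear[OF g] s]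
  by (simp add: linear_scale[OF bounded_linear.linear[OF pairing_linear[OF g]]] scaleR_conv_of_real)

lemma partition_sum:
  assumes "finite K" "\<And>k. k \<in> K \<Longrightarrow> test (h k)"
  shows "(\<Sum>\<^sub>\<infinity>b. \<Sum>k\<in>K. \<integral>x. of_bool (S k x = b) * h k x \<partial>M) = (\<Sum>k\<in>K. \<integral>x. h k x \<partial>M)"
proof -
  have hs: "((\<lambda>b. \<integral>x. of_bool (S k x = b) * h k x \<partial>M) has_sum (\<integral>x. h k x \<partial>M)) UNIV" if "k \<in> K" for k
    by (rule has_sum_integral_partition[OF S_meas test_integrable[OF assms(2)[OF that]]])
  then have "(\<lambda>b. \<integral>x. of_bool (S k x = b) * h k x \<partial>M) summable_on UNIV"
    "(\<Sum>\<^sub>\<infinity>b. \<integral>x. of_bool (S k x = b) * h k x \<partial>M) = (\<integral>x. h k x \<partial>M)" if "k \<in> K" for k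
    using that by (auto simp: summable_on_def intro: infsumI)
  then show ?thesis
    by (subst infsum_finite_sum(1)) (auto simp: assms)
qed

context
  fixes \<beta> :: "int ^ 'd \<Rightarrow> real" and B :: real and w :: "nat \<Rightarrow> nat \<Rightarrow> int ^ 'd \<Rightarrow> 'b"
  assumes \<beta>B: "\<And>b. \<bar>\<beta> b\<bar> \<le> B"
    and w0: "\<And>n a. w 0 n a = (\<Sum>k<n. T k a e)"
    and wS: "\<And>N n a. N > 0 \<Longrightarrow> w N n a = (\<Sum>l=1..n. \<Sum>j=1..N. real (N choose j) *\<^sub>R
        (\<Sum>\<^sub>\<infinity>b. \<beta> b ^ j *\<^sub>R T l (a - b) (w (N - j) (n - l) b)))"
    and w_summable: "\<And>N j l n a. j \<ge> 1 \<Longrightarrow> (\<lambda>b. \<beta> b ^ j *\<^sub>R T l (a - b) (w N n b)) summable_on UNIV"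
    and w_summable': "\<And>N j n. j \<ge> 1 \<Longrightarrow> (\<lambda>b. \<beta> b ^ j *\<^sub>R w N n b) summable_on UNIV"
begin

text \<open>Identifies the recursively defined classes with the images under P^k of L(k)^N
  restricted to S(k) = a, summed over k < n. Moving \<open>T l c\<close> to the other side of the
  pairing changes the test function, so the induction ranges over all g.\<close>

lemma pairing_w:
  "test g \<Longrightarrow> pairing g (w N n a) = (\<Sum>k<n. \<integral>x. of_bool (S k x = a) * (of_real (L \<beta> k x ^ N) * g ((F ^^ k) x)) \<partial>M)"
proof (induction N arbitrary: n a g rule: less_induct)
  case (less N)
  note g = less.prems
  note lin = bounded_linear.linear[OF pairing_linear[OF g]]
  show ?case
  proof (cases "N = 0")
    case True
    have "pairing g (T k a e) = (\<integral>x. of_bool (S k x = a) * g ((F ^^ k) x) \<partial>M)" for k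
    proof -
      have "pairing g (T k a e) = (\<integral>x. J e x * (of_bool (S k x = a) * g ((F ^^ k) x)) \<partial>M)"
        unfolding pairing_def by (rule T_duality[OF g])
      also have "\<dots> = (\<integral>x. of_bool (S k x = a) * g ((F ^^ k) x) \<partial>M)"
      proof (rule integral_cong_AE)
        have [measurable]: "(\<lambda>x. of_bool (S k x = a) * g ((F ^^ k) x)) \<in> borel_measurable M"
          using test_of_bool_mult[OF test_Fn[OF g]] by (simp add: test_def)
        show "(\<lambda>x. J e x * (of_bool (S k x = a) * g ((F ^^ k) x))) \<in> borel_measurable M"
          "(\<lambda>x. of_bool (S k x = a) * g ((F ^^ k) x)) \<in> borel_measurable M"
          by (rule borel_measurable_times, auto)
        show "AE x in M. J e x * (of_bool (S k x = a) * g ((F ^^ k) x)) = of_bool (S k x = a) * g ((F ^^ k) x)"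
          using J_e by eventually_elim simp
      qed
      finally show ?thesis .
    qed
    then show ?thesis
      using True by (simp add: w0 linear_sum[OF lin])
  next
    case False
    then have N: "N > 0" by simp
    \<comment> \<open>Last counted visit at time k with multiplicity j, then l steps ending at a.
      The site b of that visit does not occur, so summing over b is a partition of the
      space.\<close>
    define G where "G = (\<lambda>k l j x. of_real (\<beta> (S k x) ^ j * L \<beta> k x ^ (N - j)) * (of_bool (S (k + l) x = a) * g ((F ^^ (k + l)) x)))"
    have G_test: "test (G k l j)" for k l j
      unfolding G_def of_real_mult of_real_power
      by (intro test_mult test_power test_\<beta>[OF \<beta>B] test_L[OF \<beta>B] test_of_bool test_Fn g)
    have inner: "pairing g (\<Sum>\<^sub>\<infinity>b. \<beta> b ^ j *\<^sub>R T l (a - b) (w (N - j) (n - l) b)) = (\<Sum>k<n - l. \<integral>x. G k l j x \<partial>M)"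
      if j: "j \<in> {1..N}" for j l
    proof -
      have "pairing g (\<Sum>\<^sub>\<infinity>b. \<beta> b ^ j *\<^sub>R T l (a - b) (w (N - j) (n - l) b))
          = (\<Sum>\<^sub>\<infinity>b. complex_of_real (\<beta> b ^ j) * pairing g (T l (a - b) (w (N - j) (n - l) b)))"
        using j by (intro pairing_\<beta>_sum[OF g] w_summable) auto
      also have "\<dots> = (\<Sum>\<^sub>\<infinity>b. \<Sum>k<n - l. \<integral>x. of_bool (S k x = b) * G k l j x \<partial>M)"
      proof (rule infsum_cong)
        fix b
        have "pairing g (T l (a - b) (w (N - j) (n - l) b)) = (\<Sum>k<n - l. \<integral>x. of_bool (S k x = b) *
            (of_real (L \<beta> k x ^ (N - j)) * (of_bool (S l ((F ^^ k) x) = a - b) * g ((F ^^ l) ((F ^^ k) x)))) \<partial>M)"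
          unfolding pairing_T[OF g] using j by (intro less.IH test_of_bool_mult test_Fn g) auto
        then have "complex_of_real (\<beta> b ^ j) * pairing g (T l (a - b) (w (N - j) (n - l) b))
          = (\<Sum>k<n - l. \<integral>x. complex_of_real (\<beta> b ^ j) * (of_bool (S k x = b) *
            (of_real (L \<beta> k x ^ (N - j)) * (of_bool (S l ((F ^^ k) x) = a - b) * g ((F ^^ l) ((F ^^ k) x))))) \<partial>M)"
          by (simp add: sum_distrib_left)
        also have "\<dots> = (\<Sum>k<n - l. \<integral>x. of_bool (S k x = b) * G k l j x \<partial>M)"
        proof (intro sum.cong refl Bochner_Integration.integral_cong)
          fix k x
          show "complex_of_real (\<beta> b ^ j) * (of_bool (S k x = b) *
            (of_real (L \<beta> k x ^ (N - j)) * (of_bool (S l ((F ^^ k) x) = a - b) * g ((F ^^ l) ((F ^^ k) x)))))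
            = of_bool (S k x = b) * G k l j x"
          proof (cases "S k x = b")
            case True
            have "S (k + l) x = b + S l ((F ^^ k) x)"
              using True by (simp add: birkhoff_add)
            then have "(S (k + l) x = a) = (S l ((F ^^ k) x) = a - b)"
              by (auto simp: algebra_simps)
            moreover have "(F ^^ (k + l)) x = (F ^^ l) ((F ^^ k) x)"
              by (simp add: funpow_add add.commute[of k l])
            ultimately show ?thesis
              using True by (simp add: G_def)
          qed simp
        qed
        finally show "complex_of_real (\<beta> b ^ j) * pairing g (T l (a - b) (w (N - j) (n - l) b))
          = (\<Sum>k<n - l. \<integral>x. of_bool (S k x = b) * G k l j x \<partial>M)" .
      qed
      also have "\<dots> = (\<Sum>k<n - l. \<integral>x. G k l j x \<partial>M)"
        by (intro partition_sum G_test) auto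
      finally show ?thesis .
    qed
    have "pairing g (w N n a) = (\<Sum>l=1..n. \<Sum>j=1..N. real (N choose j) *\<^sub>R (\<Sum>k<n - l. \<integral>x. G k l j x \<partial>M))"
      unfolding wS[OF N] linear_sum[OF lin] linear_scale[OF lin]
      by (intro sum.cong refl arg_cong[where f="\<lambda>x. _ *\<^sub>R x"] inner)
    also have "\<dots> = (\<Sum>l=1..n. \<Sum>k<n - l. \<Sum>j=1..N. real (N choose j) *\<^sub>R (\<integral>x. G k l j x \<partial>M))"
      unfolding scaleR_sum_right by (intro sum.cong refl sum.swap)
    \<comment> \<open>Reordering by the final time m = k + l brings together all k < m, which is the
      shape required by \<open>partial_sum_power\<close>.\<close>
    also have "\<dots> = (\<Sum>m<n. \<Sum>k<m. \<Sum>j=1..N. real (N choose j) *\<^sub>R (\<integral>x. G k (m - k) j x \<partial>M))"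
      by (rule sum_triangle_diagonals)
    also have "\<dots> = (\<Sum>m<n. \<integral>x. of_bool (S m x = a) * (of_real (L \<beta> m x ^ N) * g ((F ^^ m) x)) \<partial>M)"
    proof (intro sum.cong refl)
      fix m
      have "(\<Sum>k<m. \<Sum>j=1..N. real (N choose j) *\<^sub>R (\<integral>x. G k (m - k) j x \<partial>M))
          = (\<integral>x. (\<Sum>k<m. \<Sum>j=1..N. real (N choose j) *\<^sub>R G k (m - k) j x) \<partial>M)"
        by (simp add: Bochner_Integration.integral_sum test_integrable[OF G_test])
      also have "\<dots> = (\<integral>x. of_bool (S m x = a) * (of_real (L \<beta> m x ^ N) * g ((F ^^ m) x)) \<partial>M)"
      proof (intro Bochner_Integration.integral_cong refl)
        fix x
        have "(\<Sum>k<m. \<Sum>j=1..N. real (N choose j) *\<^sub>R G k (m - k) j x)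
            = of_real (\<Sum>k<m. \<Sum>j=1..N. real (N choose j) * (\<beta> (S k x) ^ j * L \<beta> k x ^ (N - j))) * (of_bool (S m x = a) * g ((F ^^ m) x))"
          unfolding of_real_sum sum_distrib_right
          by (intro sum.cong refl) (simp add: G_def scaleR_conv_of_real)
        also have "(\<Sum>k<m. \<Sum>j=1..N. real (N choose j) * (\<beta> (S k x) ^ j * L \<beta> k x ^ (N - j))) = L \<beta> m x ^ N"
          unfolding L_def by (rule partial_sum_power[OF N])
        finally show "(\<Sum>k<m. \<Sum>j=1..N. real (N choose j) *\<^sub>R G k (m - k) j x)
            = of_bool (S m x = a) * (of_real (L \<beta> m x ^ N) * g ((F ^^ m) x))"
          by (simp add: mult_ac)
      qed
      finally show "(\<Sum>k<m. \<Sum>j=1..N. real (N choose j) *\<^sub>R (\<integral>x. G k (m - k) j x \<partial>M))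
          = (\<integral>x. of_bool (S m x = a) * (of_real (L \<beta> m x ^ N) * g ((F ^^ m) x)) \<partial>M)" .
    qed
    finally show ?thesis .
  qed
qed

text \<open>The mechanism of \<open>pairing_w\<close> without a final displacement: k is the time of
  the last counted visit, and no condition is imposed after it.\<close>

lemma E_moment:
  assumes N: "N > 0"
  shows "E (\<Sum>j=1..N. real (N choose j) *\<^sub>R (\<Sum>\<^sub>\<infinity>b. \<beta> b ^ j *\<^sub>R w (N - j) n b)) = (\<integral>x. L \<beta> n x ^ N \<partial>M)"
proof -
  let ?g = "\<lambda>_::'s. 1 :: complex"
  note g = test_const[of 1]
  note lin = bounded_linear.linear[OF pairing_linear[OF g]]
  define G where "G = (\<lambda>k j x. complex_of_real (\<beta> (S k x) ^ j * L \<beta> k x ^ (N - j)))"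
  have G_test: "test (G k j)" for k j
    unfolding G_def of_real_mult of_real_power
    by (intro test_mult test_power test_\<beta>[OF \<beta>B] test_L[OF \<beta>B])
  have inner: "pairing ?g (\<Sum>\<^sub>\<infinity>b. \<beta> b ^ j *\<^sub>R w (N - j) n b) = (\<Sum>k<n. \<integral>x. G k j x \<partial>M)"
    if j: "j \<in> {1..N}" for j
  proof -
    have "pairing ?g (\<Sum>\<^sub>\<infinity>b. \<beta> b ^ j *\<^sub>R w (N - j) n b) = (\<Sum>\<^sub>\<infinity>b. complex_of_real (\<beta> b ^ j) * pairing ?g (w (N - j) n b))"
      using j by (intro pairing_\<beta>_sum[OF g] w_summable') auto
    also have "\<dots> = (\<Sum>\<^sub>\<infinity>b. \<Sum>k<n. \<integral>x. of_bool (S k x = b) * G k j x \<partial>M)"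
    proof (rule infsum_cong)
      fix b
      have "complex_of_real (\<beta> b ^ j) * pairing ?g (w (N - j) n b)
          = (\<Sum>k<n. \<integral>x. complex_of_real (\<beta> b ^ j) * (of_bool (S k x = b) * of_real (L \<beta> k x ^ (N - j))) \<partial>M)"
        unfolding pairing_w[OF g] by (simp add: sum_distrib_left)
      also have "\<dots> = (\<Sum>k<n. \<integral>x. of_bool (S k x = b) * G k j x \<partial>M)"
        by (intro sum.cong refl Bochner_Integration.integral_cong) (auto simp: G_def)
      finally show "complex_of_real (\<beta> b ^ j) * pairing ?g (w (N - j) n b)
          = (\<Sum>k<n. \<integral>x. of_bool (S k x = b) * G k j x \<partial>M)" .
    qed
    also have "\<dots> = (\<Sum>k<n. \<integral>x. G k j x \<partial>M)"
      by (intro partition_sum G_test) auto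
    finally show ?thesis .
  qed
  have "pairing ?g (\<Sum>j=1..N. real (N choose j) *\<^sub>R (\<Sum>\<^sub>\<infinity>b. \<beta> b ^ j *\<^sub>R w (N - j) n b))
      = (\<Sum>j=1..N. real (N choose j) *\<^sub>R (\<Sum>k<n. \<integral>x. G k j x \<partial>M))"
    unfolding linear_sum[OF lin] linear_scale[OF lin]
    by (intro sum.cong refl arg_cong[where f="\<lambda>x. _ *\<^sub>R x"] inner)
  also have "\<dots> = (\<Sum>k<n. \<Sum>j=1..N. real (N choose j) *\<^sub>R (\<integral>x. G k j x \<partial>M))"
    unfolding scaleR_sum_right by (rule sum.swap)
  also have "\<dots> = (\<integral>x. (\<Sum>k<n. \<Sum>j=1..N. real (N choose j) *\<^sub>R G k j x) \<partial>M)"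
    by (simp add: Bochner_Integration.integral_sum test_integrable[OF G_test])
  also have "\<dots> = (\<integral>x. complex_of_real (L \<beta> n x ^ N) \<partial>M)"
  proof (intro Bochner_Integration.integral_cong refl)
    fix x
    have "(\<Sum>k<n. \<Sum>j=1..N. real (N choose j) *\<^sub>R G k j x)
        = of_real (\<Sum>k<n. \<Sum>j=1..N. real (N choose j) * (\<beta> (S k x) ^ j * L \<beta> k x ^ (N - j)))"
      unfolding of_real_sum by (intro sum.cong refl) (simp add: G_def scaleR_conv_of_real)
    also have "(\<Sum>k<n. \<Sum>j=1..N. real (N choose j) * (\<beta> (S k x) ^ j * L \<beta> k x ^ (N - j))) = L \<beta> n x ^ N"
      unfolding L_def by (rule partial_sum_power[OF N])
    finally show "(\<Sum>k<n. \<Sum>j=1..N. real (N choose j) *\<^sub>R G k j x) = complex_of_real (L \<beta> n x ^ N)" .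
  qed
  finally show ?thesis
    by (simp add: E_pairing del: of_real_power)
qed

end

end

section \<open>From Hypothesis A to the abstract operator estimates\<close>

lemma infsum_single:
  fixes f :: "'i \<Rightarrow> 'b::{comm_monoid_add, t2_space}"
  assumes "\<And>b. b \<noteq> c \<Longrightarrow> f b = 0"
  shows "infsum f UNIV = f c" "f summable_on UNIV"
proof -
  have "(f has_sum f c) UNIV"
    by (rule has_sum_finite_neutralI[of "{c}"]) (use assms in auto)
  then show "infsum f UNIV = f c" "f summable_on UNIV"
    by (auto simp: infsumI summable_on_def)
qed

lemma lattice_norm_minus: "lattice_norm (- a) = lattice_norm a"
proof -
  have "(\<chi> i. real_of_int ((- a) $ i)) = - (\<chi> i. real_of_int (a $ i))"
    by (simp add: vec_eq_iff)
  then show ?thesis by (simp add: lattice_norm_def)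
qed

lemma lattice_norm_nonneg: "lattice_norm a \<ge> 0"
  by (simp add: lattice_norm_def)

locale local_limit_walk = dynamical_walk M F P \<Psi> J e
  for M :: "'s measure" and F P and \<Psi> :: "'s \<Rightarrow> int ^ 'd" and J :: "'b::banach \<Rightarrow> 's \<Rightarrow> complex" and e +
  fixes \<alpha> \<Phi>0 :: real and \<aa> :: "nat \<Rightarrow> real"
  assumes d: "CARD('d) \<in> {1, 2}"
    and \<alpha>: "\<alpha> \<in> {real CARD('d)..2}"
    and hypA: "hypothesis_A M F P \<Psi> \<alpha> \<aa> J \<Phi>0"
begin

definition "p k = 1 / \<aa> k ^ CARD('d)"
definition "A = A_sum CARD('d) \<aa>"
definition "\<gamma> = (\<alpha> - real CARD('d)) / \<alpha>"
text \<open>The relative error in the local limit theorem; dividing by \<open>p k\<close> turns the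
  little-o of Hypothesis A into a null sequence.\<close>

definition "\<delta> k = onorm_L1 M (\<lambda>u x. Q_op F P \<Psi> k 0 (J u) x - complex_of_real (\<Phi>0 / \<aa> k ^ CARD('d)) * (\<integral>y. J u y \<partial>M)) / p k"

lemma aa_pos: "\<aa> k > 0"
  and aa_rv: "regularly_varying_seq (1 / \<alpha>) \<aa>"
  and A_lim: "filterlim A at_top sequentially"
  and \<Phi>0_pos: "\<Phi>0 > 0"
  and T0_bigo: "(\<lambda>n. onorm (T n 0)) \<in> O(p)"
  and \<delta>_lim: "\<delta> \<longlonglongrightarrow> 0"
proof -
  show "\<aa> k > 0" "regularly_varying_seq (1 / \<alpha>) \<aa>" "filterlim A at_top sequentially" "\<Phi>0 > 0"
    using hypA by (auto simp: hypothesis_A_def A_def)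
  show "(\<lambda>n. onorm (T n 0)) \<in> O(p)"
    using hypA by (simp add: hypothesis_A_def T_def p_def[abs_def])
  have "(\<lambda>n. onorm_L1 M (\<lambda>u x. Q_op F P \<Psi> n 0 (J u) x
      - complex_of_real (\<Phi>0 / \<aa> n ^ CARD('d)) * (\<integral>y. J u y \<partial>M))) \<in> o(p)"
    using hypA by (simp add: hypothesis_A_def p_def[abs_def])
  then show "\<delta> \<longlonglongrightarrow> 0"
    unfolding \<delta>_def[abs_def] by (rule smalloD_tendsto)
qed

lemma \<alpha>_pos: "\<alpha> > 0"
  using \<alpha> d by auto

lemma p_pos: "p k > 0"
  using aa_pos by (simp add: p_def)

lemma p_powr: "p k = \<aa> k powr (- real CARD('d))"
  using aa_pos[of k] by (simp add: p_def powr_minus powr_realpow divide_inverse)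

sublocale regular_sums p A \<gamma>
proof
  show A_eq: "A n = (\<Sum>k\<le>n. p k)" for n
    by (simp add: A_def A_sum_def p_def)
  show "p n > 0" for n by (rule p_pos)
  show "filterlim A at_top sequentially" by (rule A_lim)
  have "regularly_varying_seq (1 / \<alpha> * - real CARD('d)) p"
    using regularly_varying_seq_powr[OF aa_rv aa_pos, of "- real CARD('d)"] by (simp add: p_powr[abs_def])
  also have "1 / \<alpha> * - real CARD('d) = \<gamma> - 1"
    using \<alpha>_pos by (simp add: \<gamma>_def field_simps)
  finally show "(\<lambda>n. A (m * n + r) / A n) \<longlonglongrightarrow> real m powr \<gamma>" if "m \<ge> 1" for m r
    by (rule karamata_affine[OF A_eq p_pos A_lim _ that])
  show "0 \<le> \<gamma>" "\<gamma> \<le> 1"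
    using \<alpha> \<alpha>_pos by (auto simp: \<gamma>_def divide_le_eq)
qed

lemma T_lin: "bounded_linear (T k a)"
  unfolding T_def by (rule T_bdd)

lemma onorm_T: "norm (T k a u) \<le> onorm (T k a) * norm u"
  by (rule onorm[OF T_lin])

lemma T0_bound: "\<exists>C\<ge>0. \<forall>k u. norm (T k 0 u) \<le> C * p k * norm u"
proof -
  from T0_bigo obtain c where c: "c > 0" "\<forall>\<^sub>F n in sequentially. norm (onorm (T n 0)) \<le> c * norm (p n)"
    by (elim landau_o.bigE)
  then obtain m where m: "\<And>n. n \<ge> m \<Longrightarrow> \<bar>onorm (T n 0)\<bar> \<le> c * p n"
    using p_pos by (auto simp: eventually_sequentially less_imp_le)
  \<comment> \<open>The O-bound holds only from m on; the finitely many earlier ratios are added to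
    the constant.\<close>
  define C where "C = c + (\<Sum>k<m. \<bar>onorm (T k 0)\<bar> / p k)"
  have sum_nonneg: "(\<Sum>k<m. \<bar>onorm (T k 0)\<bar> / p k) \<ge> 0"
    using p_pos by (intro sum_nonneg divide_nonneg_nonneg) (auto intro: less_imp_le)
  have "onorm (T k 0) \<le> C * p k" for k
  proof (cases "k < m")
    case True
    have "\<bar>onorm (T k 0)\<bar> / p k \<le> (\<Sum>k<m. \<bar>onorm (T k 0)\<bar> / p k)"
      using True p_pos by (intro member_le_sum divide_nonneg_nonneg) (auto intro: less_imp_le)
    then have "\<bar>onorm (T k 0)\<bar> / p k \<le> C"
      using c by (simp add: C_def)
    then show ?thesis
      using p_pos[of k] by (simp add: divide_le_eq)
  next
    case False
    have "c * p k \<le> C * p k"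
      using sum_nonneg p_pos[of k] by (simp add: C_def)
    then show ?thesis using m[of k] False by simp
  qed
  then have "norm (T k 0 u) \<le> C * p k * norm u" for k u
    using onorm_T[of k 0 u] by (meson mult_right_mono norm_ge_zero order_trans)
  moreover have "C \<ge> 0" using c sum_nonneg by (simp add: C_def)
  ultimately show ?thesis by blast
qed

text \<open>Since \<open>J e = 1\<close> almost everywhere, subtracting the real multiple of e
  agrees, on real parts, with subtracting the complex constant in Hypothesis A.\<close>

lemma T0_asymp: "sn (T k 0 u - (\<Phi>0 * p k * E u) *\<^sub>R e) \<le> \<delta> k * p k * norm u"
proof -
  define c where "c = \<Phi>0 / \<aa> k ^ CARD('d)"
  have c: "c = \<Phi>0 * p k" by (simp add: c_def p_def)
  define D where "D = (\<lambda>u x. Q_op F P \<Psi> k 0 (J u) x - complex_of_real c * (\<integral>y. J u y \<partial>M))"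
  have D_AE: "AE x in M. D u x = J (T k 0 u) x - complex_of_real c * (\<integral>y. J u y \<partial>M)" for u
    using J_Q[of k 0 u] by eventually_elim (simp add: D_def)
  have Q_int: "integrable M (Q_op F P \<Psi> k 0 (J u))" for u
  proof -
    have "integrable M (\<lambda>x. of_bool (S k x = 0) * J u x)"
      by (rule Bochner_Integration.integrable_bound[OF J_int[of u]]) (auto simp: norm_mult)
    from Pn_duality(1)[OF this, of k] show ?thesis
      by (simp add: Q_op_def)
  qed
  have D_int: "integrable M (D u)" for u
    unfolding D_def using Q_int by simp
  obtain C where C: "\<And>u. (\<integral>x. norm (J u x) \<partial>M) \<le> C * norm u"
    using J_bound by auto
  have D_bound: "(\<integral>x. norm (D u x) \<partial>M) \<le> (\<bar>C\<bar> * onorm (T k 0) + \<bar>c\<bar> * \<bar>C\<bar>) * norm u" for u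
  proof -
    have "(\<integral>x. norm (D u x) \<partial>M) \<le> (\<integral>x. norm (J (T k 0 u) x) + norm (complex_of_real c * (\<integral>y. J u y \<partial>M)) \<partial>M)"
      using D_int by (intro integral_mono_AE) (use D_AE[of u] in \<open>auto elim!: eventually_mono intro: norm_triangle_ineq4\<close>)
    also have "\<dots> = (\<integral>x. norm (J (T k 0 u) x) \<partial>M) + \<bar>c\<bar> * norm (\<integral>y. J u y \<partial>M)"
      by (simp add: prob_space norm_mult)
    also have "\<dots> \<le> C * norm (T k 0 u) + \<bar>c\<bar> * (C * norm u)"
      by (intro add_mono mult_left_mono C order_trans[OF integral_norm_bound C]) auto
    also have "\<dots> \<le> \<bar>C\<bar> * (onorm (T k 0) * norm u) + \<bar>c\<bar> * (\<bar>C\<bar> * norm u)"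
      using onorm_T[of k 0 u] by (intro add_mono mult_mono mult_left_mono) (auto intro!: mult_right_mono)
    finally show ?thesis by (simp add: algebra_simps)
  qed
  \<comment> \<open>\<open>onorm_L1\<close> is a supremum of reals, so it dominates the ratios only
    once they are known to be bounded above. At u = 0 the ratio is 0 by division by zero.\<close>
  have ratio: "(\<integral>x. norm (D u x) \<partial>M) / norm u \<le> \<bar>C\<bar> * onorm (T k 0) + \<bar>c\<bar> * \<bar>C\<bar>" for u
    using D_bound[of u] onorm_pos_le[OF T_lin, of k 0] by (cases "u = 0") (auto simp: divide_le_eq)
  have le_onorm: "(\<integral>x. norm (D u x) \<partial>M) \<le> onorm_L1 M D * norm u"
  proof (cases "u = 0")
    case True
    then show ?thesis using D_bound[of u] by simp
  next
    case False
    have "(\<integral>x. norm (D u x) \<partial>M) / norm u \<le> onorm_L1 M D"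
      unfolding onorm_L1_def using ratio by (intro cSUP_upper bdd_aboveI2) auto
    then show ?thesis using False by (simp add: divide_le_eq)
  qed
  have AE1: "AE x in M. \<bar>Re (J (T k 0 u - (\<Phi>0 * p k * E u) *\<^sub>R e) x)\<bar> \<le> norm (D u x)"
    using J_diff[of "T k 0 u" "(\<Phi>0 * p k * E u) *\<^sub>R e"] J_scale[of "\<Phi>0 * p k * E u" e] J_e D_AE[of u]
  proof eventually_elim
    case (elim x)
    have "J (T k 0 u - (\<Phi>0 * p k * E u) *\<^sub>R e) x = J (T k 0 u) x - complex_of_real (c * E u)"
      using elim by (simp add: c scaleR_conv_of_real)
    then have "Re (J (T k 0 u - (\<Phi>0 * p k * E u) *\<^sub>R e) x) = Re (D u x)"
      using elim by (simp add: E_def c)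
    then show ?case by (simp add: abs_Re_le_cmod)
  qed
  have "sn (T k 0 u - (\<Phi>0 * p k * E u) *\<^sub>R e) \<le> (\<integral>x. norm (D u x) \<partial>M)"
    unfolding sn_def using D_int AE1 by (intro integral_mono_AE) auto
  also have "\<dots> \<le> onorm_L1 M D * norm u" by (rule le_onorm)
  also have "onorm_L1 M D = \<delta> k * p k"
    using p_pos[of k] by (simp add: \<delta>_def D_def c_def)
  finally show ?thesis .
qed

lemma walk_operators_ex: "\<exists>C0 Cn. walk_operators p A \<gamma> T e E sn \<Phi>0 C0 Cn \<delta>"
proof -
  obtain C0 where C0: "C0 \<ge> 0" "\<And>k u. norm (T k 0 u) \<le> C0 * p k * norm u"
    using T0_bound by blast
  obtain Cn where Cn: "Cn \<ge> 0" "\<And>u. sn u \<le> Cn * norm u"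
    using sn_le by blast
  have "walk_operators p A \<gamma> T e E sn \<Phi>0 C0 Cn \<delta>"
    by (intro walk_operators.intro walk_operators_axioms.intro regular_sums_axioms)
      (rule T_lin E_lin sn_triangle sn_scale Cn E_le E_T_le E_e C0 T0_asymp \<delta>_lim)+
  then show ?thesis by blast
qed

lemma local_time_moments:
  assumes N: "N > 0"
  shows "(\<lambda>n. (\<integral>x. L (\<lambda>b. of_bool (b = 0)) n x ^ N \<partial>M) / A n powr real N)
    \<longlonglongrightarrow> \<Phi>0 ^ N * fact N * Gamma (1 + \<gamma>) ^ N / Gamma (1 + real N * \<gamma>)"
proof -
  obtain C0 Cn where "walk_operators p A \<gamma> T e E sn \<Phi>0 C0 Cn \<delta>"
    using walk_operators_ex by blast
  then interpret W: walk_operators p A \<gamma> T e E sn \<Phi>0 C0 Cn \<delta> .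
  define \<beta> :: "int ^ 'd \<Rightarrow> real" where "\<beta> = (\<lambda>b. of_bool (b = 0))"
  define w where "w = rec_w T e \<beta>"
  have single: "(\<Sum>\<^sub>\<infinity>b. \<beta> b ^ j *\<^sub>R X b) = X 0" "(\<lambda>b. \<beta> b ^ j *\<^sub>R X b) summable_on UNIV" if "j \<ge> 1"
    for j and X :: "int ^ 'd \<Rightarrow> 'b"
    using infsum_single[of 0 "\<lambda>b. \<beta> b ^ j *\<^sub>R X b"] that by (auto simp: \<beta>_def)
  define V where "V = (\<lambda>N n. \<Sum>j=1..N. real (N choose j) *\<^sub>R w (N - j) n 0)"
  have V: "V N n = (\<Sum>j=1..N. real (N choose j) *\<^sub>R (\<Sum>\<^sub>\<infinity>b. \<beta> b ^ j *\<^sub>R w (N - j) n b))" for N n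
    unfolding V_def by (intro sum.cong refl) (simp add: single(1))
  have wS: "w N n 0 = (\<Sum>l=1..n. T l 0 (V N (n - l)))" if "N > 0" for N n
    unfolding w_def rec_w_pos[OF that] V_def linear_sum[OF bounded_linear.linear[OF T_lin]]
      linear_scale[OF bounded_linear.linear[OF T_lin]]
    by (intro sum.cong refl) (simp add: single(1))
  have "(\<lambda>n. E (V N n) / A n powr real N) \<longlonglongrightarrow> \<Phi>0 ^ N * fact N * Gamma (1 + \<gamma>) ^ N / Gamma (1 + real N * \<gamma>)"
    by (rule W.indicator_moments[where w="\<lambda>N n. w N n 0"]) (auto simp: w_def rec_w_0 wS[unfolded w_def] V_def N)
  moreover have "E (V N n) = (\<integral>x. L \<beta> n x ^ N \<partial>M)" for n
    unfolding V
  proof (rule E_moment[where B=1, OF _ _ _ _ _ N])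
    show "\<bar>\<beta> b\<bar> \<le> 1" for b by (simp add: \<beta>_def)
  qed (simp_all add: w_def rec_w_0 rec_w_pos single(2))
  ultimately show ?thesis by (simp add: \<beta>_def)
qed

end

section \<open>The two forms of the variance series\<close>

lemma has_sum_int_symmetric:
  fixes f :: "int \<Rightarrow> real"
  assumes sym: "\<And>k. f (- k) = f k" and s: "summable (\<lambda>l. norm (f (int (Suc l))))"
  shows "(f has_sum (f 0 + 2 * (\<Sum>l. f (int (Suc l))))) UNIV"
proof -
  let ?s = "\<Sum>l. f (int (Suc l))"
  have hs: "((\<lambda>l. f (int (Suc l))) has_sum ?s) UNIV"
    by (rule norm_summable_imp_has_sum[OF s summable_sums[OF summable_norm_cancel[OF s]]])
  have pos: "(f has_sum ?s) (range (\<lambda>l. int (Suc l)))"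
    using hs by (subst has_sum_reindex) (auto simp: inj_on_def comp_def)
  have neg: "(f has_sum ?s) (range (\<lambda>l. - int (Suc l)))"
    using hs by (subst has_sum_reindex) (auto simp: inj_on_def comp_def sym simp del: of_nat_Suc)
  have "(f has_sum (f 0 + (?s + ?s))) ({0} \<union> (range (\<lambda>l. int (Suc l)) \<union> range (\<lambda>l. - int (Suc l))))"
    by (intro has_sum_Un_disjoint pos neg) (auto intro: has_sum_finiteI)
  moreover have "{0} \<union> (range (\<lambda>l. int (Suc l)) \<union> range (\<lambda>l. - int (Suc l))) = (UNIV :: int set)"
  proof (intro equalityI subsetI UNIV_I)
    fix k :: int
    consider "k = 0" | "k > 0" | "k < 0" by linarith
    then show "k \<in> {0} \<union> (range (\<lambda>l. int (Suc l)) \<union> range (\<lambda>l. - int (Suc l)))"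
    proof cases
      case 2
      then have "k = int (Suc (nat (k - 1)))" by simp
      then show ?thesis by blast
    next
      case 3
      then have "k = - int (Suc (nat (- k - 1)))" by simp
      then show ?thesis by blast
    qed simp
  qed
  ultimately show ?thesis by simp
qed

locale centred_weights =
  fixes \<beta> :: "'i \<Rightarrow> real"
  assumes \<beta>_abs: "(\<lambda>b. \<bar>\<beta> b\<bar>) summable_on UNIV" and \<beta>_zero: "infsum \<beta> UNIV = 0"
begin

definition "bisum c = (\<Sum>\<^sub>\<infinity>(a, b)\<in>UNIV. \<beta> a * \<beta> b * c a b)"

lemma weights_product_summable: "(\<lambda>(a, b). \<bar>\<beta> a\<bar> * \<bar>\<beta> b\<bar>) summable_on UNIV"
proof -
  have "((\<lambda>b. \<bar>\<beta> a\<bar> * \<bar>\<beta> b\<bar>) has_sum (\<bar>\<beta> a\<bar> * (\<Sum>\<^sub>\<infinity>b. \<bar>\<beta> b\<bar>))) UNIV" for a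
    by (intro has_sum_cmult_right has_sum_infsum \<beta>_abs)
  moreover have "(\<lambda>a. \<bar>\<beta> a\<bar> * (\<Sum>\<^sub>\<infinity>b. \<bar>\<beta> b\<bar>)) summable_on UNIV"
    by (intro summable_on_cmult_left \<beta>_abs)
  ultimately have "(\<lambda>(a, b). \<bar>\<beta> a\<bar> * \<bar>\<beta> b\<bar>) summable_on (SIGMA a:UNIV. UNIV)"
    by (intro summable_on_SigmaI[where g="\<lambda>a. \<bar>\<beta> a\<bar> * (\<Sum>\<^sub>\<infinity>b. \<bar>\<beta> b\<bar>)"]) auto
  then show ?thesis by simp
qed

lemma bisum_summable:
  assumes "\<And>a b. \<bar>c a b\<bar> \<le> K"
  shows "(\<lambda>(a, b). \<beta> a * \<beta> b * c a b) summable_on UNIV"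
proof (rule summable_on_norm_le)
  show "(\<lambda>x. K * (case x of (a, b) \<Rightarrow> \<bar>\<beta> a\<bar> * \<bar>\<beta> b\<bar>)) summable_on UNIV"
    by (intro summable_on_cmult_right weights_product_summable)
  fix x :: "'i \<times> 'i"
  show "norm (case x of (a, b) \<Rightarrow> \<beta> a * \<beta> b * c a b) \<le> K * (case x of (a, b) \<Rightarrow> \<bar>\<beta> a\<bar> * \<bar>\<beta> b\<bar>)"
    using assms[of "fst x" "snd x"] mult_left_mono[OF assms[of "fst x" "snd x"], of "\<bar>\<beta> (fst x)\<bar> * \<bar>\<beta> (snd x)\<bar>"]
    by (simp add: case_prod_beta abs_mult mult_ac)
qed

lemma bisum_iterated:
  assumes "\<And>a b. \<bar>c a b\<bar> \<le> K"
  shows "bisum c = (\<Sum>\<^sub>\<infinity>a. \<beta> a * (\<Sum>\<^sub>\<infinity>b. \<beta> b * c a b))"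
proof -
  have "(\<lambda>(a, b). \<beta> a * \<beta> b * c a b) summable_on (SIGMA a:UNIV. UNIV)"
    using bisum_summable[OF assms] by simp
  from infsum_Sigma'_banach[OF this]
  have "bisum c = (\<Sum>\<^sub>\<infinity>a. \<Sum>\<^sub>\<infinity>b. \<beta> a * \<beta> b * c a b)"
    by (simp add: bisum_def)
  also have "\<dots> = (\<Sum>\<^sub>\<infinity>a. \<beta> a * (\<Sum>\<^sub>\<infinity>b. \<beta> b * c a b))"
    by (simp add: infsum_cmult_right'[symmetric] mult.assoc)
  finally show ?thesis .
qed

lemma bisum_swap: "bisum (\<lambda>a b. c b a) = bisum c"
proof -
  have "bisum c = (\<Sum>\<^sub>\<infinity>x\<in>prod.swap ` UNIV. case x of (a, b) \<Rightarrow> \<beta> a * \<beta> b * c a b)"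
    by (simp add: bisum_def)
  also have "\<dots> = (\<Sum>\<^sub>\<infinity>x. case prod.swap x of (a, b) \<Rightarrow> \<beta> a * \<beta> b * c a b)"
    by (subst infsum_reindex) (auto simp: comp_def inj_on_def)
  also have "\<dots> = bisum (\<lambda>a b. c b a)"
    unfolding bisum_def by (intro infsum_cong) (auto simp: mult_ac)
  finally show ?thesis by simp
qed

lemma bisum_left:
  assumes "\<And>a. \<bar>f a\<bar> \<le> K"
  shows "bisum (\<lambda>a b. f a) = 0"
proof -
  have "bisum (\<lambda>a b. f a) = (\<Sum>\<^sub>\<infinity>a. \<beta> a * (\<Sum>\<^sub>\<infinity>b. \<beta> b * f a))"
    using assms by (intro bisum_iterated)
  also have "\<dots> = 0"
    by (simp add: infsum_cmult_left' \<beta>_zero)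
  finally show ?thesis .
qed

lemma bisum_right: "(\<And>b. \<bar>f b\<bar> \<le> K) \<Longrightarrow> bisum (\<lambda>a b. f b) = 0"
  using bisum_left[of f K] bisum_swap[of "\<lambda>a b. f a"] by simp

lemma bisum_add:
  assumes "\<And>a b. \<bar>c a b\<bar> \<le> K" "\<And>a b. \<bar>c' a b\<bar> \<le> K'"
  shows "bisum (\<lambda>a b. c a b + c' a b) = bisum c + bisum c'"
proof -
  have "(\<lambda>(a, b). \<beta> a * \<beta> b * c a b) summable_on UNIV" "(\<lambda>(a, b). \<beta> a * \<beta> b * c' a b) summable_on UNIV"
    using assms by (blast intro: bisum_summable)+
  from infsum_add[OF this] show ?thesis
    unfolding bisum_def by (simp only: case_prod_unfold distrib_left)
qed

text \<open>A summand depending on one variable only is annihilated by the weights of the other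
  variable. This equates the centred and the plain double sums lag by lag.\<close>

lemma bisum_centre:
  assumes c: "\<And>a b. \<bar>c a b\<bar> \<le> K" and f: "\<And>a. \<bar>f a\<bar> \<le> K" and g: "\<And>b. \<bar>g b\<bar> \<le> K"
  shows "bisum (\<lambda>a b. c a b - f a - g b + k) = bisum c"
proof -
  have "bisum (\<lambda>a b. c a b + ((- f a) + ((- g b) + k))) = bisum c + (bisum (\<lambda>a b. - f a) + (bisum (\<lambda>a b. - g b) + bisum (\<lambda>a b. k)))"
  proof (subst bisum_add[where K=K and K'="K + (K + \<bar>k\<bar>)"], goal_cases)
    case (2 a b)
    show ?case using f[of a] g[of b] by linarith
  next
    case 3
    show ?case
    proof (subst bisum_add[where K=K and K'="K + \<bar>k\<bar>"], goal_cases)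
      case (2 a b)
      show ?case using g[of b] by linarith
    next
      case 3
      show ?case by (subst bisum_add[where K=K and K'="\<bar>k\<bar>"]) (use g in auto)
    qed (use f in auto)
  qed (use c in auto)
  moreover have "bisum (\<lambda>a b. - f a) = 0" "bisum (\<lambda>a b. - g b) = 0" "bisum (\<lambda>a b. k) = 0"
    using bisum_left[of "\<lambda>a. - f a" K] bisum_right[of "\<lambda>b. - g b" K] bisum_left[of "\<lambda>a. k" "\<bar>k\<bar>"] f g by auto
  ultimately show ?thesis by (simp add: algebra_simps)
qed

end

section \<open>Moments of centred sums under Hypothesis B\<close>

context local_limit_walk
begin

lemma walk_prob_le: "\<bar>walk_prob M F \<Psi> k a\<bar> \<le> 1"
  by (simp add: walk_prob_def)

lemma E_T_e: "E (T l a e) = walk_prob M F \<Psi> (int l) a"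
proof -
  have "(\<integral>x. J (T l a e) x * 1 \<partial>M) = (\<integral>x. J e x * (of_bool (S l x = a) * 1) \<partial>M)"
    by (rule T_duality[OF test_const])
  also have "\<dots> = (\<integral>x. of_bool (S l x = a) \<partial>M)"
  proof (rule integral_cong_AE)
    have [measurable]: "(\<lambda>x. of_bool (S l x = a) :: complex) \<in> borel_measurable M"
      using test_of_bool by (simp add: test_def)
    show "(\<lambda>x. J e x * (of_bool (S l x = a) * 1)) \<in> borel_measurable M"
      "(\<lambda>x. of_bool (S l x = a) :: complex) \<in> borel_measurable M"
      by measurable
    show "AE x in M. J e x * (of_bool (S l x = a) * 1) = of_bool (S l x = a)"
      using J_e by eventually_elim simp
  qed
  also have "\<dots> = (\<integral>x. complex_of_real (indicator {x \<in> space M. S l x = a} x) \<partial>M)"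
    by (intro Bochner_Integration.integral_cong) (auto simp: indicator_def)
  also have "\<dots> = complex_of_real (measure M {x \<in> space M. S l x = a})"
    by (simp add: Int_absorb1)
  finally show ?thesis
    by (simp add: E_def walk_prob_def)
qed

lemma hypothesis_B_bounds:
  assumes hypB: "hypothesis_B M F P \<Psi> \<alpha> \<aa> J \<Phi>0" and \<eta>: "\<eta> \<in> {0..1}"
  obtains C where "C \<ge> 0" "\<And>k a u. norm (T k a u) \<le> C * p k * norm u"
    "\<And>k a b u. norm (T k b u - T k a u) \<le> C * (lattice_norm (b - a) powr \<eta> * \<aa> k powr (- real CARD('d) - \<eta>)) * norm u"
    "\<And>k a b u. norm (T k (a - b) u - T k a u - T k (- b) u + T k 0 u)
        \<le> C * (lattice_norm a powr \<eta> * lattice_norm b powr \<eta> * \<aa> k powr (- real CARD('d) - 2 * \<eta>)) * norm u"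
proof -
  from hypB \<eta> obtain C1 C2 C3 where C1: "\<And>k a. onorm (T k a) \<le> C1 * \<aa> k powr (- real CARD('d))"
    and C2: "\<And>k a b. onorm (\<lambda>u. T k b u - T k a u) \<le> C2 * (lattice_norm (b - a) powr \<eta> * \<aa> k powr (- real CARD('d) - \<eta>))"
    and C3: "\<And>k a b. onorm (\<lambda>u. T k (b - a) u - T k b u - T k (- a) u + T k 0 u)
        \<le> C3 * ((lattice_norm a * lattice_norm b) powr \<eta> * \<aa> k powr (- real CARD('d) - 2 * \<eta>))"
    unfolding hypothesis_B_def Let_def T_def by blast
  define C where "C = \<bar>C1\<bar> + \<bar>C2\<bar> + \<bar>C3\<bar>"
  have C: "C1 \<le> C" "C2 \<le> C" "C3 \<le> C" "C \<ge> 0"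
    by (auto simp: C_def)
  have weaken: "norm (f u) \<le> C * z * norm u"
    if "bounded_linear f" "onorm f \<le> c * z" "c \<le> C" "z \<ge> 0" for f :: "'b \<Rightarrow> 'b" and u c z
  proof -
    have "norm (f u) \<le> onorm f * norm u"
      by (rule onorm[OF that(1)])
    also have "\<dots> \<le> (C * z) * norm u"
      using that(2) mult_right_mono[OF that(3,4)] by (intro mult_right_mono) auto
    finally show ?thesis .
  qed
  show thesis
  proof (rule that[of C])
    show "C \<ge> 0" by (rule C)
    show "norm (T k a u) \<le> C * p k * norm u" for k a u
      unfolding p_powr by (rule weaken[OF T_lin C1 C(1)]) simp
    show "norm (T k b u - T k a u) \<le> C * (lattice_norm (b - a) powr \<eta> * \<aa> k powr (- real CARD('d) - \<eta>)) * norm u" for k a b u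
      by (rule weaken[OF bounded_linear_sub[OF T_lin T_lin] C2 C(2)]) simp
    show "norm (T k (a - b) u - T k a u - T k (- b) u + T k 0 u)
        \<le> C * (lattice_norm a powr \<eta> * lattice_norm b powr \<eta> * \<aa> k powr (- real CARD('d) - 2 * \<eta>)) * norm u" for k a b u
    proof (rule weaken[OF _ _ C(3)])
      show "bounded_linear (\<lambda>u. T k (a - b) u - T k a u - T k (- b) u + T k 0 u)"
        by (intro bounded_linear_sub bounded_linear_add T_lin)
      show "onorm (\<lambda>u. T k (a - b) u - T k a u - T k (- b) u + T k 0 u)
          \<le> C3 * (lattice_norm a powr \<eta> * lattice_norm b powr \<eta> * \<aa> k powr (- real CARD('d) - 2 * \<eta>))"
        using C3[of k a b] by (simp add: powr_mult lattice_norm_nonneg mult_ac)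
    qed simp
  qed
qed

lemma centred_observable:
  fixes \<beta> :: "int ^ 'd \<Rightarrow> real"
  assumes \<epsilon>: "\<epsilon> \<in> {0<..<1/2}" and \<eta>: "\<eta> = (\<alpha> + \<epsilon> - real CARD('d)) / 2"
    and \<beta>: "(\<lambda>l. (1 + lattice_norm l) powr \<eta> * \<bar>\<beta> l\<bar>) summable_on UNIV" and \<beta>0: "(\<Sum>\<^sub>\<infinity>l. \<beta> l) = 0"
    and hypB: "hypothesis_B M F P \<Psi> \<alpha> \<aa> J \<Phi>0"
  shows "sigma_term M F \<Psi> \<beta> summable_on UNIV"
    "(sigma_term_centred M F \<Psi> \<beta> has_sum sigma2 M F \<Psi> \<beta>) UNIV"
    "\<exists>B. \<forall>b. \<bar>\<beta> b\<bar> \<le> B"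
    "\<And>N. N > 0 \<Longrightarrow> (\<lambda>n. (\<integral>x. L \<beta> n x ^ N \<partial>M) / A n powr (real N / 2)) \<longlonglongrightarrow>
      (if even N then fact N / 2 ^ (N div 2) * (sigma2 M F \<Psi> \<beta> * \<Phi>0) ^ (N div 2) *
        (Gamma (1 + \<gamma>) ^ (N div 2) / Gamma (1 + real (N div 2) * \<gamma>)) else 0)"
proof -
  \<comment> \<open>With \<alpha> <= 2, d >= 1 and \<epsilon> < 1/2 one gets \<eta> < 3/4, within
    the range allowed by Hypothesis B.\<close>
  have \<eta>01: "0 < \<eta>" "\<eta> \<le> 1"
    using \<epsilon> \<alpha> d by (auto simp: \<eta>)
  obtain C1 where C1: "C1 \<ge> 0" "\<And>k a u. norm (T k a u) \<le> C1 * p k * norm u"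
    "\<And>k a b u. norm (T k b u - T k a u) \<le> C1 * (lattice_norm (b - a) powr \<eta> * \<aa> k powr (- real CARD('d) - \<eta>)) * norm u"
    "\<And>k a b u. norm (T k (a - b) u - T k a u - T k (- b) u + T k 0 u)
        \<le> C1 * (lattice_norm a powr \<eta> * lattice_norm b powr \<eta> * \<aa> k powr (- real CARD('d) - 2 * \<eta>)) * norm u"
    using hypothesis_B_bounds[OF hypB, of \<eta>] \<eta>01 by (auto simp: less_imp_le)
  obtain C0 Cn where W: "walk_operators p A \<gamma> T e E sn \<Phi>0 C0 Cn \<delta>"
    using walk_operators_ex by blast
  define lam where "lam = (\<lambda>a :: int ^ 'd. lattice_norm a powr \<eta>)"
  define q where "q = (\<lambda>k. \<aa> k powr (- real CARD('d) - \<eta>))"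
  define r where "r = (\<lambda>k. \<aa> k powr (- real CARD('d) - 2 * \<eta>))"
  have r_summable: "summable r"
  proof -
    \<comment> \<open>The choice of \<eta> makes d + 2 \<eta> exceed \<alpha> by exactly \<epsilon>,
      so r varies regularly with index -(1 + \<epsilon>/\<alpha>) < -1.\<close>
    have "- real CARD('d) - 2 * \<eta> = - (\<alpha> + \<epsilon>)"
      by (simp add: \<eta> field_simps)
    moreover have "summable (\<lambda>k. \<aa> k powr (- (\<alpha> + \<epsilon>)))"
    proof (rule regularly_varying_seq_summable)
      show "regularly_varying_seq (1 / \<alpha> * (- (\<alpha> + \<epsilon>))) (\<lambda>k. \<aa> k powr (- (\<alpha> + \<epsilon>)))"
        by (rule regularly_varying_seq_powr[OF aa_rv aa_pos])
      show "1 / \<alpha> * (- (\<alpha> + \<epsilon>)) < - 1"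
        using \<alpha>_pos \<epsilon> by (simp add: field_simps)
    qed (use aa_pos in \<open>simp add: less_imp_neq[symmetric]\<close>)
    ultimately show ?thesis by (simp add: r_def)
  qed
  have one_le: "1 \<le> (1 + lattice_norm b) powr \<eta>" "lam b \<le> (1 + lattice_norm b) powr \<eta>" for b :: "int ^ 'd"
    using \<eta>01 lattice_norm_nonneg[of b] by (auto simp: lam_def intro!: ge_one_powr_ge_zero powr_mono2)
  have \<beta>_abs: "(\<lambda>b. \<bar>\<beta> b\<bar>) summable_on UNIV"
    by (rule summable_on_comparison_test[OF \<beta>]) (use mult_right_mono[OF one_le(1), of "\<bar>\<beta> _\<bar>"] in auto)
  have \<beta>_lam: "(\<lambda>b. \<bar>\<beta> b\<bar> * lam b) summable_on UNIV"
    by (rule summable_on_comparison_test[OF \<beta>])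
      (use mult_right_mono[OF one_le(2), of "\<bar>\<beta> _\<bar>"] in \<open>auto simp: lam_def mult.commute\<close>)
  interpret W: walk_recursion p A \<gamma> T e E sn \<Phi>0 C0 Cn \<delta> q r lam \<beta> C1 "rec_w T e \<beta>"
  proof (intro walk_recursion.intro walk_recursion_axioms.intro W)
    show "(q k)\<^sup>2 \<le> p k * r k" for k
      by (simp add: q_def r_def p_powr power2_eq_square powr_add[symmetric] algebra_simps)
  qed (use C1 r_summable \<beta>_abs \<beta>_lam \<beta>0 in \<open>auto simp: lam_def q_def r_def lattice_norm_minus rec_w_0 rec_w_pos\<close>)
  interpret centred_weights \<beta>
    by unfold_locales (use \<beta>_abs \<beta>0 in auto)
  show "\<exists>B. \<forall>b. \<bar>\<beta> b\<bar> \<le> B"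
    using W.\<beta>_le by blast
  have st: "sigma_term M F \<Psi> \<beta> k = bisum (\<lambda>a b. walk_prob M F \<Psi> k (b - a))" for k
    by (simp add: sigma_term_def bisum_def)
  have stc: "sigma_term_centred M F \<Psi> \<beta> k = sigma_term M F \<Psi> \<beta> k" for k
  proof -
    have "sigma_term_centred M F \<Psi> \<beta> k = bisum (\<lambda>a b. walk_prob M F \<Psi> k (b - a)
        - walk_prob M F \<Psi> k (- a) - walk_prob M F \<Psi> k b + walk_prob M F \<Psi> k 0)"
      unfolding sigma_term_centred_def bisum_def by (intro infsum_cong) (auto simp: algebra_simps)
    also have "\<dots> = sigma_term M F \<Psi> \<beta> k"
      unfolding st by (rule bisum_centre[where K=1]) (rule walk_prob_le)+
    finally show ?thesis .
  qed
  \<comment> \<open>The double difference involves a - b where the variance involves b - a: centring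
    removes the terms in one variable, and exchanging a and b does the rest.\<close>
  have \<rho>: "W.\<rho> l = sigma_term M F \<Psi> \<beta> (int l)" for l
  proof -
    have "E (W.DD l a b e) = walk_prob M F \<Psi> (int l) (a - b) - walk_prob M F \<Psi> (int l) a
        - walk_prob M F \<Psi> (int l) (- b) + walk_prob M F \<Psi> (int l) 0" for a b
      by (simp add: W.DD_def linear_diff[OF W.E_linear] linear_add[OF W.E_linear] E_T_e)
    then have "W.\<rho> l = (\<Sum>\<^sub>\<infinity>a. \<beta> a * (\<Sum>\<^sub>\<infinity>b. \<beta> b * (walk_prob M F \<Psi> (int l) (a - b) - walk_prob M F \<Psi> (int l) a
        - walk_prob M F \<Psi> (int l) (- b) + walk_prob M F \<Psi> (int l) 0)))"
      by (simp add: W.\<rho>_def)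
    also have "\<dots> = bisum (\<lambda>a b. walk_prob M F \<Psi> (int l) (a - b) - walk_prob M F \<Psi> (int l) a
        - walk_prob M F \<Psi> (int l) (- b) + walk_prob M F \<Psi> (int l) 0)"
    proof (rule bisum_iterated[symmetric, where K=4])
      fix a b
      show "\<bar>walk_prob M F \<Psi> (int l) (a - b) - walk_prob M F \<Psi> (int l) a
        - walk_prob M F \<Psi> (int l) (- b) + walk_prob M F \<Psi> (int l) 0\<bar> \<le> 4"
        using walk_prob_le[of "int l" "a - b"] walk_prob_le[of "int l" a] walk_prob_le[of "int l" "- b"]
          walk_prob_le[of "int l" 0] by linarith
    qed
    also have "\<dots> = bisum (\<lambda>a b. walk_prob M F \<Psi> (int l) (a - b))"
      by (rule bisum_centre[where K=1]) (rule walk_prob_le)+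
    also have "\<dots> = bisum (\<lambda>a b. walk_prob M F \<Psi> (int l) (b - a))"
      by (rule bisum_swap)
    finally show ?thesis by (simp add: st)
  qed
  \<comment> \<open>At time 0 the walk is at the origin, so only the diagonal a = b
    contributes.\<close>
  have st0: "sigma_term M F \<Psi> \<beta> 0 = (\<Sum>\<^sub>\<infinity>b. (\<beta> b)\<^sup>2)"
  proof -
    have wp0: "walk_prob M F \<Psi> 0 a = of_bool (a = 0)" for a
      using prob_space by (auto simp: walk_prob_def birkhoff_def)
    have "sigma_term M F \<Psi> \<beta> 0 = (\<Sum>\<^sub>\<infinity>a. \<beta> a * (\<Sum>\<^sub>\<infinity>b. \<beta> b * of_bool (b - a = 0)))"
      unfolding st wp0 by (rule bisum_iterated[where K=1]) simp
    also have "\<dots> = (\<Sum>\<^sub>\<infinity>a. \<beta> a * \<beta> a)"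
      by (intro infsum_cong) (subst infsum_single(1)[of "_"], auto)
    finally show ?thesis by (simp add: power2_eq_square)
  qed
  \<comment> \<open>The case N = 0 supplies the premise of \<open>interaction_limit\<close>, from
    which absolute summability of the lag series is read off.\<close>
  have tends0: "W.tends (\<lambda>n. (1 / A n powr (real 0 / 2 + 1)) *\<^sub>R rec_w T e \<beta> 0 n 0) (\<Phi>0 * kappa \<gamma> (real 0 / 2) * W.mu 0)"
    by (rule W.w_tends)
  have "(sigma_term M F \<Psi> \<beta> has_sum (sigma_term M F \<Psi> \<beta> 0 + 2 * (\<Sum>l. sigma_term M F \<Psi> \<beta> (int (Suc l))))) UNIV"
  proof (rule has_sum_int_symmetric)
    show "sigma_term M F \<Psi> \<beta> (- k) = sigma_term M F \<Psi> \<beta> k" for k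
      by (simp add: sigma_term_def walk_prob_def)
    show "summable (\<lambda>l. norm (sigma_term M F \<Psi> \<beta> (int (Suc l))))"
      using W.interaction_limit(1)[OF tends0] by (simp only: \<rho>)
  qed
  also have "sigma_term M F \<Psi> \<beta> 0 + 2 * (\<Sum>l. sigma_term M F \<Psi> \<beta> (int (Suc l))) = W.\<sigma>2"
    by (simp only: W.\<sigma>2_def st0 \<rho>)
  finally have hs: "(sigma_term M F \<Psi> \<beta> has_sum W.\<sigma>2) UNIV" .
  then have s2: "sigma2 M F \<Psi> \<beta> = W.\<sigma>2"
    by (simp add: sigma2_def infsumI)
  show "sigma_term M F \<Psi> \<beta> summable_on UNIV"
    using hs by (auto simp: summable_on_def)
  show "(sigma_term_centred M F \<Psi> \<beta> has_sum sigma2 M F \<Psi> \<beta>) UNIV"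
    using hs unfolding s2 by (simp only: stc[abs_def] has_sum_cong[OF stc])
  fix N :: nat assume N: "N > 0"
  have "E (W.V N n) = (\<integral>x. L \<beta> n x ^ N \<partial>M)" for n
    unfolding W.V_def
  proof (rule E_moment[where B=W.\<beta>1, OF W.\<beta>_le W.w0 W.wS _ _ N])
    fix N' j l n a assume j: "(j :: nat) \<ge> 1"
    obtain G where G: "W.w_bound N' G" using W.w_bounds by blast
    show "(\<lambda>b. \<beta> b ^ j *\<^sub>R T l (a - b) (rec_w T e \<beta> N' n b)) summable_on UNIV"
      using W.T_w_summable[of "N' + j" j G l "\<lambda>b. a - b" n] G j by simp
    show "(\<lambda>b. \<beta> b ^ j *\<^sub>R rec_w T e \<beta> N' n b) summable_on UNIV"
      by (rule W.\<beta>_sum(1)[OF j W.w_boundD(2)[OF G]])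
  qed
  then show "(\<lambda>n. (\<integral>x. L \<beta> n x ^ N \<partial>M) / A n powr (real N / 2)) \<longlonglongrightarrow>
      (if even N then fact N / 2 ^ (N div 2) * (sigma2 M F \<Psi> \<beta> * \<Phi>0) ^ (N div 2) *
        (Gamma (1 + \<gamma>) ^ (N div 2) / Gamma (1 + real (N div 2) * \<gamma>)) else 0)"
    using W.V_tends[OF N] by (simp only: W.mu_def s2)
qed

end

section \<open>Limit laws\<close>

lemma (in prob_space) distr_pair_snd:
  assumes "sigma_finite_measure N"
  shows "distr (M \<Otimes>\<^sub>M N) N snd = N"
proof (intro measure_eqI)
  interpret N: sigma_finite_measure N by (rule assms)
  fix A assume A: "A \<in> sets (distr (M \<Otimes>\<^sub>M N) N snd)"
  then have "emeasure (distr (M \<Otimes>\<^sub>M N) N snd) A = emeasure (M \<Otimes>\<^sub>M N) (space M \<times> A)"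
    by (auto simp add: emeasure_distr space_pair_measure dest: sets.sets_into_space intro!: arg_cong2[where f=emeasure])
  with A show "emeasure (distr (M \<Otimes>\<^sub>M N) N snd) A = emeasure N A"
    by (simp add: N.emeasure_pair_measure_Times emeasure_space_1)
qed simp

lemma product_with_normal:
  fixes \<nu> :: "real measure"
  assumes \<nu>: "real_distribution \<nu>"
  defines "\<Omega> \<equiv> \<nu> \<Otimes>\<^sub>M density lborel std_normal_density"
  shows "prob_space \<Omega>" "distr \<Omega> borel fst = \<nu>" "distributed \<Omega> lborel snd std_normal_density"
    "prob_space.indep_var \<Omega> borel fst borel snd" "fst \<in> borel_measurable \<Omega>" "snd \<in> borel_measurable \<Omega>"
proof -
  let ?N = "density lborel std_normal_density"
  interpret \<nu>: real_distribution \<nu> by (rule \<nu>)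
  interpret N: prob_space ?N by (rule prob_space_normal_density) simp
  interpret pair_prob_space \<nu> ?N ..
  show ps: "prob_space \<Omega>"
    unfolding \<Omega>_def by unfold_locales
  then interpret \<Omega>: prob_space \<Omega> .
  have sets: "sets \<Omega> = sets (borel \<Otimes>\<^sub>M borel)"
    unfolding \<Omega>_def by (intro sets_pair_measure_cong) auto
  show fst: "fst \<in> borel_measurable \<Omega>" and snd: "snd \<in> borel_measurable \<Omega>"
    by (simp_all add: measurable_cong_sets[OF sets refl])
  have "distr \<Omega> borel fst = distr \<Omega> \<nu> fst"
    by (intro distr_cong) auto
  also have "\<dots> = \<nu>"
    unfolding \<Omega>_def by (rule N.distr_pair_fst)
  finally show dfst: "distr \<Omega> borel fst = \<nu>" .
  have "distr \<Omega> ?N snd = ?N"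
    unfolding \<Omega>_def by (rule \<nu>.distr_pair_snd) unfold_locales
  then have dsnd: "distr \<Omega> lborel snd = ?N" "distr \<Omega> borel snd = ?N"
    by (simp_all cong: distr_cong)
  show "distributed \<Omega> lborel snd std_normal_density"
    using dsnd snd by (simp add: distributed_def)
  have "distr \<Omega> (borel \<Otimes>\<^sub>M borel) (\<lambda>x. (fst x, snd x)) = \<Omega>"
    using distr_id2[OF sets[symmetric]] by simp
  then show "\<Omega>.indep_var borel fst borel snd"
    unfolding \<Omega>.indep_var_distribution_eq dfst dsnd using fst snd by (simp add: \<Omega>_def)
qed

text \<open>Each factor kappa is the limit of convolutions divided by A(n)^(s + 1), and these
  quotients are at most 1 because A(n - l) <= A(n). It follows that the N-th Mittag-Leffler moment
  is at most N!.\<close>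

lemma (in regular_sums) Gamma_ratio_le:
  "Gamma (1 + \<gamma>) ^ N / Gamma (1 + real N * \<gamma>) \<le> 1"
proof -
  have kappa_le: "kappa \<gamma> s \<le> 1" if s: "s > 0" for s
  proof (rule LIMSEQ_le_const2[OF convolution_powr_limit[OF s]], intro exI allI impI)
    fix n
    have "(\<Sum>l\<le>n. p l * A (n - l) powr s) \<le> (\<Sum>l\<le>n. p l * A n powr s)"
      using s p_pos A_pos A_mono by (intro sum_mono mult_left_mono powr_mono2) (auto intro: less_imp_le)
    also have "\<dots> = A n powr (s + 1)"
      using A_pos[of n] by (simp add: powr_add A_eq sum_distrib_left sum_distrib_right mult_ac)
    finally show "(\<Sum>l\<le>n. p l * A (n - l) powr s) / A n powr (s + 1) \<le> 1"
      by (simp add: divide_le_eq)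
  qed
  have Gpos: "Gamma (1 + real N * \<gamma>) > 0" for N
    using \<gamma>_range by (intro Gamma_real_pos add_pos_nonneg) auto
  show ?thesis
  proof (induction N)
    case (Suc N)
    have "Gamma (1 + \<gamma>) ^ Suc N / Gamma (1 + real (Suc N) * \<gamma>)
        = kappa \<gamma> (real N) * (Gamma (1 + \<gamma>) ^ N / Gamma (1 + real N * \<gamma>))"
      using Gpos[of N] by (simp add: kappa_def add_ac)
    also have "\<dots> \<le> 1 * 1"
    proof (intro mult_mono Suc)
      show "kappa \<gamma> (real N) \<le> 1"
        using kappa_le[of "real N"] kappa_s0[OF \<gamma>_range(1)] by (cases "N = 0") auto
      show "0 \<le> Gamma (1 + \<gamma>) ^ N / Gamma (1 + real N * \<gamma>)"
        using Gpos[of N] Gpos[of 1] by simp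
    qed simp
    finally show ?case by simp
  qed simp
qed

lemma std_normal_moments:
  assumes "distributed \<Omega> lborel Z std_normal_density"
  shows "integrable \<Omega> (\<lambda>w. Z w ^ N)"
    "(\<integral>w. Z w ^ N \<partial>\<Omega>) = (if even N then fact N / (2 ^ (N div 2) * fact (N div 2)) else 0)"
proof -
  show "integrable \<Omega> (\<lambda>w. Z w ^ N)"
    using distributed_integrable[OF assms, of "\<lambda>x. x ^ N"] integrable_std_normal_moment[of N] by simp
  have "(\<integral>w. Z w ^ N \<partial>\<Omega>) = (\<integral>x. std_normal_density x * x ^ N \<partial>lborel)"
    using distributed_integral[OF assms, of "\<lambda>x. x ^ N"] by simp
  also have "\<dots> = (if even N then fact N / (2 ^ (N div 2) * fact (N div 2)) else 0)"
  proof (cases "even N")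
    case True
    then obtain k where "N = 2 * k" by blast
    then show ?thesis using integral_std_normal_moment_even[of k] by simp
  next
    case False
    then obtain k where "N = 2 * k + 1" by (blast elim: oddE)
    then show ?thesis using integral_std_normal_moment_odd[of k] by simp
  qed
  finally show "(\<integral>w. Z w ^ N \<partial>\<Omega>) = (if even N then fact N / (2 ^ (N div 2) * fact (N div 2)) else 0)" .
qed

text \<open>Valid for negative x as well, \<open>sqrt\<close> being odd; the reason is sqrt|x| <=
  max(1, |x|). It gives the integrability of all powers of the square root of the mixing
  variable.\<close>

lemma sqrt_power_le: "\<bar>sqrt x ^ N\<bar> \<le> 1 + \<bar>x ^ N\<bar>"
proof -
  have eq: "\<bar>sqrt x\<bar> = sqrt \<bar>x\<bar>"
    by (auto simp: abs_if real_sqrt_minus)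
  have "sqrt \<bar>x\<bar> \<le> max 1 \<bar>x\<bar>"
  proof (rule real_le_lsqrt)
    have "\<bar>x\<bar> \<le> max 1 \<bar>x\<bar> * 1" by simp
    also have "\<dots> \<le> max 1 \<bar>x\<bar> * max 1 \<bar>x\<bar>" by (intro mult_left_mono) auto
    finally show "\<bar>x\<bar> \<le> (max 1 \<bar>x\<bar>)\<^sup>2" by (simp add: power2_eq_square)
  qed auto
  then have "sqrt \<bar>x\<bar> ^ N \<le> max 1 \<bar>x\<bar> ^ N" by (intro power_mono) auto
  also have "\<dots> \<le> 1 + \<bar>x\<bar> ^ N" by (simp add: max_def)
  finally show ?thesis by (simp add: power_abs eq)
qed

lemma normal_mixture_moments:
  assumes \<Omega>: "prob_space \<Omega>" and Z: "distributed \<Omega> lborel Z std_normal_density"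
    and ind: "prob_space.indep_var \<Omega> borel Y borel Z"
    and Y [measurable]: "Y \<in> borel_measurable \<Omega>" and Y0: "AE w in \<Omega>. 0 \<le> Y w"
    and Yint: "\<And>N. integrable \<Omega> (\<lambda>w. Y w ^ N)" and c: "c \<ge> 0"
  shows "integrable \<Omega> (\<lambda>w. (sqrt (c * Y w) * Z w) ^ N)"
    "(\<integral>w. (sqrt (c * Y w) * Z w) ^ N \<partial>\<Omega>) = (if even N then
      c ^ (N div 2) * (\<integral>w. Y w ^ (N div 2) \<partial>\<Omega>) * (fact N / (2 ^ (N div 2) * fact (N div 2))) else 0)"
proof -
  interpret prob_space \<Omega> by (rule \<Omega>)
  have Z_meas [measurable]: "Z \<in> borel_measurable \<Omega>"
    using distributed_measurable[OF Z] by simp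
  have sqrt_int: "integrable \<Omega> (\<lambda>w. sqrt (c * Y w) ^ N)"
  proof (rule Bochner_Integration.integrable_bound)
    show "integrable \<Omega> (\<lambda>w. 1 + \<bar>c ^ N * Y w ^ N\<bar>)"
      using Yint by (intro Bochner_Integration.integrable_add integrable_abs integrable_mult_right) auto
    show "AE w in \<Omega>. norm (sqrt (c * Y w) ^ N) \<le> norm (1 + \<bar>c ^ N * Y w ^ N\<bar>)"
      using sqrt_power_le[of "c * Y _" N] by (auto simp: power_mult_distrib intro!: AE_I2)
  qed simp
  note Zm = std_normal_moments[OF Z]
  have "indep_var borel ((\<lambda>y. sqrt (c * y) ^ N) \<circ> Y) borel ((\<lambda>z. z ^ N) \<circ> Z)"
    by (rule indep_var_compose[OF ind]) auto
  then have i: "indep_var borel (\<lambda>w. sqrt (c * Y w) ^ N) borel (\<lambda>w. Z w ^ N)"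
    by (simp add: comp_def)
  show "integrable \<Omega> (\<lambda>w. (sqrt (c * Y w) * Z w) ^ N)"
    using indep_var_integrable[OF i sqrt_int Zm(1)] by (simp add: power_mult_distrib)
  have "(\<integral>w. (sqrt (c * Y w) * Z w) ^ N \<partial>\<Omega>) = (\<integral>w. sqrt (c * Y w) ^ N \<partial>\<Omega>) * (\<integral>w. Z w ^ N \<partial>\<Omega>)"
    using indep_var_lebesgue_integral[OF i sqrt_int Zm(1)] by (simp only: power_mult_distrib)
  also have "\<dots> = (if even N then
      c ^ (N div 2) * (\<integral>w. Y w ^ (N div 2) \<partial>\<Omega>) * (fact N / (2 ^ (N div 2) * fact (N div 2))) else 0)"
  proof (cases "even N")
    case True
    then obtain m where N: "N = 2 * m" by blast
    have "(\<integral>w. sqrt (c * Y w) ^ N \<partial>\<Omega>) = (\<integral>w. c ^ m * Y w ^ m \<partial>\<Omega>)"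
    proof (rule integral_cong_AE)
      show "AE w in \<Omega>. sqrt (c * Y w) ^ N = c ^ m * Y w ^ m"
        using Y0
      proof eventually_elim
        case (elim w)
        then have "(sqrt (c * Y w))\<^sup>2 = c * Y w"
          using c by simp
        then show ?case
          by (simp add: N power_mult power_mult_distrib)
      qed
    qed simp_all
    then show ?thesis
      using True N by (simp add: Zm(2))
  qed (simp add: Zm(2))
  finally show "(\<integral>w. (sqrt (c * Y w) * Z w) ^ N \<partial>\<Omega>) = (if even N then
      c ^ (N div 2) * (\<integral>w. Y w ^ (N div 2) \<partial>\<Omega>) * (fact N / (2 ^ (N div 2) * fact (N div 2))) else 0)" .
qed

lemma weak_limit_nonneg:
  assumes \<mu>: "\<And>n. real_distribution (\<mu> n)" and \<nu>: "real_distribution \<nu>" and w: "weak_conv_m \<mu> \<nu>"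
    and nn: "\<And>n. AE x in \<mu> n. 0 \<le> x"
  shows "AE x in \<nu>. 0 \<le> x"
proof -
  interpret \<nu>: real_distribution \<nu> by (rule \<nu>)
  \<comment> \<open>A bounded continuous function that vanishes exactly on the nonnegative half
    line.\<close>
  define f where "f = (\<lambda>x::real. min 1 (max 0 (- x)))"
  have cont: "continuous_on UNIV f"
    unfolding f_def by (intro continuous_intros)
  have [measurable]: "f \<in> borel_measurable borel"
    by (rule borel_measurable_continuous_onI[OF cont])
  have "(\<lambda>n. \<integral>x. f x \<partial>\<mu> n) \<longlonglongrightarrow> (\<integral>x. f x \<partial>\<nu>)"
    using cont by (intro weak_conv_imp_integral_bdd_continuous_conv[OF \<mu> \<nu> w, of _ 1])
      (auto simp: continuous_on_eq_continuous_at f_def)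
  moreover have "(\<integral>x. f x \<partial>\<mu> n) = 0" for n
  proof -
    have "AE x in \<mu> n. f x = 0"
      using nn[of n] by eventually_elim (simp add: f_def)
    then show ?thesis by (rule integral_eq_zero_AE)
  qed
  ultimately have "(\<integral>x. f x \<partial>\<nu>) = 0"
    by (simp add: LIMSEQ_const_iff)
  moreover have "integrable \<nu> f"
    by (rule \<nu>.integrable_const_bound[where B=1]) (auto simp: f_def)
  ultimately have "AE x in \<nu>. f x = 0"
    by (subst (asm) integral_nonneg_eq_0_iff_AE) (auto simp: f_def)
  then show ?thesis
    by eventually_elim (auto simp: f_def split: if_splits)
qed

context local_limit_walk
begin

lemma L_power_integrable:
  assumes "\<And>b. \<bar>\<beta> b\<bar> \<le> B"
  shows "integrable M (\<lambda>x. L \<beta> n x ^ N)"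
proof -
  have "test (\<lambda>x. complex_of_real (L \<beta> n x) ^ N)"
    by (intro test_power test_L[OF assms])
  from integrable_Re[OF test_integrable[OF this]] show ?thesis
    by (simp flip: of_real_power)
qed

abbreviation "\<beta>0 \<equiv> (\<lambda>b :: int ^ 'd. of_bool (b = 0) :: real)"

text \<open>Dividing the local times by \<Phi>0 A(n) strips the powers of \<Phi>0 from their limit
  moments. A weak subsequential limit then has the Mittag-Leffler moments, and it inherits
  nonnegativity.\<close>

lemma mittag_leffler_exists:
  obtains \<nu> where "real_distribution \<nu>" "AE y in \<nu>. 0 \<le> y" "\<And>N. integrable \<nu> (\<lambda>y. y ^ N)"
    "\<And>N. (\<integral>y. y ^ N \<partial>\<nu>) = fact N * Gamma (1 + \<gamma>) ^ N / Gamma (1 + real N * \<gamma>)"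
proof -
  define X where "X = (\<lambda>n x. 1 / (\<Phi>0 * A n) * L \<beta>0 n x)"
  have X_meas [measurable]: "X n \<in> borel_measurable M" for n
    unfolding X_def by measurable
  have X_power: "X n x ^ N = (1 / (\<Phi>0 * A n)) ^ N * L \<beta>0 n x ^ N" for n x N
    by (simp add: X_def power_mult_distrib power_divide)
  have X_int: "integrable M (\<lambda>x. X n x ^ N)" for n N
    unfolding X_power by (intro integrable_mult_right L_power_integrable[where B=1]) simp
  have X_lim: "(\<lambda>n. \<integral>x. X n x ^ N \<partial>M) \<longlonglongrightarrow> fact N * Gamma (1 + \<gamma>) ^ N / Gamma (1 + real N * \<gamma>)" for N
  proof (cases "N = 0")
    case True
    then show ?thesis by (simp add: prob_space)
  next
    case False
    then have "(\<lambda>n. 1 / \<Phi>0 ^ N * ((\<integral>x. L \<beta>0 n x ^ N \<partial>M) / A n powr real N))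
        \<longlonglongrightarrow> 1 / \<Phi>0 ^ N * (\<Phi>0 ^ N * fact N * Gamma (1 + \<gamma>) ^ N / Gamma (1 + real N * \<gamma>))"
      by (intro tendsto_mult_left local_time_moments) simp
    then show ?thesis
      using \<Phi>0_pos A_pos by (simp add: X_power powr_realpow power_divide power_mult_distrib)
  qed
  define \<mu> where "\<mu> = (\<lambda>n. distr M borel (X n))"
  have \<mu>: "real_distribution (\<mu> n)" for n
    unfolding \<mu>_def by (rule real_distribution_distr) simp
  have \<mu>_int: "integrable (\<mu> n) (\<lambda>y. y ^ N)" "(\<integral>y. y ^ N \<partial>\<mu> n) = (\<integral>x. X n x ^ N \<partial>M)" for n N
    unfolding \<mu>_def using X_int by (simp_all add: integrable_distr_eq integral_distr)
  have \<mu>_lim: "(\<lambda>n. \<integral>y. y ^ N \<partial>\<mu> n) \<longlonglongrightarrow> fact N * Gamma (1 + \<gamma>) ^ N / Gamma (1 + real N * \<gamma>)" for N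
    unfolding \<mu>_int(2) by (rule X_lim)
  obtain r \<nu> where "strict_mono r" and \<nu>: "real_distribution \<nu>" "weak_conv_m (\<mu> \<circ> r) \<nu>" "\<And>k. integrable \<nu> (\<lambda>y. y ^ k)"
    "\<And>k. (\<integral>y. y ^ k \<partial>\<nu>) = fact k * Gamma (1 + \<gamma>) ^ k / Gamma (1 + real k * \<gamma>)"
    by (rule moment_problem_solvable[OF \<mu> \<mu>_int(1) \<mu>_lim]) (rule that)
  have "AE y in \<mu> n. 0 \<le> y" for n
    unfolding \<mu>_def using \<Phi>0_pos A_pos[of n]
    by (subst AE_distr_iff) (auto simp: X_def L_def sum_nonneg less_imp_le)
  then have "AE x in (\<mu> \<circ> r) n. 0 \<le> x" for n
    unfolding comp_def .
  moreover have "real_distribution ((\<mu> \<circ> r) n)" for n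
    unfolding comp_def by (rule \<mu>)
  ultimately have "AE y in \<nu>. 0 \<le> y"
    by (intro weak_limit_nonneg[OF _ \<nu>(1,2)])
  then show thesis
    by (rule that[OF \<nu>(1) _ \<nu>(3,4)])
qed

end

theorem theorem2p3:
  fixes M :: "'s measure" and F :: "'s \<Rightarrow> 's"
    and P :: "('s \<Rightarrow> complex) \<Rightarrow> ('s \<Rightarrow> complex)"
    and \<Psi> :: "'s \<Rightarrow> int ^ 'd"
    and \<alpha> \<Phi>0 :: real and \<aa> :: "nat \<Rightarrow> real"
    and J :: "'b::banach \<Rightarrow> 's \<Rightarrow> complex"
  assumes d: "CARD('d) \<in> {1, 2}"
    and \<alpha>: "\<alpha> \<in> {real CARD('d)..2}"
    and system: "pp_dynamical_system M F"
    and transfer: "transfer_operator M F P"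
    and \<Psi>: "\<Psi> \<in> measurable M (count_space UNIV)"
    and hypA: "hypothesis_A M F P \<Psi> \<alpha> \<aa> J \<Phi>0"
  shows "\<exists>(\<Omega> :: (real \<times> real) measure) Y Z.
    prob_space \<Omega> \<and>
    mittag_leffler ((\<alpha> - real CARD('d)) / \<alpha>) \<Omega> Y \<and>
    distributed \<Omega> lborel Z std_normal_density \<and>
    prob_space.indep_var \<Omega> borel Y borel Z \<and>
    converges_dist_moments M (\<lambda>n x. 1 / A_sum CARD('d) \<aa> n * (\<Sum>k<n. of_bool (birkhoff F \<Psi> k x = 0)))
      \<Omega> (\<lambda>w. \<Phi>0 * Y w) \<and>
    (\<forall>(\<beta> :: int ^ 'd \<Rightarrow> real) \<epsilon> \<eta>.
       \<epsilon> \<in> {0<..<1/2} \<longrightarrow> \<eta> = (\<alpha> + \<epsilon> - real CARD('d)) / 2 \<longrightarrow>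
       (\<lambda>l. (1 + lattice_norm l) powr \<eta> * \<bar>\<beta> l\<bar>) summable_on UNIV \<longrightarrow>
       (\<Sum>\<^sub>\<infinity>l\<in>UNIV. \<beta> l) = 0 \<longrightarrow>
       hypothesis_B M F P \<Psi> \<alpha> \<aa> J \<Phi>0 \<longrightarrow>
         sigma_term M F \<Psi> \<beta> summable_on UNIV \<and>
         (sigma_term_centred M F \<Psi> \<beta> has_sum sigma2 M F \<Psi> \<beta>) UNIV \<and>
         0 \<le> sigma2 M F \<Psi> \<beta> \<and>
         converges_dist_moments M (\<lambda>n x. 1 / sqrt (A_sum CARD('d) \<aa> n) * (\<Sum>k<n. \<beta> (birkhoff F \<Psi> k x)))
           \<Omega> (\<lambda>w. sqrt (sigma2 M F \<Psi> \<beta> * \<Phi>0 * Y w) * Z w))"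
proof -
  obtain e where e: "AE x in M. J e x = 1"
    using hypA by (auto simp: hypothesis_A_def)
  have "L1_inclusion M J" "\<And>n a. preserved_by M J (Q_op F P \<Psi> n a)"
    "\<And>n a. bounded_linear (restrict_op M J (Q_op F P \<Psi> n a))"
    using hypA unfolding hypothesis_A_def by blast+
  then have "dynamical_walk M F P \<Psi> J e"
    using system transfer \<Psi> e by (intro dynamical_walk.intro)
  then interpret local_limit_walk M F P \<Psi> J e \<alpha> \<Phi>0 \<aa>
    by (intro local_limit_walk.intro local_limit_walk_axioms.intro d \<alpha> hypA)
  obtain \<nu> where \<nu>: "real_distribution \<nu>" "AE y in \<nu>. 0 \<le> y" "\<And>N. integrable \<nu> (\<lambda>y. y ^ N)"
    "\<And>N. (\<integral>y. y ^ N \<partial>\<nu>) = fact N * Gamma (1 + \<gamma>) ^ N / Gamma (1 + real N * \<gamma>)"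
    by (rule mittag_leffler_exists) (rule that)
  \<comment> \<open>One product space serves both conclusions and every \<beta>: the first
    coordinate carries the Mittag-Leffler law, the second an independent standard Gaussian.\<close>
  define \<Omega> where "\<Omega> = \<nu> \<Otimes>\<^sub>M density lborel std_normal_density"
  note \<Omega> = product_with_normal[OF \<nu>(1), folded \<Omega>_def]
  define Y Z :: "real \<times> real \<Rightarrow> real" where "Y = fst" and "Z = snd"
  have Y_meas [measurable]: "Y \<in> borel_measurable \<Omega>" and Z_meas [measurable]: "Z \<in> borel_measurable \<Omega>"
    using \<Omega> by (simp_all add: Y_def Z_def)
  have Y: "AE w in \<Omega>. 0 \<le> Y w" "\<And>N. integrable \<Omega> (\<lambda>w. Y w ^ N)"
    "\<And>N. (\<integral>w. Y w ^ N \<partial>\<Omega>) = fact N * Gamma (1 + \<gamma>) ^ N / Gamma (1 + real N * \<gamma>)"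
  proof -
    note dY = \<Omega>(2)[folded Y_def, symmetric]
    show "AE w in \<Omega>. 0 \<le> Y w"
      using \<nu>(2) unfolding dY by (subst (asm) AE_distr_iff) auto
    show "integrable \<Omega> (\<lambda>w. Y w ^ N)" for N
      using \<nu>(3)[of N] unfolding dY by (subst (asm) integrable_distr_eq) auto
    show "(\<integral>w. Y w ^ N \<partial>\<Omega>) = fact N * Gamma (1 + \<gamma>) ^ N / Gamma (1 + real N * \<gamma>)" for N
      using \<nu>(4)[of N] unfolding dY by (subst (asm) integral_distr) auto
  qed
  have Y_le: "(\<integral>w. Y w ^ N \<partial>\<Omega>) \<le> fact N" for N
    using mult_left_mono[OF Gamma_ratio_le[of N], of "fact N"] unfolding Y(3) by simp
  have mlY: "mittag_leffler ((\<alpha> - real CARD('d)) / \<alpha>) \<Omega> Y"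
    using Y Y_meas by (simp add: mittag_leffler_def \<gamma>_def)
  have part1: "converges_dist_moments M (\<lambda>n x. 1 / A_sum CARD('d) \<aa> n * (\<Sum>k<n. of_bool (birkhoff F \<Psi> k x = 0)))
      \<Omega> (\<lambda>w. \<Phi>0 * Y w)"
    unfolding A_def[symmetric] L_def[of \<beta>0, symmetric]
  proof (rule converges_dist_momentsI[OF prob_space_axioms \<Omega>(1)])
    show "integrable M (\<lambda>x. (1 / A n * L \<beta>0 n x) ^ N)" for n N
      unfolding power_mult_distrib by (intro integrable_mult_right L_power_integrable[where B=1]) simp
    show "integrable \<Omega> (\<lambda>w. (\<Phi>0 * Y w) ^ N)" for N
      unfolding power_mult_distrib by (intro integrable_mult_right Y)
    show "(\<lambda>n. \<integral>x. (1 / A n * L \<beta>0 n x) ^ N \<partial>M) \<longlonglongrightarrow> (\<integral>w. (\<Phi>0 * Y w) ^ N \<partial>\<Omega>)" for N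
    proof (cases "N = 0")
      case True
      then show ?thesis
        using prob_space.prob_space[OF \<Omega>(1)] by (simp add: prob_space)
    next
      case False
      then show ?thesis
        using local_time_moments[of N] A_pos by (simp add: power_mult_distrib power_divide Y(3) powr_realpow mult_ac)
    qed
    \<comment> \<open>Since the N-th moment of Y is at most N!, the growth constant may be taken to
      be \<Phi>0 squared.\<close>
    show "(\<integral>w. (\<Phi>0 * Y w) ^ (2 * k) \<partial>\<Omega>) \<le> (\<Phi>0\<^sup>2) ^ k * fact (2 * k)" for k
      unfolding power_mult_distrib using Y_le[of "2 * k"] by (simp add: power_mult mult_left_mono)
  qed auto
  have part2: "sigma_term M F \<Psi> \<beta> summable_on UNIV \<and>
         (sigma_term_centred M F \<Psi> \<beta> has_sum sigma2 M F \<Psi> \<beta>) UNIV \<and>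
         0 \<le> sigma2 M F \<Psi> \<beta> \<and>
         converges_dist_moments M (\<lambda>n x. 1 / sqrt (A_sum CARD('d) \<aa> n) * (\<Sum>k<n. \<beta> (birkhoff F \<Psi> k x)))
           \<Omega> (\<lambda>w. sqrt (sigma2 M F \<Psi> \<beta> * \<Phi>0 * Y w) * Z w)"
    if h: "\<epsilon> \<in> {0<..<1/2}" "\<eta> = (\<alpha> + \<epsilon> - real CARD('d)) / 2"
      "(\<lambda>l. (1 + lattice_norm l) powr \<eta> * \<bar>\<beta> l\<bar>) summable_on UNIV" "(\<Sum>\<^sub>\<infinity>l. \<beta> l) = 0"
      "hypothesis_B M F P \<Psi> \<alpha> \<aa> J \<Phi>0" for \<beta> :: "int ^ 'd \<Rightarrow> real" and \<epsilon> \<eta>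
  proof -
    note co = centred_observable[OF h]
    obtain B where B: "\<And>b. \<bar>\<beta> b\<bar> \<le> B"
      using co(3) by blast
    let ?s = "sigma2 M F \<Psi> \<beta>"
    have pw: "(1 / sqrt (A n)) ^ N = 1 / A n powr (real N / 2)" for n N
      using A_pos[of n] by (simp add: power_divide powr_half_sqrt[symmetric] powr_powr powr_realpow[symmetric])
    have lim: "(\<lambda>n. \<integral>x. (1 / sqrt (A n) * L \<beta> n x) ^ N \<partial>M) \<longlonglongrightarrow>
        (if even N then fact N / 2 ^ (N div 2) * (?s * \<Phi>0) ^ (N div 2) *
          (Gamma (1 + \<gamma>) ^ (N div 2) / Gamma (1 + real (N div 2) * \<gamma>)) else 0)" for N
    proof (cases "N = 0")
      case True
      then show ?thesis by (simp add: prob_space)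
    next
      case False
      then show ?thesis
        using co(4)[of N] unfolding power_mult_distrib pw by simp
    qed
    have G1: "Gamma (1 + \<gamma>) > 0"
      using \<gamma>_range by (intro Gamma_real_pos add_pos_nonneg) auto
    \<comment> \<open>At N = 2 the Gamma factors cancel, so this product is the limit of second
      moments. Its sign gives the square root in the limit variable its meaning.\<close>
    have "?s * \<Phi>0 \<ge> 0"
    proof (rule LIMSEQ_le_const)
      show "(\<lambda>n. \<integral>x. (1 / sqrt (A n) * L \<beta> n x) ^ 2 \<partial>M) \<longlonglongrightarrow> ?s * \<Phi>0"
        using lim[of 2] G1 by simp
    qed auto
    then have s0: "?s \<ge> 0"
      using \<Phi>0_pos by (simp add: zero_le_mult_iff)
    note nm = normal_mixture_moments[OF \<Omega>(1) \<Omega>(3,4)[folded Y_def Z_def] Y_meas Y(1,2) \<open>?s * \<Phi>0 \<ge> 0\<close>]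
    have "converges_dist_moments M (\<lambda>n x. 1 / sqrt (A n) * L \<beta> n x) \<Omega> (\<lambda>w. sqrt (?s * \<Phi>0 * Y w) * Z w)"
    proof (rule converges_dist_momentsI[OF prob_space_axioms \<Omega>(1)])
      show "integrable M (\<lambda>x. (1 / sqrt (A n) * L \<beta> n x) ^ N)" for n N
        unfolding power_mult_distrib by (intro integrable_mult_right L_power_integrable[OF B])
      show "integrable \<Omega> (\<lambda>w. (sqrt (?s * \<Phi>0 * Y w) * Z w) ^ N)" for N
        by (rule nm)
      have eq: "(\<integral>w. (sqrt (?s * \<Phi>0 * Y w) * Z w) ^ N \<partial>\<Omega>) =
          (if even N then fact N / 2 ^ (N div 2) * (?s * \<Phi>0) ^ (N div 2) *
          (Gamma (1 + \<gamma>) ^ (N div 2) / Gamma (1 + real (N div 2) * \<gamma>)) else 0)" for N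
        unfolding nm(2) Y(3) by (simp add: mult_ac)
      show "(\<lambda>n. \<integral>x. (1 / sqrt (A n) * L \<beta> n x) ^ N \<partial>M) \<longlonglongrightarrow> (\<integral>w. (sqrt (?s * \<Phi>0 * Y w) * Z w) ^ N \<partial>\<Omega>)" for N
        unfolding eq by (rule lim)
      show "(\<integral>w. (sqrt (?s * \<Phi>0 * Y w) * Z w) ^ (2 * k) \<partial>\<Omega>) \<le> (?s * \<Phi>0) ^ k * fact (2 * k)" for k
      proof -
        \<comment> \<open>The moment of order 2k is (\<sigma>^2 \<Phi>0)^k (2k)! times g / 2^k, and
          g <= 1; hence the growth constant \<sigma>^2 \<Phi>0.\<close>
        define g where "g = Gamma (1 + \<gamma>) ^ k / Gamma (1 + real k * \<gamma>)"
        have "1 / 2 ^ k * g \<le> 1 * 1"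
        proof (rule mult_mono)
          show "g \<le> 1" unfolding g_def by (rule Gamma_ratio_le)
          have "Gamma (1 + real k * \<gamma>) > 0"
            using \<gamma>_range by (intro Gamma_real_pos add_pos_nonneg) auto
          then show "0 \<le> g" using G1 by (simp add: g_def)
        qed auto
        then have "((?s * \<Phi>0) ^ k * fact (2 * k)) * (1 / 2 ^ k * g) \<le> ((?s * \<Phi>0) ^ k * fact (2 * k)) * 1"
          using \<open>?s * \<Phi>0 \<ge> 0\<close> by (intro mult_left_mono) auto
        then show ?thesis
          unfolding eq by (simp add: g_def mult_ac)
      qed
      show "0 \<le> ?s * \<Phi>0" by fact
    qed auto
    with co(1,2) s0 show ?thesis
      by (simp add: A_def L_def)
  qed
  show ?thesis
    using \<Omega>(1) mlY \<Omega>(3,4)[folded Y_def Z_def] part1 part2 by blast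
qed

end
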